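(* Up to equivalence of invariants: the intercalate structure invariant $\iota$ attains precisely $148$ distinct values on the set of standard division sudokus of rank $3$; the minisquare structure invariant $\mu$ attains precisely $139$ distinct values on the set of standard division sudokus of rank $3$; and the combined invariant $(\iota,\mu)$ (the pair consisting of the equivalence class of $\iota_L$ and the equivalence class of $\mu_L$) attains precisely $183$ distinct values on the set of standard division sudokus of rank $3$.
   Context: A latin square on a finite set $X$ is an array $L=(L(x,y))_{x,y\in X}$ with entries in $X$ such that every row and every column contains all symbols. Its orthogonal array is $O(L)=\{(x,y,L(x,y)):x,y\in X\}$. The standard sudoku partition of $X=\{1,\dots,9\}$ has blocks $X_1=\{1,2,3\}$, $X_2=\{4,5,6\}$, $X_3=\{7,8,9\}$. Bands, stacks and piles of $L$ are $B_i=\{(x,y,z)\in O(L):x\in X_i\}$, $S_i=\{(x,y,z)\in O(L):y\in X_i\}$, $P_i=\{(x,y,z)\in O(L):z\in X_i\}$. A standard division sudoku of rank $3$ is a latin square $L$ on $\{1,\dots,9\}$ such that for all $i,j$: every $z\in X$ occurs as a third coordinate in $B_i\cap S_j$, every $y\in X$ occurs as a second coordinate in $B_i\cap P_j$, and every $x\in X$ occurs as a first coordinate in $S_i\cap P_j$. Intercalate structure invariant. An intercalate $I$ of $L$ is a $2\times 2$ latin subsquare, i.e. a set of four elements $(x,y,z),(x,y',z'),(x',y,z'),(x',y',z)$ of $O(L)$ with $x\ne x'$, $y\ne y'$. Let $\mathrm{band}_L(I)$ (resp. $\mathrm{stack}_L(I)$, $\mathrm{pile}_L(I)$) be the unique band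 (resp. stack, pile) of $L$ that either contains $I$ or is disjoint from $I$. Then $\iota_L$ is the $\{0,1\}$-array indexed by triples (band, stack, pile) with $\iota_L(B_i,S_j,P_k)=1$ iff there is an intercalate $I$ of $L$ with $(B_i,S_j,P_k)=(\mathrm{band}_L(I),\mathrm{stack}_L(I),\mathrm{pile}_L(I))$. Two such arrays are equivalent if one is obtained from the other by a permutation of the band indices, a permutation of the stack indices and a permutation of the pile indices. Minisquare structure invariant. $\mu_L$ is the tripartite digraph whose nine vertices are the bands, stacks and piles of $L$, with directed edges as follows. For a band $B$ and a stack $S$, let $S_i,S_j$ be the two stacks different from $S$; for a column $y$ let $C_y$ be the set of symbols $z$ with $(x,y,z)\in B$ for some $x$. Then $B\to S$ is an edge iff $\{C_y:y\in X_i\}=\{C_y:y\in X_j\}$ (the minicolumns of $B\cap S_i$ and of $B\cap S_j$ yield the same collection of symbol sets). The directed edges stack $\to$ band, band $\to$ pile, pile $\to$ band, stack $\to$ pile, pile $\to$ stack are defined analogously by permuting the roles of the three coordinates: for vertices $U$, $W$ of two different types $u$, $w$, with $t$ the remaining type (types being row/column/symbol coordinates for bands/stacks/piles), $U\to W$ iff, for the two blocks $X_i,X_j$ other than the one defining $W$, $\{C_a:a\in X_i\}=\{C_a:a\in X_j\}$, where $C_a$ is the set of $t$-coordinates of the elements of $U$ whose $w$-coordinate is $a$. Two such digraphs are equivalent if one is obtained from the other by a permutation of the band vertices, a permutation of the stack vertices and a permutation of the pile vertices. *)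

theory Defs
  imports "HOL-Library.FuncSet" "HOL-Combinatorics.Permutations"
begin

section \<open>Latin squares and standard division sudokus of rank 3\<close>

definition latin_square :: "'a set \<Rightarrow> ('a \<times> 'a \<Rightarrow> 'a) \<Rightarrow> bool" where
  "latin_square X L \<longleftrightarrow> finite X \<and> L \<in> X \<times> X \<rightarrow>\<^sub>E X \<and>
     (\<forall>x\<in>X. \<forall>z\<in>X. \<exists>y\<in>X. L (x, y) = z) \<and>
     (\<forall>y\<in>X. \<forall>z\<in>X. \<exists>x\<in>X. L (x, y) = z)"

definition orth_array :: "'a set \<Rightarrow> ('a \<times> 'a \<Rightarrow> 'a) \<Rightarrow> ('a \<times> 'a \<times> 'a) set" where
  "orth_array X L = {(x, y, L (x, y)) | x y. x \<in> X \<and> y \<in> X}"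

abbreviation X9 :: "nat set" where "X9 \<equiv> {1..9}"
abbreviation Idx :: "nat set" where "Idx \<equiv> {1, 2, 3}"

definition block :: "nat \<Rightarrow> nat set" where
  "block i = {3 * i - 2..3 * i}"

lemma block_simps: "block 1 = {1, 2, 3}" "block 2 = {4, 5, 6}" "block 3 = {7, 8, 9}"
  by (auto simp: block_def)

datatype coord = Row | Column | Symbol

fun coord_val :: "coord \<Rightarrow> 'a \<times> 'a \<times> 'a \<Rightarrow> 'a" where
  "coord_val Row (x, y, z) = x"
| "coord_val Column (x, y, z) = y"
| "coord_val Symbol (x, y, z) = z"

type_synonym square = "nat \<times> nat \<Rightarrow> nat"

text \<open>Bands, stacks and piles are the slices in the row, column and symbol coordinate.\<close>

definition slice :: "square \<Rightarrow> coord \<Rightarrow> nat \<Rightarrow> (nat \<times> nat \<times> nat) set" where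
  "slice L c i = {e \<in> orth_array X9 L. coord_val c e \<in> block i}"

abbreviation band :: "square \<Rightarrow> nat \<Rightarrow> (nat \<times> nat \<times> nat) set" where "band L \<equiv> slice L Row"
abbreviation stack :: "square \<Rightarrow> nat \<Rightarrow> (nat \<times> nat \<times> nat) set" where "stack L \<equiv> slice L Column"
abbreviation pile :: "square \<Rightarrow> nat \<Rightarrow> (nat \<times> nat \<times> nat) set" where "pile L \<equiv> slice L Symbol"

definition division_sudoku :: "square \<Rightarrow> bool" where
  "division_sudoku L \<longleftrightarrow> latin_square X9 L \<and>
     (\<forall>i\<in>Idx. \<forall>j\<in>Idx.
        (\<forall>z\<in>X9. \<exists>e \<in> band L i \<inter> stack L j. coord_val Symbol e = z) \<and>
        (\<forall>y\<in>X9. \<exists>e \<in> band L i \<inter> pile L j. coord_val Column e = y) \<and>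
        (\<forall>x\<in>X9. \<exists>e \<in> stack L i \<inter> pile L j. coord_val Row e = x))"


section \<open>The intercalate structure invariant\<close>

definition intercalate :: "square \<Rightarrow> (nat \<times> nat \<times> nat) set \<Rightarrow> bool" where
  "intercalate L I \<longleftrightarrow> (\<exists>x x' y y' z z'. x \<noteq> x' \<and> y \<noteq> y' \<and>
     I = {(x, y, z), (x, y', z'), (x', y, z'), (x', y', z)} \<and> I \<subseteq> orth_array X9 L)"

text \<open>
  An intercalate takes exactly two values in each coordinate.  If both lie in the same block, one
  slice contains the intercalate (and the other two are disjoint from it); otherwise no slice
  contains it and exactly one is disjoint from it.  ``The unique slice that either contains the
  intercalate or is disjoint from it'' therefore means the slice containing it if there is one,
  and the slice disjoint from it otherwise.
\<close>

definition assoc_index :: "square \<Rightarrow> coord \<Rightarrow> (nat \<times> nat \<times> nat) set \<Rightarrow> nat" where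
  "assoc_index L c I =
     (if \<exists>i\<in>Idx. I \<subseteq> slice L c i
      then (THE i. i \<in> Idx \<and> I \<subseteq> slice L c i)
      else (THE i. i \<in> Idx \<and> I \<inter> slice L c i = {}))"

lemma assoc_index_well_defined:
  assumes "latin_square X9 L" and "intercalate L I"
  shows "if \<exists>i\<in>Idx. I \<subseteq> slice L c i
         then \<exists>!i. i \<in> Idx \<and> I \<subseteq> slice L c i
         else \<exists>!i. i \<in> Idx \<and> I \<inter> slice L c i = {}"
proof -
  obtain x x' y y' z z' where
    I: "I = {(x, y, z), (x, y', z'), (x', y, z'), (x', y', z)}" and O: "I \<subseteq> orth_array X9 L"
    using assms(2) unfolding intercalate_def by metis
  have L: "L (p, q) \<in> X9" if "p \<in> X9" "q \<in> X9" for p q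
    using assms(1) that by (auto simp: latin_square_def PiE_iff)
  have "coord_val c ` I = (case c of Row \<Rightarrow> {x, x'} | Column \<Rightarrow> {y, y'} | Symbol \<Rightarrow> {z, z'})"
    unfolding I by (cases c) (simp_all add: insert_commute)
  then obtain a b where ab: "coord_val c ` I = {a, b}"
    by (cases c) simp_all
  have sub: "I \<subseteq> slice L c i \<longleftrightarrow> a \<in> block i \<and> b \<in> block i" for i
  proof -
    have "I \<subseteq> slice L c i \<longleftrightarrow> coord_val c ` I \<subseteq> block i"
      using O by (auto simp: slice_def)
    then show ?thesis by (simp add: ab)
  qed
  have dis: "I \<inter> slice L c i = {} \<longleftrightarrow> a \<notin> block i \<and> b \<notin> block i" for i
  proof -
    have "I \<inter> slice L c i = {} \<longleftrightarrow> coord_val c ` I \<inter> block i = {}"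
      using O by (auto simp: slice_def)
    then show ?thesis by (simp add: ab)
  qed
  have "coord_val c e \<in> X9" if "e \<in> orth_array X9 L" for e
    using that L by (cases c) (auto simp: orth_array_def simp del: atLeastAtMost_iff)
  then have "coord_val c ` I \<subseteq> X9"
    using O by blast
  then have "a \<in> X9" "b \<in> X9"
    by (simp_all only: ab insert_subset)
  define K where "K = Idx"
  have ex: "\<exists>i\<in>K. v \<in> block i" if "v \<in> X9" for v
  proof -
    have "v \<in> block 1 \<or> v \<in> block 2 \<or> v \<in> block 3"
      using that unfolding block_def atLeastAtMost_iff by linarith
    then show ?thesis by (auto simp: K_def)
  qed
  have uniq: "k = k'" if "v \<in> block k" "v \<in> block k'" for v k k'
    using that unfolding block_def atLeastAtMost_iff by linarith
  obtain i j where ij: "i \<in> K" "a \<in> block i" "j \<in> K" "b \<in> block j"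
    using ex \<open>a \<in> X9\<close> \<open>b \<in> X9\<close> by metis
  have a: "a \<in> block k \<longleftrightarrow> k = i" and b: "b \<in> block k \<longleftrightarrow> k = j" if "k \<in> K" for k
    using ij uniq by metis+
  show ?thesis
  proof (cases "i = j")
    case True
    then have c: "k \<in> K \<and> I \<subseteq> slice L c k \<longleftrightarrow> k = i" for k
      using ij(1) a b sub by metis
    then have e: "\<exists>k\<in>K. I \<subseteq> slice L c k" by metis
    have "\<exists>!k. k \<in> K \<and> I \<subseteq> slice L c k" unfolding c by blast
    then show ?thesis unfolding K_def[symmetric] if_P[OF e] .
  next
    case False
    have d: "k \<in> K \<and> I \<inter> slice L c k = {} \<longleftrightarrow> k \<in> K \<and> k \<noteq> i \<and> k \<noteq> j" for k
      using a b dis by metis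
    have e: "\<not> (\<exists>k\<in>K. I \<subseteq> slice L c k)"
      using a b False sub by metis
    have "\<exists>!k. k \<in> K \<and> k \<noteq> i \<and> k \<noteq> j"
    proof (rule ex1I[of _ "6 - i - j"])
      have "i = 1 \<or> i = 2 \<or> i = 3" "j = 1 \<or> j = 2 \<or> j = 3"
        using ij(1,3) by (simp_all add: K_def)
      then show "6 - i - j \<in> K \<and> 6 - i - j \<noteq> i \<and> 6 - i - j \<noteq> j"
        using False by (elim disjE) (simp_all add: K_def)
      show "k = 6 - i - j" if "k \<in> K \<and> k \<noteq> i \<and> k \<noteq> j" for k
      proof -
        have "k = 1 \<or> k = 2 \<or> k = 3" using that by (simp add: K_def)
        with \<open>i = 1 \<or> i = 2 \<or> i = 3\<close> \<open>j = 1 \<or> j = 2 \<or> j = 3\<close> show ?thesis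
          using that False by linarith
      qed
    qed
    then show ?thesis unfolding K_def[symmetric] if_not_P[OF e] d .
  qed
qed

text \<open>Arrays are functions on \<open>Idx \<times> Idx \<times> Idx\<close> (band, stack, pile index), extended by
  \<open>undefined\<close>.\<close>

definition iota :: "square \<Rightarrow> nat \<times> nat \<times> nat \<Rightarrow> nat" where
  "iota L = (\<lambda>(i, j, k) \<in> Idx \<times> Idx \<times> Idx.
     if \<exists>I. intercalate L I \<and>
          (i, j, k) = (assoc_index L Row I, assoc_index L Column I, assoc_index L Symbol I)
     then 1 else 0)"

definition iota_equiv :: "((nat \<times> nat \<times> nat \<Rightarrow> nat) \<times> (nat \<times> nat \<times> nat \<Rightarrow> nat)) set" where
  "iota_equiv = {(A, A').
     A \<in> Idx \<times> Idx \<times> Idx \<rightarrow>\<^sub>E {0, 1} \<and> A' \<in> Idx \<times> Idx \<times> Idx \<rightarrow>\<^sub>E {0, 1} \<and>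
     (\<exists>\<pi> \<sigma> \<tau>. \<pi> permutes Idx \<and> \<sigma> permutes Idx \<and> \<tau> permutes Idx \<and>
        (\<forall>i\<in>Idx. \<forall>j\<in>Idx. \<forall>k\<in>Idx. A' (\<pi> i, \<sigma> j, \<tau> k) = A (i, j, k)))}"


section \<open>The minisquare structure invariant\<close>

text \<open>The vertices \<open>(Row, i)\<close>, \<open>(Column, i)\<close>, \<open>(Symbol, i)\<close> with \<open>i \<in> Idx\<close> are the
  bands, stacks and piles; as they are the same for all squares, a digraph is given by its
  edge set.\<close>

type_synonym vertex = "coord \<times> nat"

definition mini_set :: "square \<Rightarrow> vertex \<Rightarrow> coord \<Rightarrow> coord \<Rightarrow> nat \<Rightarrow> nat set" where
  "mini_set L U w t a = {coord_val t e | e. e \<in> slice L (fst U) (snd U) \<and> coord_val w e = a}"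

text \<open>For distinct \<open>u\<close> and \<open>w\<close> there is exactly one remaining coordinate \<open>t\<close>; the indices
  \<open>i\<close> and \<open>j\<close> range over the two blocks other than the one defining the target vertex.\<close>

definition mu :: "square \<Rightarrow> (vertex \<times> vertex) set" where
  "mu L = {((u, m), (w, n)) | u m w n. u \<noteq> w \<and> m \<in> Idx \<and> n \<in> Idx \<and>
     (\<forall>t. t \<noteq> u \<and> t \<noteq> w \<longrightarrow>
       (\<forall>i \<in> Idx - {n}. \<forall>j \<in> Idx - {n}.
          mini_set L (u, m) w t ` block i = mini_set L (u, m) w t ` block j))}"

definition mu_equiv :: "((vertex \<times> vertex) set \<times> (vertex \<times> vertex) set) set" where
  "mu_equiv = {(E, E'). E \<subseteq> (UNIV \<times> Idx) \<times> (UNIV \<times> Idx) \<and>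
     (\<exists>\<rho> :: coord \<Rightarrow> nat \<Rightarrow> nat. (\<forall>c. \<rho> c permutes Idx) \<and>
        E' = (\<lambda>((u, m), (w, n)). ((u, \<rho> u m), (w, \<rho> w n))) ` E)}"

definition iota_class :: "square \<Rightarrow> (nat \<times> nat \<times> nat \<Rightarrow> nat) set" where
  "iota_class L = iota_equiv `` {iota L}"

definition mu_class :: "square \<Rightarrow> (vertex \<times> vertex) set set" where
  "mu_class L = mu_equiv `` {mu L}"

end

theory Submission
  imports Defs "HOL-Library.Product_Lexorder"
begin

text \<open>
  Label the three points of each block of rows, columns and symbols by \<open>\<int>/3\<close>. In a division sudoku
  the entries common to band \<open>i\<close>, stack \<open>j\<close> and pile \<open>k\<close> form graphs of bijections between three
  rows, three columns and three symbols. Bijections of \<open>\<int>/3\<close> are affine, and the sudoku conditions relate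
  their slopes in such a way that, after changing the sign of the labels of some blocks, all slopes are
  \<open>1\<close> (\<open>division_sudoku_framing\<close>). The entries then satisfy \<open>y = x + \<alpha> i j k\<close> and \<open>z = y + \<beta> i j k\<close>. By
  the latin conditions \<open>\<alpha>\<close> is injective in \<open>k\<close>, \<open>\<beta>\<close> in \<open>i\<close> and \<open>\<gamma> = - (\<alpha> + \<beta>)\<close> in \<open>j\<close>, hence
  \<open>\<alpha> i j k = s i j * k + const\<close>, \<open>\<beta> i j k = t j k * i + const\<close>, \<open>\<gamma> i j k = u i k * j + const\<close> with three
  matrices \<open>s\<close>, \<open>t\<close>, \<open>u\<close> of signs, where \<open>const\<close> stands for a term free of the index
  that is multiplied by the sign.
  The three matrices come from a square iff the mixed third difference of
  \<open>s i j * k + t j k * i + u i k * j\<close> vanishes (\<open>affine_form_valid\<close>, \<open>valid_realized\<close>).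

  Both invariants depend on the signs only. An intercalate amounts to closing conditions whose
  constant terms cancel (\<open>has_intercalate_iff\<close>, \<open>iota_config\<close>). A minisquare edge means that two entries
  in a line of one sign matrix agree and that a line of another one is constant (\<open>mu_config\<close>). Both
  invariants are thus cubes indexed by band, stack and pile, and equivalence of invariants is equality
  of the least cubes obtained by permuting indices (\<open>iota_class_config\<close>, \<open>mu_class_config\<close>).

  What is left is finite. Permuting blocks and changing the sign of all labels acts on the
  configurations \<open>(s, t, u)\<close> of one and the same square, so that every square has a configuration that
  is minimal under these symmetries. An orderly search, pruned by linear relations between the three
  matrices, produces a list of valid configurations that contains all the minimal ones
  (\<open>division_sudoku_rep\<close>). The three numbers are obtained by computing the canonical cubes along this list
  (\<open>tally_reps\<close>), with the simplifier as an interpreter for a small call-by-value language.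
\<close>

section \<open>The field with three elements\<close>

text \<open>The field \<open>\<int>/3\<close>. It is an enumerated type, so that rewriting decides equations between
  concrete elements.\<close>

datatype f3 = Zer | One | Two

instantiation f3 :: comm_ring_1
begin

definition "0 = Zer"
definition "1 = One"

fun plus_f3 where
  "Zer + b = b"
| "a + Zer = a"
| "One + One = Two"
| "One + Two = Zer"
| "Two + One = Zer"
| "Two + Two = One"

fun uminus_f3 where
  "- Zer = Zer"
| "- One = Two"
| "- Two = One"

definition "a - b = a + (- b)" for a b :: f3

fun times_f3 where
  "Zer * b = Zer"
| "One * b = b"
| "Two * b = - b"

instance
proof
  fix a b c :: f3
  show "a + b + c = a + (b + c)" by (cases a; cases b; cases c) simp_all
  show "a + b = b + a" by (cases a; cases b) simp_all
  show "0 + a = a" by (simp add: zero_f3_def)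
  show "- a + a = 0" by (cases a) (simp_all add: zero_f3_def)
  show "a - b = a + - b" by (simp add: minus_f3_def)
  show "a * b * c = a * (b * c)" by (cases a; cases b; cases c) simp_all
  show "a * b = b * a" by (cases a; cases b) simp_all
  show "1 * a = a" by (simp add: one_f3_def)
  show "(a + b) * c = a * c + b * c" by (cases a; cases b; cases c) simp_all
  show "(0::f3) \<noteq> 1" by (simp add: zero_f3_def one_f3_def)
qed

end

lemma zero_f3 [simp]: "0 = Zer"
  by (simp add: zero_f3_def)

lemma f3_ring_simps [simp]:
  "a + Zer = a" "a - Zer = a" "a - a = Zer" "Zer - a = - a" "a * Zer = Zer" "a * One = a" "- (- a) = a"
  "One - Two = Two" "Two - One = One" "a + - a = Zer" "- a + a = Zer" "a * Two = - a"
  for a :: f3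
  by (cases a; simp add: minus_f3_def)+

lemma UNIV_f3: "UNIV = {Zer, One, Two}"
  using f3.exhaust by auto

instance f3 :: finite
  by standard (simp add: UNIV_f3)

lemma all_f3: "(\<forall>a. P a) \<longleftrightarrow> P Zer \<and> P One \<and> P Two"
  by (metis f3.exhaust)

lemma sum_f3: "(\<Sum>a\<in>UNIV. g a) = g Zer + g One + g Two"
  by (simp add: UNIV_f3 add.assoc)

text \<open>The signs \<open>1\<close> and \<open>-1 = 2\<close>, indexed by truth values; a matrix of truth values is then
  a matrix of signs without a side condition.\<close>

fun sg :: "bool \<Rightarrow> f3" where
  "sg True = One"
| "sg False = Two"

lemma sg_square [simp]: "sg b * sg b = One" "sg b * (sg b * a) = a"
  by (cases b; simp)+

lemma sg_eq: "sg (a = b) = sg a * sg b"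
  by (cases a; cases b; simp)

lemma sg_inject [simp]: "sg a = sg b \<longleftrightarrow> a = b"
  by (cases a; cases b; simp)

lemma sg_mult_eq: "sg b * x = y \<longleftrightarrow> x = sg b * y"
  by (cases b; cases x; cases y; simp)

text \<open>There are six permutations of three points and six affine maps of \<open>\<int>/3\<close> with slope
  \<open>1\<close> or \<open>-1\<close>, so they are the same maps. All bijections between blocks of a sudoku become linear
  algebra through this observation.\<close>

lemma inj_f3_affine:
  assumes "inj f"
  shows "\<exists>b. \<forall>x. f x = sg b * x + f Zer"
proof -
  have "f Zer \<noteq> f One" "f Zer \<noteq> f Two" "f One \<noteq> f Two"
    using assms by (auto dest: injD)
  then show ?thesis
    unfolding all_f3
    by (intro exI[of _ "f One = f Zer + One"]; cases "f Zer"; cases "f One"; cases "f Two"; simp)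
qed

section \<open>Triples and cubes\<close>

text \<open>Functions on \<^typ>\<open>f3\<close> as data: matrices and cubes with concrete entries become
  constructor terms that can be rewritten, compared and ordered lexicographically.\<close>

datatype 'a tri = Tri 'a 'a 'a

fun sel :: "'a tri \<Rightarrow> f3 \<Rightarrow> 'a" where
  "sel (Tri a b c) Zer = a"
| "sel (Tri a b c) One = b"
| "sel (Tri a b c) Two = c"

definition tab :: "(f3 \<Rightarrow> 'a) \<Rightarrow> 'a tri" where
  "tab f = Tri (f Zer) (f One) (f Two)"

lemma sel_tab [simp]: "sel (tab f) = f"
proof
  show "sel (tab f) i = f i" for i
    by (cases i) (simp_all add: tab_def)
qed

lemma sel_map_tri [simp]: "sel (map_tri f v) i = f (sel v i)"
  by (cases v; cases i) simp_all

lemma tri_eq_iff: "v = w \<longleftrightarrow> (\<forall>i. sel v i = sel w i)"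
  by (cases v; cases w) (simp add: all_f3)

instance tri :: (finite) finite
proof
  have "(UNIV :: 'a tri set) = (\<lambda>(a, b, c). Tri a b c) ` UNIV"
    by (auto simp: image_def) (metis tri.exhaust)
  then show "finite (UNIV :: 'a tri set)"
    by (metis finite finite_imageI)
qed

instantiation tri :: (linorder) linorder
begin

fun less_eq_tri where
  "Tri a b c \<le> Tri x y z \<longleftrightarrow> (if a = x then if b = y then c \<le> z else b < y else a < x)"

fun less_tri where
  "Tri a b c < Tri x y z \<longleftrightarrow> (if a = x then if b = y then c < z else b < y else a < x)"

instance
proof
  fix u v w :: "'a tri"
  show "u < v \<longleftrightarrow> u \<le> v \<and> \<not> v \<le> u" by (cases u; cases v) auto
  show "u \<le> u" by (cases u) auto
  show "u \<le> v \<Longrightarrow> v \<le> w \<Longrightarrow> u \<le> w" by (cases u; cases v; cases w) (auto split: if_splits)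
  show "u \<le> v \<Longrightarrow> v \<le> u \<Longrightarrow> u = v" by (cases u; cases v) (auto split: if_splits)
  show "u \<le> v \<or> v \<le> u" by (cases u; cases v) auto
qed

end

section \<open>Permuting the indices of a cube\<close>

definition perms :: "f3 tri list" where
  "perms = [Tri Zer One Two, Tri One Two Zer, Tri Two Zer One,
            Tri Zer Two One, Tri One Zer Two, Tri Two One Zer]"

definition permute :: "f3 tri \<Rightarrow> 'a tri \<Rightarrow> 'a tri" where
  "permute p v = map_tri (sel v) p"

lemma sel_permute [simp]: "sel (permute p v) i = sel v (sel p i)"
  by (simp add: permute_def)

lemma perms_iff: "p \<in> set perms \<longleftrightarrow> bij (sel p)"
proof -
  obtain a b c where p: "p = Tri a b c"
    by (cases p)
  have "bij (sel p) \<longleftrightarrow> inj (sel p)"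
    by (metis bij_def finite finite_UNIV_inj_surj)
  also have "\<dots> \<longleftrightarrow> a \<noteq> b \<and> a \<noteq> c \<and> b \<noteq> c"
    by (simp add: inj_def all_f3 p) blast
  also have "\<dots> \<longleftrightarrow> p \<in> set perms"
    by (cases a; cases b; cases c) (simp_all add: p perms_def)
  finally show ?thesis by simp
qed

text \<open>As an affine map a permutation has slope \<open>1\<close> iff it is even.\<close>

definition even_perm :: "f3 tri \<Rightarrow> bool" where
  "even_perm p \<longleftrightarrow> sel p One = sel p Zer + One"

lemma perm_affine:
  assumes "p \<in> set perms"
  shows "sel p i = sg (even_perm p) * i + sel p Zer"
  using assms by (cases i) (auto simp: perms_def even_perm_def)

type_synonym 'a cube = "'a tri tri tri"

definition cube :: "(f3 \<Rightarrow> f3 \<Rightarrow> f3 \<Rightarrow> 'a) \<Rightarrow> 'a cube" where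
  "cube f = tab (\<lambda>i. tab (\<lambda>j. tab (f i j)))"

definition entry :: "'a cube \<Rightarrow> f3 \<Rightarrow> f3 \<Rightarrow> f3 \<Rightarrow> 'a" where
  "entry v i j k = sel (sel (sel v i) j) k"

lemma entry_cube [simp]: "entry (cube f) = f"
  by (simp add: fun_eq_iff entry_def cube_def)

lemma cube_entry [simp]: "cube (entry v) = v"
  by (simp add: tri_eq_iff entry_def cube_def)

definition rearrange :: "f3 tri \<times> f3 tri \<times> f3 tri \<Rightarrow> 'a cube \<Rightarrow> 'a cube" where
  "rearrange = (\<lambda>(p, q, r) v. permute p (map_tri (permute q) (map_tri (map_tri (permute r)) v)))"

lemma rearr_eq: "rearrange (p, q, r) v = cube (\<lambda>i j k. entry v (sel p i) (sel q j) (sel r k))"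
  by (simp add: tri_eq_iff rearrange_def cube_def entry_def)

definition rearrangements :: "'a cube \<Rightarrow> 'a cube set" where
  "rearrangements v = {cube (\<lambda>i j k. entry v (P i) (Q j) (R k)) | P Q R. bij P \<and> bij Q \<and> bij R}"

lemma rearrangements_eq_iff: 
  "rearrangements v = rearrangements w \<longleftrightarrow>
   (\<exists>P Q R. bij P \<and> bij Q \<and> bij R \<and> (\<forall>i j k. entry w (P i) (Q j) (R k) = entry v i j k))"
  (is "_ \<longleftrightarrow> ?eq v w")
proof
  assume "rearrangements v = rearrangements w"
  moreover have "v \<in> rearrangements v"
    unfolding rearrangements_def mem_Collect_eq
    by (rule exI[of _ id], rule exI[of _ id], rule exI[of _ id]) simp
  ultimately have "v \<in> rearrangements w"
    by simp
  then obtain P Q R where "bij P" "bij Q" "bij R"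
    and v: "v = cube (\<lambda>i j k. entry w (P i) (Q j) (R k))"
    unfolding rearrangements_def mem_Collect_eq by (elim exE conjE)
  moreover have "entry w (P i) (Q j) (R k) = entry v i j k" for i j k
    by (simp add: v)
  ultimately show "?eq v w"
    by (intro exI[of _ P] exI[of _ Q] exI[of _ R]) simp
next
  have sub: "rearrangements v \<subseteq> rearrangements w" if eq: "?eq v w" for v w :: "'a cube"
  proof
    fix u assume "u \<in> rearrangements v"
    then obtain P' Q' R' where b': "bij P'" "bij Q'" "bij R'"
      and u: "u = cube (\<lambda>i j k. entry v (P' i) (Q' j) (R' k))"
      unfolding rearrangements_def mem_Collect_eq by (elim exE conjE)
    obtain P Q R where b: "bij P" "bij Q" "bij R"
      and e: "\<And>i j k. entry w (P i) (Q j) (R k) = entry v i j k"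
      using eq by (elim exE conjE) (simp (no_asm_simp))
    have "u = cube (\<lambda>i j k. entry w ((P \<circ> P') i) ((Q \<circ> Q') j) ((R \<circ> R') k))"
      by (simp add: u e)
    moreover have "bij (P \<circ> P')" "bij (Q \<circ> Q')" "bij (R \<circ> R')"
      using b b' by (simp_all add: bij_comp)
    ultimately show "u \<in> rearrangements w"
      unfolding rearrangements_def mem_Collect_eq
      by (intro exI[of _ "P \<circ> P'"] exI[of _ "Q \<circ> Q'"] exI[of _ "R \<circ> R'"] conjI)
  qed
  have sym: "?eq w v" if eq: "?eq v w"
  proof -
    obtain P Q R where b: "bij P" "bij Q" "bij R"
      and e: "\<And>i j k. entry w (P i) (Q j) (R k) = entry v i j k"
      using eq by (elim exE conjE) (simp (no_asm_simp))
    have "entry v (inv P i) (inv Q j) (inv R k) = entry w i j k" for i j k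
      using e[of "inv P i" "inv Q j" "inv R k"] b by (simp add: bij_is_surj surj_f_inv_f)
    then show ?thesis
      using b by (intro exI[of _ "inv P"] exI[of _ "inv Q"] exI[of _ "inv R"]) (simp add: bij_imp_bij_inv)
  qed
  assume "?eq v w"
  then show "rearrangements v = rearrangements w"
    by (intro equalityI sub sym)
qed

definition canon :: "'a::linorder cube \<Rightarrow> 'a cube" where
  "canon v = Min (rearrangements v)"

lemma bij_perm: "bij P \<Longrightarrow> \<exists>p\<in>set perms. sel p = P"
  by (rule bexI[of _ "tab P"]) (simp_all add: perms_iff fun_eq_iff[symmetric] fun_eq_iff)

lemma rearrangements_perms:
  "rearrangements v = (\<lambda>g. rearrange g v) ` (set perms \<times> set perms \<times> set perms)" (is "_ = ?R")
proof
  show "rearrangements v \<subseteq> ?R"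
  proof
    fix u assume "u \<in> rearrangements v"
    then obtain P Q R where b: "bij P" "bij Q" "bij R"
      and u: "u = cube (\<lambda>i j k. entry v (P i) (Q j) (R k))"
      unfolding rearrangements_def mem_Collect_eq by (elim exE conjE)
    obtain p q r where "p \<in> set perms" "q \<in> set perms" "r \<in> set perms"
      and "sel p = P" "sel q = Q" "sel r = R"
      using b bij_perm by metis
    then have "u = rearrange (p, q, r) v" "(p, q, r) \<in> set perms \<times> set perms \<times> set perms"
      by (simp_all add: u rearr_eq)
    then show "u \<in> ?R"
      by blast
  qed
  show "?R \<subseteq> rearrangements v"
    unfolding rearrangements_def by (auto simp: rearr_eq perms_iff) blast
qed

lemma finite_rearrangements: "finite (rearrangements v)" and rearrangements_nonempty: "rearrangements v \<noteq> {}"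
  unfolding rearrangements_perms by (simp_all add: perms_def)

text \<open>Two orbits of the group of index permutations are equal or disjoint, so the least element of
  the orbit decides equivalence.\<close>

lemma canon_eq_iff: "canon v = canon w \<longleftrightarrow>
   (\<exists>P Q R. bij P \<and> bij Q \<and> bij R \<and> (\<forall>i j k. entry w (P i) (Q j) (R k) = entry v i j k))"
proof -
  have "canon x \<in> rearrangements x" for x :: "'a cube"
    unfolding canon_def using finite_rearrangements rearrangements_nonempty by (rule Min_in)
  moreover have "rearrangements u = rearrangements x" if mem: "u \<in> rearrangements x" for u x :: "'a cube"
  proof -
    obtain P Q R where "bij P" "bij Q" "bij R" "u = cube (\<lambda>i j k. entry x (P i) (Q j) (R k))"
      using mem unfolding rearrangements_def mem_Collect_eq by (elim exE conjE)
    then show ?thesis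
      unfolding rearrangements_eq_iff
      by (intro exI[of _ P] exI[of _ Q] exI[of _ R]) simp
  qed
  ultimately have "canon v = canon w \<longleftrightarrow> rearrangements v = rearrangements w"
    by (metis canon_def)
  then show ?thesis
    by (simp add: rearrangements_eq_iff)
qed

section \<open>Labels for the points of the blocks\<close>

fun num3 :: "f3 \<Rightarrow> nat" where
  "num3 Zer = 0"
| "num3 One = 1"
| "num3 Two = 2"

definition block_index :: "f3 \<Rightarrow> nat" where
  "block_index i = num3 i + 1"

definition point :: "f3 \<Rightarrow> f3 \<Rightarrow> nat" where
  "point i x = 3 * num3 i + num3 x + 1"

lemma bij_block_index: "bij_betw block_index UNIV Idx"
  by (auto simp: bij_betw_def inj_def UNIV_f3 all_f3 block_index_def)

lemma point_inject: "point i x = point i' x' \<longleftrightarrow> i = i' \<and> x = x'"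
  by (cases i; cases i'; cases x; cases x'; simp add: point_def)

lemma block_eq_range: "block (block_index i) = range (point i)"
  by (cases i) (auto simp: block_def block_index_def point_def UNIV_f3)

lemma bij_point: "bij_betw (point i) UNIV (block (block_index i))"
  by (auto simp: bij_betw_def block_eq_range inj_def point_inject)

lemma X9_points: "X9 = {point i x | i x. True}"
proof -
  have "X9 = block 1 \<union> block 2 \<union> block 3"
    by (auto simp: block_def)
  also have "\<dots> = block (block_index Zer) \<union> block (block_index One) \<union> block (block_index Two)"
    by (simp add: block_index_def numeral_eq_Suc)
  also have "\<dots> = (\<Union>i. block (block_index i))"
    by (simp add: UNIV_f3 Un_assoc)
  also have "\<dots> = {point i x | i x. True}"
    by (auto simp: block_eq_range)
  finally show ?thesis .
qed

lemma point_in_X9: "point i x \<in> X9"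
  unfolding X9_points by blast

text \<open>The map \<open>R i\<close> labels the three points of the block with number \<open>p i\<close> by
  \<^typ>\<open>f3\<close>. The renumbering \<open>p\<close> of the blocks is part of the labelling because the invariants are
  considered up to such renumberings.\<close>

definition block_labels :: "(f3 \<Rightarrow> f3) \<Rightarrow> (f3 \<Rightarrow> f3 \<Rightarrow> nat) \<Rightarrow> bool" where
  "block_labels p R \<longleftrightarrow> bij p \<and> (\<forall>i. bij_betw (R i) UNIV (block (block_index (p i))))"

lemma block_disjoint: "a \<in> block (block_index i) \<Longrightarrow> a \<in> block (block_index j) \<Longrightarrow> i = j"
  by (auto simp: block_eq_range point_inject)

lemma labels_in_block:
  assumes "block_labels p R"
  shows "R i x \<in> block (block_index (p j)) \<longleftrightarrow> i = j"
proof -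
  have "R i x \<in> block (block_index (p i))"
    using assms by (auto simp: block_labels_def bij_betw_def)
  moreover have "inj p"
    using assms by (simp add: block_labels_def bij_is_inj)
  ultimately show ?thesis
    by (metis block_disjoint injD)
qed

lemma labels_inject:
  assumes "block_labels p R"
  shows "R i x = R i' x' \<longleftrightarrow> i = i' \<and> x = x'"
proof -
  have "i = i'" if "R i x = R i' x'"
    using that labels_in_block[OF assms, of i x i'] labels_in_block[OF assms, of i' x' i'] by simp
  moreover have "inj (R i)"
    using assms by (simp add: block_labels_def bij_betw_def)
  ultimately show ?thesis
    by (auto dest: injD)
qed

lemma labels_block:
  assumes "block_labels p R"
  shows "block (block_index (p i)) = range (R i)"
  using assms by (simp add: block_labels_def bij_betw_def)

lemma labels_X9:
  assumes "block_labels p R"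
  shows "X9 = {R i x | i x. True}"
proof -
  have "surj p"
    using assms by (simp add: block_labels_def bij_is_surj)
  have "X9 = (\<Union>i. block (block_index i))"
    unfolding X9_points block_eq_range by auto
  also have "\<dots> = (\<Union>i. block (block_index (p i)))"
    using \<open>surj p\<close> by (metis image_image)
  also have "\<dots> = {R i x | i x. True}"
    by (auto simp: labels_block[OF assms])
  finally show ?thesis .
qed

text \<open>A square is framed if, in suitable labels, the entries common to band \<open>i\<close>, stack \<open>j\<close> and
  pile \<open>k\<close> are the three translates \<open>(x, x + \<alpha> i j k, x + \<alpha> i j k + \<beta> i j k)\<close> of one triple.\<close>

definition framing ::
  "square \<Rightarrow> (coord \<Rightarrow> f3 \<Rightarrow> f3) \<Rightarrow> (coord \<Rightarrow> f3 \<Rightarrow> f3 \<Rightarrow> nat) \<Rightarrow>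
   (f3 \<Rightarrow> f3 \<Rightarrow> f3 \<Rightarrow> f3) \<Rightarrow> (f3 \<Rightarrow> f3 \<Rightarrow> f3 \<Rightarrow> f3) \<Rightarrow> bool" where
  "framing L \<pi> lab \<alpha> \<beta> \<longleftrightarrow>
     (\<forall>c. block_labels (\<pi> c) (lab c)) \<and>
     (\<forall>i x j y k z. L (lab Row i x, lab Column j y) = lab Symbol k z \<longleftrightarrow>
        y = x + \<alpha> i j k \<and> z = y + \<beta> i j k)"

section \<open>Framings of division sudokus\<close>

definition is_sign :: "f3 \<Rightarrow> bool" where
  "is_sign e \<longleftrightarrow> e * e = One"

lemma is_sign_cases: "is_sign e \<longleftrightarrow> e = One \<or> e = Two"
  by (cases e) (simp_all add: is_sign_def)

lemma inj_f3_affine':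
  assumes "inj (f :: f3 \<Rightarrow> f3)"
  shows "\<exists>e. is_sign e \<and> (\<forall>x. f x = e * x + f Zer)"
  using inj_f3_affine[OF assms] by (metis is_sign_def sg_square(1))

lemma surj_f3_inj: "(\<And>b. \<exists>a. f a = b) \<Longrightarrow> inj (f :: f3 \<Rightarrow> f3)"
  by (rule finite_UNIV_surj_inj) (simp, metis surj_def)

text \<open>Lines with different slopes meet.\<close>

lemma affine_disjoint:
  assumes "is_sign e" "is_sign e'" "\<And>x. e * x + c \<noteq> e' * x + c'"
  shows "e = e'"
  using assms(1,2) assms(3)[of Zer] assms(3)[of One] assms(3)[of Two]
  unfolding is_sign_cases
  by (cases c; cases c'; auto)

definition cell :: "square \<Rightarrow> f3 \<Rightarrow> f3 \<Rightarrow> f3 \<Rightarrow> f3 \<Rightarrow> f3 \<Rightarrow> f3 \<Rightarrow> bool" where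
  "cell L i x j y k z \<longleftrightarrow> L (point i x, point j y) = point k z"

text \<open>The latin conditions give existence and uniqueness for two given coordinates; the sudoku
  conditions give existence when one coordinate is known exactly and the other two up to their block.\<close>

lemma division_sudoku_cells:
  assumes L: "division_sudoku L"
  shows "\<exists>k z. cell L i x j y k z"
    and "cell L i x j y k z \<Longrightarrow> cell L i x j y k' z' \<Longrightarrow> k = k' \<and> z = z'"
    and "\<exists>j y. cell L i x j y k z"
    and "cell L i x j y k z \<Longrightarrow> cell L i x j' y' k z \<Longrightarrow> j = j' \<and> y = y'"
    and "\<exists>i x. cell L i x j y k z"
    and "cell L i x j y k z \<Longrightarrow> cell L i' x' j y k z \<Longrightarrow> i = i' \<and> x = x'"
    and "\<exists>x y. cell L i x j y k z"
    and "\<exists>x z. cell L i x j y k z"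
    and "\<exists>y z. cell L i x j y k z"
proof -
  have lat: "latin_square X9 L"
    using L by (simp add: division_sudoku_def)
  have X: "L (a, b) \<in> X9" if "a \<in> X9" "b \<in> X9" for a b
    using lat that by (auto simp: latin_square_def PiE_iff)
  have r: "\<forall>x\<in>X9. \<forall>z\<in>X9. \<exists>y\<in>X9. L (x, y) = z"
    using lat unfolding latin_square_def by (elim conjE)
  have c: "\<forall>y\<in>X9. \<forall>z\<in>X9. \<exists>x\<in>X9. L (x, y) = z"
    using lat unfolding latin_square_def by (elim conjE)
  have rows: "(\<lambda>b. L (a, b)) ` X9 = X9" if "a \<in> X9" for a
    using r[rule_format, OF that] X[OF that] by (fast intro: rev_image_eqI)
  have cols: "(\<lambda>a. L (a, b)) ` X9 = X9" if "b \<in> X9" for b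
    using c[rule_format, OF that] X[OF _ that] by (fast intro: rev_image_eqI)
  have row_inj: "inj_on (\<lambda>b. L (a, b)) X9" if "a \<in> X9" for a
    using rows[OF that] by (simp add: eq_card_imp_inj_on)
  have col_inj: "inj_on (\<lambda>a. L (a, b)) X9" if "b \<in> X9" for b
    using cols[OF that] by (simp add: eq_card_imp_inj_on)
  show "\<exists>k z. cell L i x j y k z"
    using X[OF point_in_X9[of i x] point_in_X9[of j y]] unfolding X9_points cell_def by blast
  show "k = k' \<and> z = z'" if "cell L i x j y k z" "cell L i x j y k' z'"
    using that by (simp add: cell_def point_inject)
  have "point k z \<in> (\<lambda>b. L (point i x, b)) ` X9"
    by (simp only: rows[OF point_in_X9] point_in_X9)
  then show "\<exists>j y. cell L i x j y k z"
    unfolding X9_points cell_def by force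
  have "point k z \<in> (\<lambda>a. L (a, point j y)) ` X9"
    by (simp only: cols[OF point_in_X9] point_in_X9)
  then show "\<exists>i x. cell L i x j y k z"
    unfolding X9_points cell_def by force
  show "j = j' \<and> y = y'" if "cell L i x j y k z" "cell L i x j' y' k z"
    using inj_onD[OF row_inj[OF point_in_X9[of i x]], of "point j y" "point j' y'"] that point_in_X9
    by (simp add: cell_def point_inject)
  show "i = i' \<and> x = x'" if "cell L i x j y k z" "cell L i' x' j y k z"
    using inj_onD[OF col_inj[OF point_in_X9[of j y]], of "point i x" "point i' x'"] that point_in_X9
    by (simp add: cell_def point_inject)
  have block_index: "block_index i \<in> Idx" for i
    using bij_block_index by (auto simp: bij_betw_def)
  have sud: "\<exists>e \<in> band L (block_index i) \<inter> stack L (block_index j). coord_val Symbol e = point k z"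
     "\<exists>e \<in> band L (block_index i) \<inter> pile L (block_index k). coord_val Column e = point j y"
     "\<exists>e \<in> stack L (block_index j) \<inter> pile L (block_index k). coord_val Row e = point i x" for i j k x y z
    using L block_index point_in_X9 unfolding division_sudoku_def by meson+
  show "\<exists>x y. cell L i x j y k z"
    using sud(1)[of i j k z] by (force simp: slice_def orth_array_def block_eq_range cell_def)
  show "\<exists>x z. cell L i x j y k z"
    using sud(2)[of i k j y] by (force simp: slice_def orth_array_def block_eq_range cell_def)
  show "\<exists>y z. cell L i x j y k z"
    using sud(3)[of j k i x] by (force simp: slice_def orth_array_def block_eq_range cell_def)
qed

text \<open>In a fixed row, a pile occupies three cells, and these meet all three stacks; hence exactly
  one of them lies in each stack. By this and its two analogues, the entries common to a band, a stack
  and a pile form the graphs of bijections \<open>Y\<close> (row to column) and \<open>Z\<close> (column to symbol), which are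
  affine. For a fixed band and stack the maps \<open>Y\<close> of the three piles disagree everywhere, so they have
  the same slope; in the same way the slope of \<open>Z\<close> does not depend on the band, and that of the
  composition does not depend on the stack.\<close>

lemma division_sudoku_affine:
  assumes L: "division_sudoku L"
  obtains e f c d where "\<And>i j. is_sign (e i j)" and "\<And>j k. is_sign (f j k)"
    and "\<And>i j j' k. f j k * e i j = f j' k * e i j'"
    and "\<And>i x j y k z. L (point i x, point j y) = point k z \<longleftrightarrow>
           y = e i j * x + c i j k \<and> z = f j k * y + d i j k"
proof -
  note C = division_sudoku_cells[OF L]
  \<comment> \<open>For a fixed row and pile, the symbol determines the stack; all stacks occur, so the
    three symbols of the pile lie in different stacks.\<close>
  have inner_column: "y = y' \<and> z = z'" if "cell L i x j y k z" "cell L i x j y' k z'" for i x j y y' k z z'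
  proof -
    obtain J where J: "\<And>z. \<exists>y. cell L i x (J z) y k z"
      using C(3)[of i x k] by metis
    have "J z = j" if "cell L i x j y k z" for z j y
      using J[of z] that C(4) by blast
    then have "\<exists>z. J z = j" for j
      using C(9) by metis
    then have "inj J"
      by (rule surj_f3_inj)
    then have "z = z'"
      using that \<open>\<And>z j y. cell L i x j y k z \<Longrightarrow> J z = j\<close> by (metis injD)
    then show ?thesis
      using that C(4) by blast
  qed
  have inner_row: "x = x'" if "cell L i x j y k z" "cell L i x' j y k z'" for i x x' j y k z z'
  proof -
    obtain K where K: "\<And>x. \<exists>z. cell L i x j y (K x) z"
      using C(1)[of i _ j y] by metis
    have *: "K x = k" if "cell L i x j y k z" for x k z
      using K[of x] that C(2) by blast
    then have "\<exists>x. K x = k" for k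
      using C(8) by metis
    then have "inj K"
      by (rule surj_f3_inj)
    then show ?thesis
      using that * by (metis injD)
  qed
  have inner_symbol: "y = y'" if "cell L i x j y k z" "cell L i x' j y' k z" for i x x' j y y' k z
  proof -
    obtain I where I: "\<And>y. \<exists>x. cell L (I y) x j y k z"
      using C(5)[of j _ k z] by metis
    have *: "I y = i" if "cell L i x j y k z" for y i x
      using I[of y] that C(6) by blast
    then have "\<exists>y. I y = i" for i
      using C(7) by metis
    then have "inj I"
      by (rule surj_f3_inj)
    then show ?thesis
      using that * by (metis injD)
  qed
  define Y where "Y i j k x = (SOME y. \<exists>z. cell L i x j y k z)" for i j k x
  have Y: "\<exists>z. cell L i x j (Y i j k x) k z" for i j k x
    unfolding Y_def by (rule someI_ex) (rule C(9))
  define Z where "Z i j k y = (SOME z. \<exists>x. cell L i x j y k z)" for i j k y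
  have Z: "\<exists>x. cell L i x j y k (Z i j k y)" for i j k y
    unfolding Z_def by (rule someI_ex) (use C(8) in blast)
  have cell_iff: "cell L i x j y k z \<longleftrightarrow> y = Y i j k x \<and> z = Z i j k y" for i x j y k z
  proof
    assume e: "cell L i x j y k z"
    have "y = Y i j k x"
      using Y[of i x j k] e inner_column by blast
    moreover obtain x' where x': "cell L i x' j y k (Z i j k y)"
      using Z by blast
    then have "z = Z i j k y"
      using e inner_row[OF e x'] C(2)[of i x j y k z k] by blast
    ultimately show "y = Y i j k x \<and> z = Z i j k y" ..
  next
    assume e: "y = Y i j k x \<and> z = Z i j k y"
    obtain x' z' where "cell L i x' j y k (Z i j k y)" "cell L i x j y k z'"
      using Y[of i x j k] Z[of i j y k] e by blast
    then show "cell L i x j y k z"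
      using e inner_row by blast
  qed
  have "inj (Y i j k)" for i j k
    using Y inner_row by (metis injI)
  define e where "e i j k = (SOME e. is_sign e \<and> (\<forall>x. Y i j k x = e * x + Y i j k Zer))" for i j k
  have e: "is_sign (e i j k)" "Y i j k x = e i j k * x + Y i j k Zer" for i j k x
    using someI_ex[OF inj_f3_affine'[OF \<open>inj (Y i j k)\<close>], folded e_def] by blast+
  have "inj (Z i j k)" for i j k
    using Z inner_symbol by (metis injI)
  define f where "f i j k = (SOME f. is_sign f \<and> (\<forall>y. Z i j k y = f * y + Z i j k Zer))" for i j k
  have f: "is_sign (f i j k)" "Z i j k y = f i j k * y + Z i j k Zer" for i j k y
    using someI_ex[OF inj_f3_affine'[OF \<open>inj (Z i j k)\<close>], folded f_def] by blast+
  have e_indep: "e i j k = e i j k'" for i j k k'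
  proof (cases "k = k'")
    case False
    have "Y i j k x \<noteq> Y i j k' x" for x
      using cell_iff C(2) False by metis
    then show ?thesis
      using affine_disjoint[of "e i j k" "e i j k'" "Y i j k Zer" "Y i j k' Zer"] e by metis
  qed simp
  have f_indep: "f i j k = f i' j k" for i i' j k
  proof (cases "i = i'")
    case False
    have "Z i j k y \<noteq> Z i' j k y" for y
      using cell_iff C(6) Z False by metis
    then show ?thesis
      using affine_disjoint[of "f i j k" "f i' j k" "Z i j k Zer" "Z i' j k Zer"] f by metis
  qed simp
  have sign_mult: "is_sign (a * b)" if "is_sign a" "is_sign b" for a b
    using that unfolding is_sign_cases by auto
  have ef_indep: "f i j k * e i j k = f i j' k * e i j' k" for i j j' k
  proof (cases "j = j'")
    case False
    have "Z i j k (Y i j k x) \<noteq> Z i j' k (Y i j' k x)" for x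
      using cell_iff C(4) False by metis
    moreover have "Z i j k (Y i j k x) = f i j k * e i j k * x + (f i j k * Y i j k Zer + Z i j k Zer)" for j x
      by (subst f(2), subst e(2)) (simp only: algebra_simps)
    ultimately show ?thesis
      using affine_disjoint[of "f i j k * e i j k" "f i j' k * e i j' k"] sign_mult[OF f(1) e(1)] by metis
  qed simp
  show thesis
  proof (rule that[of "\<lambda>i j. e i j Zer" "\<lambda>j k. f Zer j k" "\<lambda>i j k. Y i j k Zer" "\<lambda>i j k. Z i j k Zer"])
    show "is_sign (e i j Zer)" "is_sign (f Zer j k)" for i j k
      by (rule e(1) f(1))+
    show "f Zer j k * e i j Zer = f Zer j' k * e i j' Zer" for i j j' k
      using ef_indep[of i j k j'] e_indep f_indep by metis
    show "L (point i x, point j y) = point k z \<longleftrightarrow>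
       y = e i j Zer * x + Y i j k Zer \<and> z = f Zer j k * y + Z i j k Zer" for i x j y k z
      using cell_iff[of i x j y k z] e_indep[of i j k Zer] f_indep[of i j k Zer] e(2)[of i j k x] f(2)[of i j k y]
      by (simp add: cell_def)
  qed
qed

lemma sign_labels:
  assumes "\<And>i. is_sign (m i)"
  shows "block_labels id (\<lambda>i x. point i (m i * x))"
  unfolding block_labels_def
proof (intro conjI allI)
  fix i
  have "bij_betw (\<lambda>x. m i * x) UNIV UNIV"
    by (rule bij_betw_byWitness[where f' = "\<lambda>x. m i * x"])
      (use assms[of i] in \<open>auto simp: is_sign_cases\<close>)
  from bij_betw_trans[OF this bij_point[of i]]
  show "bij_betw (\<lambda>x. point i (m i * x)) UNIV (block (block_index (id i)))"
    by (simp add: comp_def)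
qed simp

text \<open>Since the product of the slopes \<open>e i j\<close> and \<open>f j k\<close> does not depend on \<open>j\<close>, there are signs
  attached to the bands, stacks and piles such that each slope is the product of two of them. Multiplying
  the labels of each block by its sign turns all slopes into \<open>1\<close>.\<close>

lemma division_sudoku_framing:
  assumes "division_sudoku L"
  shows "\<exists>lab \<alpha> \<beta>. framing L (\<lambda>_. id) lab \<alpha> \<beta>"
proof -
  obtain e f c d where e: "\<And>i j. is_sign (e i j)" and f: "\<And>j k. is_sign (f j k)"
    and ef: "\<And>i j j' k. f j k * e i j = f j' k * e i j'"
    and E: "\<And>i x j y k z. L (point i x, point j y) = point k z \<longleftrightarrow>
           y = e i j * x + c i j k \<and> z = f j k * y + d i j k"
    using division_sudoku_affine[OF assms] by blast
  \<comment> \<open>The signs solve \<open>n j * e i j * m i = 1\<close> and \<open>l k * f j k * n j = 1\<close>, normalised by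
    \<open>n 0 = 1\<close>.\<close>
  define m where "m i = e i Zer" for i
  define n where "n j = f j Zer * f Zer Zer" for j
  define l where "l k = f Zer k" for k
  define lab where "lab c = (\<lambda>i x. point i ((case c of Row \<Rightarrow> m | Column \<Rightarrow> n | Symbol \<Rightarrow> l) i * x))" for c
  have sm: "is_sign (m i)" "is_sign (n i)" "is_sign (l i)" for i
    using e[of i Zer] f[of i Zer] f[of Zer Zer] f[of Zer i] by (auto simp: m_def n_def l_def is_sign_cases)
  have labels: "block_labels id (lab c)" for c
    unfolding lab_def by (rule sign_labels) (cases c; simp add: sm)
  have me: "n j * (e i j * m i) = One" and ln: "l k * (f j k * n j) = One" for i j k
    using ef[of j Zer i Zer] ef[of j k i Zer] e[of i j] e[of i Zer] f[of j Zer] f[of Zer Zer] f[of Zer k] f[of j k]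
    by (auto simp: m_def n_def l_def is_sign_cases)
  have solve: "a * u = w \<longleftrightarrow> u = a * w" if "is_sign a" for a u w
    using that by (auto simp: is_sign_cases)
  have "L (lab Row i x, lab Column j y) = lab Symbol k z \<longleftrightarrow>
      y = x + n j * c i j k \<and> z = y + l k * d i j k" for i x j y k z
  proof -
    have "L (lab Row i x, lab Column j y) = lab Symbol k z \<longleftrightarrow>
        n j * y = e i j * (m i * x) + c i j k \<and> l k * z = f j k * (n j * y) + d i j k"
      by (simp add: lab_def E)
    also have "\<dots> \<longleftrightarrow> y = n j * (e i j * m i) * x + n j * c i j k \<and>
        z = l k * (f j k * n j) * y + l k * d i j k"
      unfolding solve[OF sm(2)] solve[OF sm(3)] by (simp only: distrib_left mult.assoc)
    finally show ?thesis
      by (simp add: me ln)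
  qed
  then have "framing L (\<lambda>_. id) lab (\<lambda>i j k. n j * c i j k) (\<lambda>i j k. l k * d i j k)"
    unfolding framing_def using labels by blast
  then show ?thesis
    by blast
qed

section \<open>Sign configurations\<close>

type_synonym mat = "bool tri tri"
type_synonym config = "mat \<times> mat \<times> mat"

definition at :: "mat \<Rightarrow> f3 \<Rightarrow> f3 \<Rightarrow> bool" where
  "at m i j = sel (sel m i) j"

definition ent :: "mat \<Rightarrow> f3 \<Rightarrow> f3 \<Rightarrow> f3" where
  "ent m i j = sg (at m i j)"

text \<open>The three differences \<open>\<alpha>\<close>, \<open>\<beta>\<close> and \<open>\<gamma> = - (\<alpha> + \<beta>)\<close> of an entry depend
  affinely on one index each, namely on the index that they do not compare: \<open>\<alpha>\<close> (from row to column) on the pile,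
  \<open>\<beta>\<close> (from column to symbol) on the band, \<open>\<gamma>\<close> (from symbol to row) on the stack. The sign matrices
  \<open>s\<close>, \<open>t\<close>, \<open>u\<close> collect the slopes.\<close>

fun affine_form :: "config \<Rightarrow> (f3 \<Rightarrow> f3 \<Rightarrow> f3 \<Rightarrow> f3) \<Rightarrow> (f3 \<Rightarrow> f3 \<Rightarrow> f3 \<Rightarrow> f3) \<Rightarrow> bool" where
  "affine_form (s, t, u) \<alpha> \<beta> \<longleftrightarrow>
     (\<forall>i j k. \<alpha> i j k = ent s i j * k + \<alpha> i j Zer \<and>
              \<beta> i j k = ent t j k * i + \<beta> Zer j k \<and>
              - (\<alpha> i j k + \<beta> i j k) = ent u i k * j - (\<alpha> i Zer k + \<beta> i Zer k))"

definition has_config :: "square \<Rightarrow> config \<Rightarrow> bool" where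
  "has_config L c \<longleftrightarrow> (\<exists>\<pi> lab \<alpha> \<beta>. framing L \<pi> lab \<alpha> \<beta> \<and> affine_form c \<alpha> \<beta>)"

lemma framing_labels: "framing L \<pi> lab \<alpha> \<beta> \<Longrightarrow> block_labels (\<pi> c) (lab c)"
  by (simp add: framing_def)

lemma framing_entry:
  assumes "framing L \<pi> lab \<alpha> \<beta>"
  shows "(lab Row i x, lab Column j y, lab Symbol k z) \<in> orth_array X9 L \<longleftrightarrow> y = x + \<alpha> i j k \<and> z = y + \<beta> i j k"
proof -
  have "lab Row i x \<in> X9" "lab Column j y \<in> X9"
    using labels_X9[OF framing_labels[OF assms]] by blast+
  then have "(lab Row i x, lab Column j y, lab Symbol k z) \<in> orth_array X9 L \<longleftrightarrow> 
     L (lab Row i x, lab Column j y) = lab Symbol k z"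
    unfolding orth_array_def by auto
  then show ?thesis
    using assms by (simp add: framing_def)
qed

text \<open>Every entry of a framed latin square has labels, so facts about entries reduce to the two
  equations of the framing.\<close>

lemma framing_entries:
  assumes "latin_square X9 L" and fr: "framing L \<pi> lab \<alpha> \<beta>" and e: "(a, b, c) \<in> orth_array X9 L"
  obtains i x j y k z where "a = lab Row i x" "b = lab Column j y" "c = lab Symbol k z"
    "y = x + \<alpha> i j k" "z = y + \<beta> i j k"
proof -
  have "a \<in> X9" "b \<in> X9" "c = L (a, b)"
    using e unfolding orth_array_def by blast+
  moreover have "L (a, b) \<in> X9"
    using assms(1) \<open>a \<in> X9\<close> \<open>b \<in> X9\<close> by (auto simp: latin_square_def PiE_iff)
  ultimately obtain i x j y k z where "a = lab Row i x" "b = lab Column j y" "c = lab Symbol k z"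
    using labels_X9[OF framing_labels[OF fr, of Row]] labels_X9[OF framing_labels[OF fr, of Column]]
      labels_X9[OF framing_labels[OF fr, of Symbol]] by blast
  with e that framing_entry[OF fr] show thesis
    by blast
qed

definition mat_of :: "(f3 \<Rightarrow> f3 \<Rightarrow> bool) \<Rightarrow> mat" where
  "mat_of f = tab (\<lambda>i. tab (f i))"

lemma ent_mat_of [simp]: "ent (mat_of f) i j = sg (f i j)"
  by (simp add: ent_def at_def mat_of_def)

lemma inj_f3_signs:
  assumes "\<And>i j. inj (f i j :: f3 \<Rightarrow> f3)"
  obtains m where "\<And>i j k. f i j k = ent m i j * k + f i j Zer"
proof -
  define b where "b i j = (SOME b. \<forall>x. f i j x = sg b * x + f i j Zer)" for i j
  have "\<forall>x. f i j x = sg (b i j) * x + f i j Zer" for i j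
    unfolding b_def by (rule someI_ex) (rule inj_f3_affine[OF assms])
  then show thesis
    by (intro that[of "mat_of b"], unfold ent_mat_of) (rule spec)
qed

text \<open>A latin square has one symbol in each cell, so for given band and stack the shifts \<open>\<alpha>\<close>
  of the three piles differ; the other two latin conditions do the same for \<open>\<beta>\<close> and \<open>\<gamma>\<close>. Injective
  functions on \<open>\<int>/3\<close> are affine with a sign as slope.\<close>

lemma division_sudoku_config:
  assumes L: "division_sudoku L"
  shows "\<exists>c. has_config L c"
proof -
  obtain lab \<alpha> \<beta> where fr: "framing L (\<lambda>_. id) lab \<alpha> \<beta>"
    using division_sudoku_framing[OF L] by blast
  have lat: "latin_square X9 L"
    using L by (simp add: division_sudoku_def)
  have r: "\<forall>x\<in>X9. \<forall>z\<in>X9. \<exists>y\<in>X9. L (x, y) = z"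
    using lat unfolding latin_square_def by (elim conjE)
  have c: "\<forall>y\<in>X9. \<forall>z\<in>X9. \<exists>x\<in>X9. L (x, y) = z"
    using lat unfolding latin_square_def by (elim conjE)
  have XR: "lab c i x \<in> X9" for c i x
    using labels_X9[OF framing_labels[OF fr]] by blast
  have eq: "L (lab Row i x, lab Column j y) = lab Symbol k z \<longleftrightarrow> y = x + \<alpha> i j k \<and> z = y + \<beta> i j k" for i x j y k z
    using fr by (simp add: framing_def)
  have inj_lab: "lab c i x = lab c i' x' \<longleftrightarrow> i = i' \<and> x = x'" for c i x i' x'
    by (rule labels_inject[OF framing_labels[OF fr]])
  have sub: "(\<lambda>b. L (a, b)) ` X9 \<subseteq> X9" "(\<lambda>a. L (a, b)) ` X9 \<subseteq> X9" if "a \<in> X9" "b \<in> X9" for a b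
    using lat that by (auto simp: latin_square_def PiE_iff)
  have row_inj: "inj_on (\<lambda>b. L (a, b)) X9" if "a \<in> X9" for a
    using sub(1)[OF that that] r[rule_format, OF that]
    by (intro finite_surj_inj) (simp, fast intro: rev_image_eqI)
  have col_inj: "inj_on (\<lambda>a. L (a, b)) X9" if "b \<in> X9" for b
    using sub(2)[OF that that] c[rule_format, OF that]
    by (intro finite_surj_inj) (simp, fast intro: rev_image_eqI)
  have "inj (\<alpha> i j)" for i j
  proof (rule injI)
    fix k k' assume "\<alpha> i j k = \<alpha> i j k'"
    then have "lab Symbol k (\<alpha> i j k + \<beta> i j k) = lab Symbol k' (\<alpha> i j k + \<beta> i j k')"
      using eq[of i Zer j "\<alpha> i j k" k "\<alpha> i j k + \<beta> i j k"] eq[of i Zer j "\<alpha> i j k" k' "\<alpha> i j k + \<beta> i j k'"]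
      by simp
    then show "k = k'"
      by (simp add: inj_lab)
  qed
  then obtain s where s: "\<And>i j k. \<alpha> i j k = ent s i j * k + \<alpha> i j Zer"
    using inj_f3_signs by metis
  have "inj (\<lambda>i. \<beta> i j k)" for j k
  proof (rule injI)
    fix i i' assume b: "\<beta> i j k = \<beta> i' j k"
    have "L (lab Row i (- \<alpha> i j k), lab Column j Zer) = L (lab Row i' (- \<alpha> i' j k), lab Column j Zer)"
      using eq[of i "- \<alpha> i j k" j Zer k "\<beta> i j k"] eq[of i' "- \<alpha> i' j k" j Zer k "\<beta> i j k"] b by simp
    then have "lab Row i (- \<alpha> i j k) = lab Row i' (- \<alpha> i' j k)"
      using inj_onD[OF col_inj[OF XR]] XR by blast
    then show "i = i'"
      by (simp add: inj_lab)
  qed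
  then obtain t where t: "\<And>j k i. \<beta> i j k = ent t j k * i + \<beta> Zer j k"
    using inj_f3_signs[of "\<lambda>j k i. \<beta> i j k"] by metis
  have "inj (\<lambda>j. - (\<alpha> i j k + \<beta> i j k))" for i k
  proof (rule injI)
    fix j j' assume b: "- (\<alpha> i j k + \<beta> i j k) = - (\<alpha> i j' k + \<beta> i j' k)"
    have "L (lab Row i Zer, lab Column j (\<alpha> i j k)) = L (lab Row i Zer, lab Column j' (\<alpha> i j' k))"
      using eq[of i Zer j "\<alpha> i j k" k "\<alpha> i j k + \<beta> i j k"]
        eq[of i Zer j' "\<alpha> i j' k" k "\<alpha> i j' k + \<beta> i j' k"] b by (simp del: minus_add_distrib)
    then have "lab Column j (\<alpha> i j k) = lab Column j' (\<alpha> i j' k)"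
      using inj_onD[OF row_inj[OF XR]] XR by blast
    then show "j = j'"
      by (simp add: inj_lab)
  qed
  then obtain u where u: "\<And>i k j. - (\<alpha> i j k + \<beta> i j k) = ent u i k * j + - (\<alpha> i Zer k + \<beta> i Zer k)"
    using inj_f3_signs[of "\<lambda>i k j. - (\<alpha> i j k + \<beta> i j k)"] by metis
  have "affine_form (s, t, u) \<alpha> \<beta>"
    unfolding affine_form.simps
    by (intro allI conjI) (rule s, rule t, simp only: diff_conv_add_uminus, rule u)
  with fr show ?thesis
    unfolding has_config_def by blast
qed

text \<open>The mixed difference, with base point \<open>0\<close>, of
  \<open>s i j * k + t j k * i + u i k * j\<close> in all three indices. It annihilates every sum of functions of two
  indices, and conversely a function with vanishing mixed difference is such a sum. Since
  \<open>\<alpha> + \<beta> + \<gamma> = 0\<close>, this is the condition for constant terms of \<open>\<alpha>\<close>, \<open>\<beta>\<close>, \<open>\<gamma>\<close> to exist.\<close>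

fun balanced :: "config \<Rightarrow> f3 \<Rightarrow> f3 \<Rightarrow> f3 \<Rightarrow> bool" where
  "balanced (s, t, u) i j k \<longleftrightarrow>
     (ent s i j * k + ent t j k * i + ent u i k * j)
     - (ent t j Zer * i + ent u i Zer * j) - (ent s Zer j * k + ent u Zer k * j) - (ent s i Zer * k + ent t Zer k * i)
     + (ent t Zer Zer * i + ent u Zer Zer * j + ent s Zer Zer * k) = Zer"

definition valid :: "config \<Rightarrow> bool" where
  "valid c \<longleftrightarrow> (\<forall>i j k. balanced c i j k)"

lemma affine_form_valid:
  assumes "affine_form c \<alpha> \<beta>"
  shows "valid c"
proof -
  obtain s t u where c: "c = (s, t, u)"
    by (cases c)
  have s: "ent s i j * k = \<alpha> i j k - \<alpha> i j Zer" for i j k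
    using assms unfolding c affine_form.simps by (metis add_diff_cancel_right')
  have t: "ent t j k * i = \<beta> i j k - \<beta> Zer j k" for i j k
    using assms unfolding c affine_form.simps by (metis add_diff_cancel_right')
  have u: "ent u i k * j = (\<alpha> i Zer k + \<beta> i Zer k) - (\<alpha> i j k + \<beta> i j k)" for i j k
    using assms unfolding c affine_form.simps
    by (metis diff_add_cancel add.commute diff_conv_add_uminus)
  show ?thesis
    unfolding valid_def c balanced.simps s t u by (simp add: algebra_simps)
qed

section \<open>Realizing sign configurations\<close>

text \<open>One choice of \<open>\<alpha>\<close> and \<open>\<beta>\<close> with the given signs. The faces \<open>k = 0\<close>, \<open>i = 0\<close> and \<open>j = 0\<close> of
  the cube of values determine a function with vanishing mixed difference; the contributions of these
  faces are distributed over \<open>\<alpha>\<close>, \<open>\<beta>\<close> and \<open>\<gamma>\<close>.\<close>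

definition shift_alpha :: "config \<Rightarrow> f3 \<Rightarrow> f3 \<Rightarrow> f3 \<Rightarrow> f3" where
  "shift_alpha = (\<lambda>(s, t, u) i j k. ent s i j * k - (ent t j Zer * i + ent u i Zer * j) + (ent t Zer Zer * i + ent u Zer Zer * j))"

definition shift_beta :: "config \<Rightarrow> f3 \<Rightarrow> f3 \<Rightarrow> f3 \<Rightarrow> f3" where
  "shift_beta = (\<lambda>(s, t, u) i j k. ent t j k * i - (ent s Zer j * k + ent u Zer k * j) + ent s Zer Zer * k)"

lemma valid_affine_form:
  assumes "valid c"
  shows "affine_form c (shift_alpha c) (shift_beta c)"
proof -
  obtain s t u where c: "c = (s, t, u)"
    by (cases c)
  have g: "- (shift_alpha c i j k + shift_beta c i j k) = ent u i k * j - (ent s i Zer * k + ent t Zer k * i)" for i j k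
  proof -
    have "balanced (s, t, u) i j k"
      using assms by (simp add: valid_def c)
    then have "ent u i k * j - (ent s i Zer * k + ent t Zer k * i) + (shift_alpha c i j k + shift_beta c i j k) = Zer"
      by (simp add: shift_alpha_def shift_beta_def c algebra_simps)
    then show ?thesis
      by (metis add_eq_0_iff zero_f3 add.commute)
  qed
  have g': "shift_alpha c i j k + shift_beta c i j k = (ent s i Zer * k + ent t Zer k * i) - ent u i k * j" for i j k
    using g[of i j k] by (metis minus_diff_eq minus_minus)
  show ?thesis
    unfolding c affine_form.simps
    unfolding c[symmetric] g g'
    by (simp add: shift_alpha_def shift_beta_def c)
qed

text \<open>Two given coordinates of an entry determine the block of the third because a function with slope
  a sign can be inverted. Hence the translates of the triples \<open>(0, \<alpha> i j k, \<alpha> i j k + \<beta> i j k)\<close> are the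
  entries of a latin square, and the sudoku conditions are immediate.\<close>

lemma affine_form_realized:
  assumes "affine_form c \<alpha> \<beta>"
  shows "\<exists>L. division_sudoku L \<and> framing L (\<lambda>_. id) (\<lambda>_. point) \<alpha> \<beta>"
proof -
  obtain s t u where c: "c = (s, t, u)"
    by (cases c)
  have a: "\<alpha> i j k = ent s i j * k + \<alpha> i j Zer" for i j k
    using assms unfolding c affine_form.simps by blast
  have b: "\<beta> i j k = ent t j k * i + \<beta> Zer j k" for i j k
    using assms unfolding c affine_form.simps by blast
  have g: "- (\<alpha> i j k + \<beta> i j k) = ent u i k * j - (\<alpha> i Zer k + \<beta> i Zer k)" for i j k
    using assms unfolding c affine_form.simps by blast
  have solve_a: "\<exists>k. y = x + \<alpha> i j k" for i j x y
    by (rule exI[of _ "ent s i j * (y - x - \<alpha> i j Zer)"], subst a) (simp add: ent_def)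
  have a_inj: "k = k'" if "\<alpha> i j k = \<alpha> i j k'" for i j k k'
    using that unfolding a[of i j k] a[of i j k'] by (simp add: ent_def sg_mult_eq)
  have solve_b: "\<exists>i. z = y + \<beta> i j k" for j k y z
    by (rule exI[of _ "ent t j k * (z - y - \<beta> Zer j k)"], subst b) (simp add: ent_def)
  have solve_g: "\<exists>j. z = x + \<alpha> i j k + \<beta> i j k" for i k x z
  proof -
    have "z = x + \<alpha> i j k + \<beta> i j k \<longleftrightarrow> x - z = - (\<alpha> i j k + \<beta> i j k)" for j
      by (auto simp: algebra_simps)
    moreover have "\<exists>j. x - z = - (\<alpha> i j k + \<beta> i j k)"
      by (rule exI[of _ "ent u i k * (x - z + (\<alpha> i Zer k + \<beta> i Zer k))"], subst g) (simp add: ent_def)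
    ultimately show ?thesis by simp
  qed
  define dec where "dec n = (THE (i, x). n = point i x)" for n
  have dec: "dec (point i x) = (i, x)" for i x
    unfolding dec_def by (rule the_equality) (auto simp: point_inject)
  \<comment> \<open>The pile is read off from the difference of column and row.\<close>
  define K where "K i j d = (SOME k. d = \<alpha> i j k)" for i j d
  have K: "y = x + \<alpha> i j k \<longleftrightarrow> k = K i j (y - x)" for i j k x y
  proof -
    have "\<exists>k. y - x = \<alpha> i j k"
      using solve_a[of y x i j] by (auto simp: algebra_simps)
    then have "y - x = \<alpha> i j (K i j (y - x))"
      unfolding K_def by (rule someI_ex)
    then show ?thesis
      using a_inj by (metis add_diff_cancel_left' diff_add_cancel add.commute)
  qed
  define f where "f = (\<lambda>(i, x) (j, y). point (K i j (y - x)) (y + \<beta> i j (K i j (y - x))))"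
  define L where "L = restrict (\<lambda>(a, b). f (dec a) (dec b)) (X9 \<times> X9)"
  have L: "L (point i x, point j y) = point k z \<longleftrightarrow> y = x + \<alpha> i j k \<and> z = y + \<beta> i j k" for i x j y k z
    unfolding L_def K using point_in_X9 by (auto simp: f_def dec point_inject)
  have fr: "framing L (\<lambda>_. id) (\<lambda>_. point) \<alpha> \<beta>"
    unfolding framing_def block_labels_def using L bij_point by simp
  have L_X9: "L (a, b) \<in> X9" if "a \<in> X9" "b \<in> X9" for a b
  proof -
    have "f (dec a) (dec b) \<in> X9"
      unfolding f_def by (simp only: split_beta point_in_X9)
    then show ?thesis
      using that by (simp only: L_def restrict_apply mem_Sigma_iff simp_thms if_True prod.case)
  qed
  have lat: "latin_square X9 L"
    unfolding latin_square_def
  proof (intro conjI ballI)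
    show "finite X9"
      by simp
    show "L \<in> X9 \<times> X9 \<rightarrow>\<^sub>E X9"
    proof
      show "L p \<in> X9" if "p \<in> X9 \<times> X9" for p
        using that L_X9 by (cases p) (simp only: mem_Sigma_iff)
      show "L p = undefined" if "p \<notin> X9 \<times> X9" for p
        using that unfolding L_def by (simp only: restrict_apply if_False)
    qed
  next
    fix a c assume "a \<in> X9" "c \<in> X9"
    then obtain i x k z where a: "a = point i x" and c: "c = point k z"
      unfolding X9_points by blast
    obtain j where "z = x + \<alpha> i j k + \<beta> i j k"
      using solve_g by blast
    then have "L (a, point j (x + \<alpha> i j k)) = c"
      by (simp add: a c L)
    then show "\<exists>b\<in>X9. L (a, b) = c"
      using point_in_X9 by blast
  next
    fix b c assume "b \<in> X9" "c \<in> X9"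
    then obtain j y k z where b: "b = point j y" and c: "c = point k z"
      unfolding X9_points by blast
    obtain i where "z = y + \<beta> i j k"
      using solve_b by blast
    then have "L (point i (y - \<alpha> i j k), b) = c"
      by (simp add: b c L)
    then show "\<exists>a\<in>X9. L (a, b) = c"
      using point_in_X9 by blast
  qed
  have e: "(point i x, point j y, point k z) \<in> orth_array X9 L \<longleftrightarrow> y = x + \<alpha> i j k \<and> z = y + \<beta> i j k" for i x j y k z
    using framing_entry[OF fr] .
  have Idx: "\<exists>i. n = block_index i" if "n \<in> Idx" for n
    using that bij_block_index by (auto simp: bij_betw_def)
  have mem: "point i x \<in> block (block_index i)" for i x
    by (simp add: block_eq_range)
  have "division_sudoku L"
    unfolding division_sudoku_def
  proof (intro conjI ballI)
    show "latin_square X9 L" by (rule lat)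
  next
    fix m n c assume "m \<in> Idx" "n \<in> Idx" "c \<in> X9"
    then obtain i j where mn: "m = block_index i" "n = block_index j"
      using Idx by metis
    obtain k z where c: "c = point k z"
      using \<open>c \<in> X9\<close> unfolding X9_points by blast
    let ?y = "z - \<beta> i j k"
    have "(point i (?y - \<alpha> i j k), point j ?y, c) \<in> band L m \<inter> stack L n"
      unfolding slice_def c mn using mem e[of i "?y - \<alpha> i j k" j ?y k z] by simp
    then show "\<exists>e \<in> band L m \<inter> stack L n. coord_val Symbol e = c"
      by force
  next
    fix m n b assume "m \<in> Idx" "n \<in> Idx" "b \<in> X9"
    then obtain i k where mn: "m = block_index i" "n = block_index k"
      using Idx by metis
    obtain j y where b: "b = point j y"
      using \<open>b \<in> X9\<close> unfolding X9_points by blast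
    have "(point i (y - \<alpha> i j k), b, point k (y + \<beta> i j k)) \<in> band L m \<inter> pile L n"
      unfolding slice_def b mn using mem e[of i "y - \<alpha> i j k" j y k "y + \<beta> i j k"] by simp
    then show "\<exists>e \<in> band L m \<inter> pile L n. coord_val Column e = b"
      by force
  next
    fix m n a assume "m \<in> Idx" "n \<in> Idx" "a \<in> X9"
    then obtain j k where mn: "m = block_index j" "n = block_index k"
      using Idx by metis
    obtain i x where a: "a = point i x"
      using \<open>a \<in> X9\<close> unfolding X9_points by blast
    have "(a, point j (x + \<alpha> i j k), point k (x + \<alpha> i j k + \<beta> i j k)) \<in> stack L m \<inter> pile L n"
      unfolding slice_def a mn using mem e[of i x j "x + \<alpha> i j k" k "x + \<alpha> i j k + \<beta> i j k"] by simp
    then show "\<exists>e \<in> stack L m \<inter> pile L n. coord_val Row e = a"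
      by force
  qed
  with fr show ?thesis by blast
qed

lemma valid_realized:
  assumes "valid c"
  shows "\<exists>L. division_sudoku L \<and> has_config L c"
  using affine_form_realized[OF valid_affine_form[OF assms]] valid_affine_form[OF assms]
  unfolding has_config_def by blast

section \<open>Intercalates in terms of signs\<close>

lemma add_eq_add_cancel: "b + q = a + p \<Longrightarrow> c + p = d + q \<Longrightarrow> a = b - d + c" for a :: "'a::ab_group_add"
proof -
  assume "b + q = a + p" "c + p = d + q"
  then have "q = a + p - b" "q = c + p - d"
    by (simp_all add: eq_diff_eq add.commute)
  then show ?thesis
    by (simp add: algebra_simps)
qed

lemma diff_eq_Zer [simp]: "a - b = Zer \<longleftrightarrow> a = b" "Zer = a - b \<longleftrightarrow> a = b" for a b :: f3
  by (cases a; cases b; simp)+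

lemma sg_nonzero [simp]: "sg b \<noteq> Zer"
  by (cases b) simp_all

text \<open>Three blocks are equal or distinct iff their indices sum to \<open>0\<close>, so the third index
  is the reflection of one of the others in the remaining one.\<close>

lemma f3_opposite: "- (a + b) = i \<longleftrightarrow> b = i - (a - i)" for a b i :: f3
  by (cases a; cases b; cases i; simp)

lemma block_index_in_Idx: "block_index i \<in> Idx"
  using bij_block_index by (auto simp: bij_betw_def)

lemma block_index_inject [simp]: "block_index i = block_index j \<longleftrightarrow> i = j"
  using bij_block_index by (auto simp: bij_betw_def dest: injD)

lemma Idx_labels:
  assumes "block_labels p R" "n \<in> Idx"
  obtains m where "n = block_index (p m)"
proof -
  obtain i where "n = block_index i"
    using assms(2) bij_block_index by (auto simp: bij_betw_def)
  moreover obtain m where "i = p m"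
    using assms(1) by (metis block_labels_def bij_is_surj surjD)
  ultimately show thesis
    using that by blast
qed

lemma labels_block_index_inject:
  assumes "block_labels p R"
  shows "block_index (p i) = block_index (p j) \<longleftrightarrow> i = j"
  using assms by (auto simp: block_labels_def dest: bij_is_inj injD)

text \<open>If the two values of an intercalate in one coordinate lie in the blocks \<open>a\<close> and \<open>a'\<close>, the
  associated slice is \<open>a\<close> for \<open>a = a'\<close> and the third block otherwise; in both cases this is the index
  completing \<open>a\<close>, \<open>a'\<close> to a line of \<open>\<int>/3\<close>.\<close>

lemma assoc_index_labels:
  assumes R: "block_labels p R" and I: "I \<subseteq> orth_array X9 L"
    and v: "coord_val c ` I = {R a x, R a' x'}"
  shows "assoc_index L c I = block_index (p (- (a + a')))"
proof -
  have "I \<subseteq> slice L c n \<longleftrightarrow> coord_val c ` I \<subseteq> block n" for n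
    using I by (auto simp: slice_def)
  then have sub: "I \<subseteq> slice L c (block_index (p m)) \<longleftrightarrow> a = m \<and> a' = m" for m
    by (simp add: v labels_in_block[OF R])
  have "I \<inter> slice L c n = {} \<longleftrightarrow> coord_val c ` I \<inter> block n = {}" for n
    using I by (auto simp: slice_def)
  then have dis: "I \<inter> slice L c (block_index (p m)) = {} \<longleftrightarrow> a \<noteq> m \<and> a' \<noteq> m" for m
    by (simp add: v labels_in_block[OF R])
  have idx: "block_index (p m) \<in> Idx" for m
    by (rule block_index_in_Idx)
  show ?thesis
  proof (cases "a = a'")
    case True
    then have ex: "\<exists>n\<in>Idx. I \<subseteq> slice L c n"
      using sub idx by blast
    have "(THE n. n \<in> Idx \<and> I \<subseteq> slice L c n) = block_index (p a)"
    proof (rule the_equality)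
      show "block_index (p a) \<in> Idx \<and> I \<subseteq> slice L c (block_index (p a))"
        using True sub[of a] idx[of a] by blast
      show "n = block_index (p a)" if "n \<in> Idx \<and> I \<subseteq> slice L c n" for n
        using that sub by (metis Idx_labels[OF R])
    qed
    moreover have "- (a + a') = a"
      unfolding True by (cases a') simp_all
    ultimately show ?thesis
      using ex unfolding assoc_index_def by simp
  next
    case False
    then have ex: "\<not> (\<exists>n\<in>Idx. I \<subseteq> slice L c n)"
      using sub Idx_labels[OF R] by metis
    have third: "a \<noteq> m \<and> a' \<noteq> m \<longleftrightarrow> m = - (a + a')" for m
      using False by (cases a; cases a'; cases m; simp)
    have "(THE n. n \<in> Idx \<and> I \<inter> slice L c n = {}) = block_index (p (- (a + a')))"
    proof (rule the_equality)
      show "block_index (p (- (a + a'))) \<in> Idx \<and> I \<inter> slice L c (block_index (p (- (a + a')))) = {}"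
        using dis third idx by blast
      show "n = block_index (p (- (a + a')))" if "n \<in> Idx \<and> I \<inter> slice L c n = {}" for n
        using that dis third by (metis Idx_labels[OF R])
    qed
    then show ?thesis
      using ex unfolding assoc_index_def by simp
  qed
qed

fun aligned :: "config \<Rightarrow> f3 \<Rightarrow> f3 \<Rightarrow> f3 \<Rightarrow> f3 \<Rightarrow> f3 \<Rightarrow> f3 \<Rightarrow> bool" where
  "aligned (s, t, u) a b c d e f \<longleftrightarrow> ent s a b * f = ent t b c * d + ent u a c * e"

text \<open>Intercalates associated with \<open>(i, j, k)\<close> meet the bands \<open>i + d\<close>, \<open>i - d\<close>, the stacks
  \<open>j + e\<close>, \<open>j - e\<close> and the piles \<open>k + f\<close>, \<open>k - f\<close>. Their four entries lie over four of the eight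
  vertices of this box. Each of the other four vertices gives one closing condition on the signs, and three of
  the conditions imply the fourth.\<close>

fun intercalate_at :: "config \<Rightarrow> f3 \<Rightarrow> f3 \<Rightarrow> f3 \<Rightarrow> f3 \<times> f3 \<times> f3 \<Rightarrow> bool" where
  "intercalate_at c i j k (d, e, f) \<longleftrightarrow>
     aligned c (i + d) (j + e) (k - f) d e f \<and>
     aligned c (i + d) (j - e) (k + f) d (- e) (- f) \<and>
     aligned c (i - d) (j + e) (k + f) (- d) e (- f)"

text \<open>At most one of \<open>d\<close>, \<open>e\<close>, \<open>f\<close> vanishes, and renaming the two rows, the two columns or
  the two symbols of an intercalate changes two signs in \<open>(d, e, f)\<close>. These five triples represent
  all cases.\<close>

definition directions :: "(f3 \<times> f3 \<times> f3) list" where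
  "directions = [(Zer, One, One), (One, Zer, One), (One, One, Zer), (One, One, One), (One, One, Two)]"

definition has_intercalate :: "config \<Rightarrow> f3 \<Rightarrow> f3 \<Rightarrow> f3 \<Rightarrow> bool" where
  "has_intercalate c i j k \<longleftrightarrow> list_ex (intercalate_at c i j k) directions"

text \<open>The closing condition is a sum of first differences of \<open>\<alpha>\<close>, \<open>\<beta>\<close>, \<open>\<gamma>\<close> along the edges at the
  vertex \<open>(a, b, k')\<close>; each of these differences runs in the direction in which the function is affine, so only slopes
  remain.\<close>

lemma aligned_iff:
  assumes "affine_form c \<alpha> \<beta>" and "a - a' = - d" "b - b' = - e" "k - k' = - f"
  shows "aligned c a b k' d e f \<longleftrightarrow> \<alpha> a b' k' + \<beta> a b' k' = \<alpha> a b k + \<beta> a' b k'"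
proof -
  obtain s t u where c: "c = (s, t, u)"
    by (cases c)
  have s: "ent s i j * k = \<alpha> i j k - \<alpha> i j Zer" for i j k
    using assms unfolding c affine_form.simps by (metis add_diff_cancel_right')
  have t: "ent t j k * i = \<beta> i j k - \<beta> Zer j k" for i j k
    using assms unfolding c affine_form.simps by (metis add_diff_cancel_right')
  have u: "ent u i k * j = (\<alpha> i Zer k + \<beta> i Zer k) - (\<alpha> i j k + \<beta> i j k)" for i j k
    using assms unfolding c affine_form.simps
    by (metis diff_add_cancel add.commute diff_conv_add_uminus)
  have d: "d = a' - a" "e = b' - b" "f = k' - k"
    using assms(2-4) by (metis minus_diff_eq minus_minus)+
  show ?thesis
    unfolding c aligned.simps d right_diff_distrib s t u by (auto simp: algebra_simps)
qed

text \<open>Labels of the four entries of an intercalate whose rows lie in the bands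
  \<open>a\<close>, \<open>a'\<close>, columns in the stacks \<open>b\<close>, \<open>b'\<close> and symbols in the piles \<open>c\<close>, \<open>c'\<close>.\<close>

definition labelled_intercalate ::
  "(f3 \<Rightarrow> f3 \<Rightarrow> f3 \<Rightarrow> f3) \<Rightarrow> (f3 \<Rightarrow> f3 \<Rightarrow> f3 \<Rightarrow> f3) \<Rightarrow> f3 \<Rightarrow> f3 \<Rightarrow> f3 \<Rightarrow> f3 \<Rightarrow> f3 \<Rightarrow> f3 \<Rightarrow> bool" where
  "labelled_intercalate \<alpha> \<beta> a a' b b' c c' \<longleftrightarrow> (\<exists>x x' y y' z z'.
     (a = a' \<longrightarrow> x \<noteq> x') \<and> (b = b' \<longrightarrow> y \<noteq> y') \<and>
     (y = x + \<alpha> a b c \<and> z = y + \<beta> a b c) \<and> (y' = x + \<alpha> a b' c' \<and> z' = y' + \<beta> a b' c') \<and>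
     (y = x' + \<alpha> a' b c' \<and> z' = y + \<beta> a' b c') \<and> (y' = x' + \<alpha> a' b' c \<and> z = y' + \<beta> a' b' c))"

lemma labelled_intercalate_flip:
  "labelled_intercalate \<alpha> \<beta> a a' b b' c c' \<Longrightarrow> labelled_intercalate \<alpha> \<beta> a' a b' b c c'"
  "labelled_intercalate \<alpha> \<beta> a a' b b' c c' \<Longrightarrow> labelled_intercalate \<alpha> \<beta> a' a b b' c' c"
  unfolding labelled_intercalate_def by metis+

lemma labelled_intercalate_imp_at:
  assumes af: "affine_form c \<alpha> \<beta>" and q: "labelled_intercalate \<alpha> \<beta> (i + d) (i - d) (j + e) (j - e) (k + f) (k - f)"
  shows "intercalate_at c i j k (d, e, f)" and "d = Zer \<Longrightarrow> f \<noteq> Zer" and "e = Zer \<Longrightarrow> f \<noteq> Zer"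
proof -
  have diff: "(i + d) - (i - d) = - d" "(i - d) - (i + d) = d" for i d :: f3
    by (cases i; cases d; simp)+
  let ?a = "i + d" and ?a' = "i - d" and ?b = "j + e" and ?b' = "j - e" and ?c = "k + f" and ?c' = "k - f"
  obtain x x' y y' z z' where xy: "?a = ?a' \<longrightarrow> x \<noteq> x'" "?b = ?b' \<longrightarrow> y \<noteq> y'"
    and 1: "y = x + \<alpha> ?a ?b ?c" "z = y + \<beta> ?a ?b ?c"
    and 2: "y' = x + \<alpha> ?a ?b' ?c'" "z' = y' + \<beta> ?a ?b' ?c'"
    and 3: "y = x' + \<alpha> ?a' ?b ?c'" "z' = y + \<beta> ?a' ?b ?c'"
    and 4: "y' = x' + \<alpha> ?a' ?b' ?c" "z = y' + \<beta> ?a' ?b' ?c"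
    using q unfolding labelled_intercalate_def by blast
  have "\<alpha> ?a ?b' ?c' + \<beta> ?a ?b' ?c' = \<alpha> ?a ?b ?c + \<beta> ?a' ?b ?c'"
  proof -
    have "x + (\<alpha> ?a ?b' ?c' + \<beta> ?a ?b' ?c') = z'"
      using 2 by (simp only: add.assoc)
    moreover have "x + (\<alpha> ?a ?b ?c + \<beta> ?a' ?b ?c') = z'"
      using 1(1) 3(2) by (simp only: add.assoc)
    ultimately show ?thesis
      by (metis add_left_cancel)
  qed
  moreover have "\<alpha> ?a ?b ?c + \<beta> ?a ?b ?c = \<alpha> ?a ?b' ?c' + \<beta> ?a' ?b' ?c"
  proof -
    have "x + (\<alpha> ?a ?b ?c + \<beta> ?a ?b ?c) = z"
      using 1 by (simp only: add.assoc)
    moreover have "x + (\<alpha> ?a ?b' ?c' + \<beta> ?a' ?b' ?c) = z"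
      using 2(1) 4(2) by (simp only: add.assoc)
    ultimately show ?thesis
      by (metis add_left_cancel)
  qed
  moreover have "\<alpha> ?a' ?b' ?c + \<beta> ?a' ?b' ?c = \<alpha> ?a' ?b ?c' + \<beta> ?a ?b ?c"
  proof -
    have "x' + (\<alpha> ?a' ?b' ?c + \<beta> ?a' ?b' ?c) = z"
      using 4 by (simp only: add.assoc)
    moreover have "x' + (\<alpha> ?a' ?b ?c' + \<beta> ?a ?b ?c) = z"
      using 3(1) 1(2) by (simp only: add.assoc)
    ultimately show ?thesis
      by (metis add_left_cancel)
  qed
  ultimately show int: "intercalate_at c i j k (d, e, f)"
    unfolding intercalate_at.simps
    using aligned_iff[OF af, of ?a ?a' d ?b ?b' e ?c ?c' f]
      aligned_iff[OF af, of ?a ?a' d ?b' ?b "- e" ?c' ?c "- f"]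
      aligned_iff[OF af, of ?a' ?a "- d" ?b ?b' e ?c' ?c "- f"]
    by (simp only: diff minus_minus simp_thms)
  show "f \<noteq> Zer" if "d = Zer"
    using xy(1) 1(1) 3(1) that by auto
  show "f \<noteq> Zer" if "e = Zer"
    using xy(2) 1(1) 2(1) that by auto
qed

text \<open>The first row may be given the label \<open>0\<close>. Going round the intercalate determines
  all other labels, and the closing conditions say that the walk is consistent.\<close>

lemma intercalate_at_imp_labelled:
  assumes af: "affine_form c \<alpha> \<beta>" and T: "intercalate_at c i j k (d, e, f)" and "d = Zer \<Longrightarrow> f \<noteq> Zer" and "e = Zer \<Longrightarrow> f \<noteq> Zer"
  shows "labelled_intercalate \<alpha> \<beta> (i + d) (i - d) (j + e) (j - e) (k + f) (k - f)"
proof -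
  have diff: "(i + d) - (i - d) = - d" "(i - d) - (i + d) = d" for i d :: f3
    by (cases i; cases d; simp)+
  have eqs: "i + d = i - d \<longleftrightarrow> d = Zer" for i d :: f3
    by (cases i; cases d; simp)
  obtain s t u where c: "c = (s, t, u)"
    by (cases c)
  let ?a = "i + d" and ?a' = "i - d" and ?b = "j + e" and ?b' = "j - e" and ?c = "k + f" and ?c' = "k - f"
  have P: "\<alpha> ?a ?b' ?c' + \<beta> ?a ?b' ?c' = \<alpha> ?a ?b ?c + \<beta> ?a' ?b ?c'"
    and Q: "\<alpha> ?a ?b ?c + \<beta> ?a ?b ?c = \<alpha> ?a ?b' ?c' + \<beta> ?a' ?b' ?c"
    and R: "\<alpha> ?a' ?b' ?c + \<beta> ?a' ?b' ?c = \<alpha> ?a' ?b ?c' + \<beta> ?a ?b ?c"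
    using T unfolding intercalate_at.simps
    using aligned_iff[OF af, of ?a ?a' d ?b ?b' e ?c ?c' f]
      aligned_iff[OF af, of ?a ?a' d ?b' ?b "- e" ?c' ?c "- f"]
      aligned_iff[OF af, of ?a' ?a "- d" ?b ?b' e ?c' ?c "- f"]
    by (simp_all only: diff minus_minus simp_thms)
  have inj_a: "\<alpha> a b k \<noteq> \<alpha> a b k'" if "k \<noteq> k'" for a b k k'
  proof -
    have "\<alpha> a b k = ent s a b * k + \<alpha> a b Zer" "\<alpha> a b k' = ent s a b * k' + \<alpha> a b Zer"
      using af unfolding c affine_form.simps by blast+
    then show ?thesis
      using that by (simp add: ent_def sg_mult_eq)
  qed
  have f: "?c \<noteq> ?c'" if "f \<noteq> Zer"
    using that by (simp add: eqs)
  define x' where "x' = \<alpha> ?a ?b ?c - \<alpha> ?a' ?b ?c'"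
  have n1: "Zer \<noteq> x'" if "?a = ?a'"
    using that inj_a[OF f, of ?a ?b] assms(3) unfolding x'_def by (auto simp: eqs)
  have n2: "\<alpha> ?a ?b ?c \<noteq> \<alpha> ?a ?b' ?c'" if "?b = ?b'"
    using that inj_a[OF f, of ?a ?b] assms(4) by (auto simp: eqs)
  have y: "\<alpha> ?a ?b ?c = x' + \<alpha> ?a' ?b ?c'"
    unfolding x'_def by (rule diff_add_cancel[symmetric])
  have y': "\<alpha> ?a ?b' ?c' = x' + \<alpha> ?a' ?b' ?c"
    unfolding x'_def using Q R by (rule add_eq_add_cancel)
  show ?thesis
    unfolding labelled_intercalate_def
    by (intro exI[of _ Zer] exI[of _ x'] exI[of _ "\<alpha> ?a ?b ?c"] exI[of _ "\<alpha> ?a ?b' ?c'"]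
        exI[of _ "\<alpha> ?a ?b ?c + \<beta> ?a ?b ?c"] exI[of _ "\<alpha> ?a ?b' ?c' + \<beta> ?a ?b' ?c'"] conjI impI)
      ((rule n1 n2, assumption) | rule y y' P Q | simp only: plus_f3.simps)+
qed

lemma has_intercalate_iff:
  assumes af: "affine_form c \<alpha> \<beta>"
  shows "has_intercalate c i j k \<longleftrightarrow>
    (\<exists>a a' b b' k1 k2. - (a + a') = i \<and> - (b + b') = j \<and> - (k1 + k2) = k \<and> labelled_intercalate \<alpha> \<beta> a a' b b' k1 k2)" 
proof -
  define Q where "Q d e f = labelled_intercalate \<alpha> \<beta> (i + d) (i - d) (j + e) (j - e) (k + f) (k - f)" for d e f
  \<comment> \<open>Exchange the rows and the columns, or the rows and the symbols, of the intercalate.\<close>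
  have flip: "Q (- d) (- e) f" "Q (- d) e (- f)" if "Q d e f" for d e f
    using that[unfolded Q_def, THEN labelled_intercalate_flip(1)] that[unfolded Q_def, THEN labelled_intercalate_flip(2)] by (simp_all add: Q_def)
  have Q1: "intercalate_at c i j k (d, e, f) \<and> (d = Zer \<longrightarrow> f \<noteq> Zer) \<and> (e = Zer \<longrightarrow> f \<noteq> Zer)" if "Q d e f" for d e f
    using labelled_intercalate_imp_at[OF af] that unfolding Q_def by blast
  have Q2: "Q d e f" if "intercalate_at c i j k (d, e, f)" "d = Zer \<longrightarrow> f \<noteq> Zer" "e = Zer \<longrightarrow> f \<noteq> Zer" for d e f
    using intercalate_at_imp_labelled[OF af] that unfolding Q_def by blast
  have Q3: False if "Q Zer Zer f" for f
  proof -
    have "intercalate_at c i j k (Zer, Zer, f)" "f \<noteq> Zer"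
      using Q1[OF that] by blast+
    then show False
      by (cases c; cases f) (auto simp: ent_def sg_mult_eq)
  qed
  have "has_intercalate c i j k \<longleftrightarrow> (\<exists>p\<in>set directions. case p of (d, e, f) \<Rightarrow> Q d e f)"
    unfolding has_intercalate_def list_ex_iff
  proof (rule bex_cong[OF refl])
    fix p assume "p \<in> set directions"
    then show "intercalate_at c i j k p \<longleftrightarrow> (case p of (d, e, f) \<Rightarrow> Q d e f)"
      using Q1 Q2 by (auto simp: directions_def simp del: intercalate_at.simps)
  qed
  also have "\<dots> \<longleftrightarrow> (\<exists>d e f. Q d e f)"
  proof
    assume "\<exists>d e f. Q d e f"
    then obtain d e f where q: "Q d e f" by blast
    have "d = Zer \<Longrightarrow> e \<noteq> Zer" "d = Zer \<Longrightarrow> f \<noteq> Zer" "e = Zer \<Longrightarrow> f \<noteq> Zer"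
      using Q1[OF q] Q3 q by auto
    then show "\<exists>p\<in>set directions. case p of (d, e, f) \<Rightarrow> Q d e f"
      using q flip(1)[OF q] flip(2)[OF q] flip(1)[OF flip(2)[OF q]]
      unfolding directions_def by (cases d; cases e; cases f; simp)
  qed (auto simp: directions_def)
  also have "\<dots> \<longleftrightarrow> (\<exists>a a' b b' k1 k2. - (a + a') = i \<and> - (b + b') = j \<and> - (k1 + k2) = k \<and> labelled_intercalate \<alpha> \<beta> a a' b b' k1 k2)"
  proof
    assume "\<exists>d e f. Q d e f"
    then obtain d e f where q: "Q d e f" by blast
    have "- ((i + d) + (i - d)) = i" for i d :: f3
      by (cases i; cases d; simp)
    then show "\<exists>a a' b b' k1 k2. - (a + a') = i \<and> - (b + b') = j \<and> - (k1 + k2) = k \<and> labelled_intercalate \<alpha> \<beta> a a' b b' k1 k2"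
      using q unfolding Q_def by blast
  next
    assume "\<exists>a a' b b' k1 k2. - (a + a') = i \<and> - (b + b') = j \<and> - (k1 + k2) = k \<and> labelled_intercalate \<alpha> \<beta> a a' b b' k1 k2"
    then obtain a b k1 where "labelled_intercalate \<alpha> \<beta> a (i - (a - i)) b (j - (b - j)) k1 (k - (k1 - k))"
      unfolding f3_opposite by blast
    then have "Q (a - i) (b - j) (k1 - k)"
      by (simp add: Q_def)
    then show "\<exists>d e f. Q d e f" by blast
  qed
  finally show ?thesis .
qed

lemma iota_config:
  assumes lat: "latin_square X9 L" and fr: "framing L \<pi> lab \<alpha> \<beta>" and af: "affine_form c \<alpha> \<beta>"
  shows "iota L (block_index (\<pi> Row i), block_index (\<pi> Column j), block_index (\<pi> Symbol k)) = of_bool (has_intercalate c i j k)"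
proof -
  note R = framing_labels[OF fr]
  note entry = framing_entry[OF fr]
  let ?N = "(block_index (\<pi> Row i), block_index (\<pi> Column j), block_index (\<pi> Symbol k))"
  have idx: "assoc_index L Row I = block_index (\<pi> Row (- (a + a')))"
      "assoc_index L Column I = block_index (\<pi> Column (- (b + b')))"
      "assoc_index L Symbol I = block_index (\<pi> Symbol (- (k1 + k2)))"
    if "I \<subseteq> orth_array X9 L" and I: "I = {(lab Row a x, lab Column b y, lab Symbol k1 z),
        (lab Row a x, lab Column b' y', lab Symbol k2 z'), (lab Row a' x', lab Column b y, lab Symbol k2 z'),
        (lab Row a' x', lab Column b' y', lab Symbol k1 z)}" for I a a' b b' k1 k2 x x' y y' z z'
  proof -
    have "coord_val Row ` I = {lab Row a x, lab Row a' x'}" "coord_val Column ` I = {lab Column b y, lab Column b' y'}"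
      "coord_val Symbol ` I = {lab Symbol k1 z, lab Symbol k2 z'}"
      unfolding I by auto
    then show "assoc_index L Row I = block_index (\<pi> Row (- (a + a')))"
      "assoc_index L Column I = block_index (\<pi> Column (- (b + b')))"
      "assoc_index L Symbol I = block_index (\<pi> Symbol (- (k1 + k2)))"
      using assoc_index_labels[OF R that(1)] by blast+
  qed
  have "(\<exists>I. intercalate L I \<and> ?N = (assoc_index L Row I, assoc_index L Column I, assoc_index L Symbol I))
    \<longleftrightarrow> (\<exists>a a' b b' k1 k2. - (a + a') = i \<and> - (b + b') = j \<and> - (k1 + k2) = k \<and> labelled_intercalate \<alpha> \<beta> a a' b b' k1 k2)"
    (is "?l \<longleftrightarrow> ?r")
  proof
    assume ?l
    then obtain I where int: "intercalate L I"
      and N: "?N = (assoc_index L Row I, assoc_index L Column I, assoc_index L Symbol I)"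
      by (elim exE conjE)
    obtain p p' q q' r r' where ne: "p \<noteq> p'" "q \<noteq> q'"
      and I: "I = {(p, q, r), (p, q', r'), (p', q, r'), (p', q', r)}" and O: "I \<subseteq> orth_array X9 L"
      using int unfolding intercalate_def by (elim exE conjE)
    have mem: "(p, q, r) \<in> orth_array X9 L" "(p', q', r) \<in> orth_array X9 L" "(p, q', r') \<in> orth_array X9 L"
      using O unfolding I insert_subset by simp_all
    obtain a x b y k1 z where l1: "p = lab Row a x" "q = lab Column b y" "r = lab Symbol k1 z"
      using framing_entries[OF lat fr mem(1)] by metis
    obtain a' x' b' y' where l2: "p' = lab Row a' x'" "q' = lab Column b' y'"
      using framing_entries[OF lat fr mem(2)] by metis
    obtain k2 z' where l3: "r' = lab Symbol k2 z'"
      using framing_entries[OF lat fr mem(3)] by metis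
    note l = l1 l2 l3
    have I': "I = {(lab Row a x, lab Column b y, lab Symbol k1 z),
        (lab Row a x, lab Column b' y', lab Symbol k2 z'), (lab Row a' x', lab Column b y, lab Symbol k2 z'),
        (lab Row a' x', lab Column b' y', lab Symbol k1 z)}"
      by (simp add: I l)
    have "i = - (a + a')" "j = - (b + b')" "k = - (k1 + k2)"
      using N unfolding idx[OF O I'] prod.inject labels_block_index_inject[OF R] by blast+
    moreover have "labelled_intercalate \<alpha> \<beta> a a' b b' k1 k2"
    proof -
      have n: "a = a' \<longrightarrow> x \<noteq> x'" "b = b' \<longrightarrow> y \<noteq> y'"
        using ne by (auto simp: l)
      have e: "(y = x + \<alpha> a b k1 \<and> z = y + \<beta> a b k1) \<and> (y' = x + \<alpha> a b' k2 \<and> z' = y' + \<beta> a b' k2) \<and>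
         (y = x' + \<alpha> a' b k2 \<and> z' = y + \<beta> a' b k2) \<and> (y' = x' + \<alpha> a' b' k1 \<and> z = y' + \<beta> a' b' k1)"
        unfolding entry[symmetric] using O unfolding I' by blast
      show ?thesis
        unfolding labelled_intercalate_def
        by (intro exI[of _ x] exI[of _ x'] exI[of _ y] exI[of _ y'] exI[of _ z] exI[of _ z'])
          (rule conjI[OF n(1) conjI[OF n(2) e]])
    qed
    ultimately show ?r
      by metis
  next
    assume ?r
    then obtain a a' b b' k1 k2 where ijk: "- (a + a') = i" "- (b + b') = j" "- (k1 + k2) = k" 
      and q: "labelled_intercalate \<alpha> \<beta> a a' b b' k1 k2"
      by blast
    obtain x x' y y' z z' where ne: "a = a' \<longrightarrow> x \<noteq> x'" "b = b' \<longrightarrow> y \<noteq> y'"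
      and e: "(y = x + \<alpha> a b k1 \<and> z = y + \<beta> a b k1)" "(y' = x + \<alpha> a b' k2 \<and> z' = y' + \<beta> a b' k2)"
        "(y = x' + \<alpha> a' b k2 \<and> z' = y + \<beta> a' b k2)" "(y' = x' + \<alpha> a' b' k1 \<and> z = y' + \<beta> a' b' k1)"
      using q unfolding labelled_intercalate_def by (elim exE conjE) (rule that; simp only: simp_thms)
    define I where "I = {(lab Row a x, lab Column b y, lab Symbol k1 z),
        (lab Row a x, lab Column b' y', lab Symbol k2 z'), (lab Row a' x', lab Column b y, lab Symbol k2 z'),
        (lab Row a' x', lab Column b' y', lab Symbol k1 z)}"
    have O: "I \<subseteq> orth_array X9 L"
      unfolding I_def insert_subset entry using e by simp
    have "lab Row a x \<noteq> lab Row a' x'" "lab Column b y \<noteq> lab Column b' y'"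
      using ne by (auto simp: labels_inject[OF R])
    then have "intercalate L I"
      unfolding intercalate_def using O I_def by metis
    moreover have "?N = (assoc_index L Row I, assoc_index L Column I, assoc_index L Symbol I)"
      unfolding idx[OF O I_def] ijk ..
    ultimately show ?l
      by blast
  qed
  then have "has_intercalate c i j k \<longleftrightarrow> (\<exists>I. intercalate L I \<and> ?N = (assoc_index L Row I, assoc_index L Column I, assoc_index L Symbol I))"
    unfolding has_intercalate_iff[OF af] by blast
  moreover have "?N \<in> Idx \<times> Idx \<times> Idx"
    using block_index_in_Idx by (simp only: mem_Sigma_iff simp_thms)
  ultimately show ?thesis
    unfolding iota_def restrict_apply by (simp only: if_True prod.case of_bool_def)
qed

section \<open>Minisquares in terms of signs\<close>

definition constant_row :: "mat \<Rightarrow> f3 \<Rightarrow> bool" where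
  "constant_row m i \<longleftrightarrow> at m i One = at m i Zer \<and> at m i Two = at m i Zer"

definition constant_column :: "mat \<Rightarrow> f3 \<Rightarrow> bool" where
  "constant_column m j \<longleftrightarrow> at m One j = at m Zer j \<and> at m Two j = at m Zer j"

definition row_twins :: "mat \<Rightarrow> f3 \<Rightarrow> f3 \<Rightarrow> bool" where
  "row_twins m i j \<longleftrightarrow> at m i (j + One) = at m i (j + Two)"

definition column_twins :: "mat \<Rightarrow> f3 \<Rightarrow> f3 \<Rightarrow> bool" where
  "column_twins m i j \<longleftrightarrow> at m (i + One) j = at m (i + Two) j"

fun edge :: "config \<Rightarrow> coord \<Rightarrow> f3 \<Rightarrow> coord \<Rightarrow> f3 \<Rightarrow> bool" where
  "edge (s, t, u) Row i Column j \<longleftrightarrow> row_twins s i j \<and> constant_row u i"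
| "edge (s, t, u) Column j Row i \<longleftrightarrow> column_twins s i j \<and> constant_row t j"
| "edge (s, t, u) Column j Symbol k \<longleftrightarrow> row_twins t j k \<and> constant_column s j"
| "edge (s, t, u) Symbol k Column j \<longleftrightarrow> column_twins t j k \<and> constant_column u k"
| "edge (s, t, u) Row i Symbol k \<longleftrightarrow> row_twins u i k \<and> constant_row s i"
| "edge (s, t, u) Symbol k Row i \<longleftrightarrow> column_twins u i k \<and> constant_column t k"
| "edge (s, t, u) _ _ _ _ \<longleftrightarrow> False"

text \<open>Both families consist of the translates of one transversal. They agree iff the second
  transversal is a translate of the first, that is, iff the shifts differ by a constant.\<close>

lemma shift_families:
  assumes R: "block_labels p R"
  shows "range (\<lambda>y. {R c (y + D c) | c. True}) = range (\<lambda>y. {R c (y + D' c) | c. True}) \<longleftrightarrow>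
    (\<forall>c. D c - D' c = D Zer - D' Zer)"
    (is "range (?F D) = range (?F D') \<longleftrightarrow> _")
proof -
  have sub: "D c - D' c = y' - y" if "?F D y = ?F D' y'" for y y' D D' c
  proof -
    have "R c (y + D c) \<in> ?F D' y'"
      using that by blast
    then have "y + D c = y' + D' c"
      using labels_inject[OF R] by auto
    then show ?thesis
      by (simp add: algebra_simps eq_diff_eq diff_eq_eq)
  qed
  show ?thesis
  proof
    assume "range (?F D) = range (?F D')"
    then have "?F D Zer \<in> range (?F D')"
      by blast
    then obtain y' where "?F D Zer = ?F D' y'"
      by blast
    from sub[OF this] show "\<forall>c. D c - D' c = D Zer - D' Zer"
      by simp
  next
    assume *: "\<forall>c. D c - D' c = D Zer - D' Zer"
    have "y + D c = (y + (D Zer - D' Zer)) + D' c" for y c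
      using *[rule_format, of c] by (simp add: algebra_simps diff_eq_eq)
    then have 1: "?F D y = ?F D' (y + (D Zer - D' Zer))" for y
      by (simp only:)
    have "range (\<lambda>y. G (y + a)) = range G" for G :: "f3 \<Rightarrow> nat set" and a
      by (auto simp: image_iff) (metis diff_add_cancel)
    then show "range (?F D) = range (?F D')"
      unfolding 1 .
  qed
qed

lemma others_agree: "(\<forall>i j. i \<noteq> n \<longrightarrow> j \<noteq> n \<longrightarrow> G i = G j) \<longleftrightarrow> G (n + One) = G (n + Two)"
  by (cases n) (auto simp: all_f3)

text \<open>Edges of all six kinds reduce to one computation once the sets of coordinates that are
  compared are known to be translates of transversals with shifts \<open>D\<close>.\<close>

lemma mu_edge_shift:
  assumes R: "\<And>c. block_labels (\<pi> c) (lab c)" and uwt: "u \<noteq> w" "t \<noteq> u" "t \<noteq> w"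
    and M: "\<And>n y. mini_set L (u, block_index (\<pi> u m)) w t (lab w n y) = {lab t c (y + D n c) | c. True}"
  shows "((u, block_index (\<pi> u m)), (w, block_index (\<pi> w n))) \<in> mu L \<longleftrightarrow>
    (\<forall>c. D (n + One) c - D (n + Two) c = D (n + One) Zer - D (n + Two) Zer)"
proof -
  let ?F = "\<lambda>j. mini_set L (u, block_index (\<pi> u m)) w t ` block j"
  have third: "t' \<noteq> u \<and> t' \<noteq> w \<longleftrightarrow> t' = t" for t'
    using uwt by (cases t'; cases t; cases u; cases w; simp)
  have F: "?F (block_index (\<pi> w j)) = range (\<lambda>y. {lab t c (y + D j c) | c. True})" for j
    unfolding labels_block[OF R] image_image M ..
  have idx: "\<And>j. block_index (\<pi> w j) \<in> Idx"
    by (rule block_index_in_Idx)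
  have "((u, block_index (\<pi> u m)), (w, block_index (\<pi> w n))) \<in> mu L \<longleftrightarrow>
      (\<forall>t. t \<noteq> u \<and> t \<noteq> w \<longrightarrow> (\<forall>i \<in> Idx - {block_index (\<pi> w n)}. \<forall>j \<in> Idx - {block_index (\<pi> w n)}.
         mini_set L (u, block_index (\<pi> u m)) w t ` block i = mini_set L (u, block_index (\<pi> u m)) w t ` block j))"
    unfolding mu_def using uwt(1) block_index_in_Idx by simp
  also have "\<dots> \<longleftrightarrow> (\<forall>i \<in> Idx - {block_index (\<pi> w n)}. \<forall>j \<in> Idx - {block_index (\<pi> w n)}. ?F i = ?F j)"
    unfolding third by (simp only: simp_thms)
  also have "\<dots> \<longleftrightarrow> (\<forall>i j. i \<noteq> n \<longrightarrow> j \<noteq> n \<longrightarrow> ?F (block_index (\<pi> w i)) = ?F (block_index (\<pi> w j)))" (is "?A \<longleftrightarrow> ?B")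
  proof
    assume ?A
    then show ?B
      using idx labels_block_index_inject[OF R] by (metis DiffI singletonD)
  next
    assume B: ?B
    show ?A
    proof (intro ballI)
      fix i j assume ij: "i \<in> Idx - {block_index (\<pi> w n)}" "j \<in> Idx - {block_index (\<pi> w n)}"
      obtain i' where "i = block_index (\<pi> w i')"
        using Idx_labels[OF R] ij(1) by blast
      moreover obtain j' where "j = block_index (\<pi> w j')"
        using Idx_labels[OF R] ij(2) by blast
      ultimately show "?F i = ?F j"
        using B ij by (metis Diff_iff singletonI)
    qed
  qed
  also have "\<dots> \<longleftrightarrow> ?F (block_index (\<pi> w (n + One))) = ?F (block_index (\<pi> w (n + Two)))"
    by (rule others_agree)
  also have "\<dots> \<longleftrightarrow> (\<forall>c. D (n + One) c - D (n + Two) c = D (n + One) Zer - D (n + Two) Zer)"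
    unfolding F by (rule shift_families[OF R])
  finally show ?thesis .
qed

text \<open>A difference of two signs multiplied by \<open>c\<close> takes all three values unless it vanishes,
  whereas differences of signs from a fixed sign take at most two values.\<close>

lemma sign_line:
  assumes "\<And>c. X c - X Zer = (sg p - sg q) * c - (sg (v c) - sg (v Zer)) \<or>
      X c - X Zer = - ((sg p - sg q) * c - (sg (v c) - sg (v Zer)))"
  shows "(\<forall>c. X c = X Zer) \<longleftrightarrow> p = q \<and> v One = v Zer \<and> v Two = (v Zer :: bool)"
proof -
  have "X c = X Zer \<longleftrightarrow> (sg p - sg q) * c = sg (v c) - sg (v Zer)" for c
    using assms[of c] by (cases "X c"; cases "X Zer"; cases "(sg p - sg q) * c"; cases "sg (v c) - sg (v Zer)"; simp)
  then show ?thesis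
    unfolding all_f3 by (cases p; cases q; cases "v Zer"; cases "v One"; cases "v Two"; simp)
qed

text \<open>For an edge from band \<open>m\<close> to stack \<open>n\<close> the differences of \<open>\<beta>\<close> between the two other
  stacks have to be the same for all piles. The mixed difference of \<open>\<beta>\<close> is minus that of \<open>\<alpha>\<close> and
  \<open>\<gamma>\<close>, which only involves slopes. The other kinds of edges arise by permuting the coordinates.\<close>

lemma mu_config:
  assumes lat: "latin_square X9 L" and fr: "framing L \<pi> lab \<alpha> \<beta>" and af: "affine_form c \<alpha> \<beta>"
  shows "((v, block_index (\<pi> v m)), (w, block_index (\<pi> w n))) \<in> mu L \<longleftrightarrow> edge c v m w n"
proof -
  note R = framing_labels[OF fr]
  note entry = framing_entry[OF fr]
  obtain s t u where c: "c = (s, t, u)"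
    by (cases c)
  have a: "\<alpha> i j k = ent s i j * k + \<alpha> i j Zer" for i j k
    using af unfolding c affine_form.simps by blast
  have b: "\<beta> i j k = ent t j k * i + \<beta> Zer j k" for i j k
    using af unfolding c affine_form.simps by blast
  have g: "\<alpha> i j k + \<beta> i j k = (\<alpha> i Zer k + \<beta> i Zer k) - ent u i k * j" for i j k
    using af unfolding c affine_form.simps by (metis minus_diff_eq minus_minus)
  have mem: "lab c i x \<in> block (block_index (\<pi> c m)) \<longleftrightarrow> i = m" for c i x m
    by (rule labels_in_block[OF R])
  have rc: "mini_set L (Row, block_index (\<pi> Row m)) Column Symbol (lab Column n y) = {lab Symbol k (y + \<beta> m n k) | k. True}" for m n y
  proof (intro equalityI subsetI)
    fix r assume "r \<in> mini_set L (Row, block_index (\<pi> Row m)) Column Symbol (lab Column n y)"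
    then obtain p where e: "(p, lab Column n y, r) \<in> orth_array X9 L" and p: "p \<in> block (block_index (\<pi> Row m))"
      by (auto simp: mini_set_def slice_def)
    show "r \<in> {lab Symbol k (y + \<beta> m n k) | k. True}"
      by (rule framing_entries[OF lat fr e]) (use p in \<open>auto simp: mem labels_inject[OF R]\<close>)
  next
    fix r assume "r \<in> {lab Symbol k (y + \<beta> m n k) | k. True}"
    then obtain k where r: "r = lab Symbol k (y + \<beta> m n k)"
      by blast
    have "(lab Row m (y - \<alpha> m n k), lab Column n y, r) \<in> orth_array X9 L"
      unfolding r entry by simp
    then show "r \<in> mini_set L (Row, block_index (\<pi> Row m)) Column Symbol (lab Column n y)"
      unfolding mini_set_def slice_def by (force simp: mem)
  qed
  have rs: "mini_set L (Row, block_index (\<pi> Row m)) Symbol Column (lab Symbol n z) = {lab Column j (z + - \<beta> m j n) | j. True}" for m n z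
  proof (intro equalityI subsetI)
    fix r assume "r \<in> mini_set L (Row, block_index (\<pi> Row m)) Symbol Column (lab Symbol n z)"
    then obtain p where e: "(p, r, lab Symbol n z) \<in> orth_array X9 L" and p: "p \<in> block (block_index (\<pi> Row m))"
      by (auto simp: mini_set_def slice_def)
    show "r \<in> {lab Column j (z + - \<beta> m j n) | j. True}"
      by (rule framing_entries[OF lat fr e]) (use p in \<open>auto simp: mem labels_inject[OF R]\<close>)
  next
    fix r assume "r \<in> {lab Column j (z + - \<beta> m j n) | j. True}"
    then obtain j where r: "r = lab Column j (z + - \<beta> m j n)"
      by blast
    have "(lab Row m (z - \<beta> m j n - \<alpha> m j n), r, lab Symbol n z) \<in> orth_array X9 L"
      unfolding r entry by simp
    then show "r \<in> mini_set L (Row, block_index (\<pi> Row m)) Symbol Column (lab Symbol n z)"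
      unfolding mini_set_def slice_def by (force simp: mem)
  qed
  have cr: "mini_set L (Column, block_index (\<pi> Column m)) Row Symbol (lab Row n x) = {lab Symbol k (x + (\<alpha> n m k + \<beta> n m k)) | k. True}" for m n x
  proof (intro equalityI subsetI)
    fix r assume "r \<in> mini_set L (Column, block_index (\<pi> Column m)) Row Symbol (lab Row n x)"
    then obtain p where e: "(lab Row n x, p, r) \<in> orth_array X9 L" and p: "p \<in> block (block_index (\<pi> Column m))"
      by (auto simp: mini_set_def slice_def)
    show "r \<in> {lab Symbol k (x + (\<alpha> n m k + \<beta> n m k)) | k. True}"
      by (rule framing_entries[OF lat fr e]) (use p in \<open>auto simp: mem labels_inject[OF R] add.assoc\<close>)
  next
    fix r assume "r \<in> {lab Symbol k (x + (\<alpha> n m k + \<beta> n m k)) | k. True}"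
    then obtain k where r: "r = lab Symbol k (x + (\<alpha> n m k + \<beta> n m k))"
      by blast
    have "(lab Row n x, lab Column m (x + \<alpha> n m k), r) \<in> orth_array X9 L"
      unfolding r entry by (simp add: add.assoc)
    then show "r \<in> mini_set L (Column, block_index (\<pi> Column m)) Row Symbol (lab Row n x)"
      unfolding mini_set_def slice_def by (force simp: mem)
  qed
  have cs: "mini_set L (Column, block_index (\<pi> Column m)) Symbol Row (lab Symbol n z) = {lab Row i (z + - (\<alpha> i m n + \<beta> i m n)) | i. True}" for m n z
  proof (intro equalityI subsetI)
    fix r assume "r \<in> mini_set L (Column, block_index (\<pi> Column m)) Symbol Row (lab Symbol n z)"
    then obtain p where e: "(r, p, lab Symbol n z) \<in> orth_array X9 L" and p: "p \<in> block (block_index (\<pi> Column m))"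
      by (auto simp: mini_set_def slice_def)
    show "r \<in> {lab Row i (z + - (\<alpha> i m n + \<beta> i m n)) | i. True}"
      by (rule framing_entries[OF lat fr e]) (use p in \<open>auto simp: mem labels_inject[OF R] algebra_simps\<close>)
  next
    fix r assume "r \<in> {lab Row i (z + - (\<alpha> i m n + \<beta> i m n)) | i. True}"
    then obtain i where r: "r = lab Row i (z + - (\<alpha> i m n + \<beta> i m n))"
      by blast
    have "(r, lab Column m (z - \<beta> i m n), lab Symbol n z) \<in> orth_array X9 L"
      unfolding r entry by (simp add: algebra_simps)
    then show "r \<in> mini_set L (Column, block_index (\<pi> Column m)) Symbol Row (lab Symbol n z)"
      unfolding mini_set_def slice_def by (force simp: mem)
  qed
  have sr: "mini_set L (Symbol, block_index (\<pi> Symbol m)) Row Column (lab Row n x) = {lab Column j (x + \<alpha> n j m) | j. True}" for m n x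
  proof (intro equalityI subsetI)
    fix r assume "r \<in> mini_set L (Symbol, block_index (\<pi> Symbol m)) Row Column (lab Row n x)"
    then obtain p where e: "(lab Row n x, r, p) \<in> orth_array X9 L" and p: "p \<in> block (block_index (\<pi> Symbol m))"
      by (auto simp: mini_set_def slice_def)
    show "r \<in> {lab Column j (x + \<alpha> n j m) | j. True}"
      by (rule framing_entries[OF lat fr e]) (use p in \<open>auto simp: mem labels_inject[OF R]\<close>)
  next
    fix r assume "r \<in> {lab Column j (x + \<alpha> n j m) | j. True}"
    then obtain j where r: "r = lab Column j (x + \<alpha> n j m)"
      by blast
    have "(lab Row n x, r, lab Symbol m (x + \<alpha> n j m + \<beta> n j m)) \<in> orth_array X9 L"
      unfolding r entry by simp
    then show "r \<in> mini_set L (Symbol, block_index (\<pi> Symbol m)) Row Column (lab Row n x)"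
      unfolding mini_set_def slice_def by (force simp: mem)
  qed
  have sc: "mini_set L (Symbol, block_index (\<pi> Symbol m)) Column Row (lab Column n y) = {lab Row i (y + - \<alpha> i n m) | i. True}" for m n y
  proof (intro equalityI subsetI)
    fix r assume "r \<in> mini_set L (Symbol, block_index (\<pi> Symbol m)) Column Row (lab Column n y)"
    then obtain p where e: "(r, lab Column n y, p) \<in> orth_array X9 L" and p: "p \<in> block (block_index (\<pi> Symbol m))"
      by (auto simp: mini_set_def slice_def)
    show "r \<in> {lab Row i (y + - \<alpha> i n m) | i. True}"
      by (rule framing_entries[OF lat fr e]) (use p in \<open>auto simp: mem labels_inject[OF R]\<close>)
  next
    fix r assume "r \<in> {lab Row i (y + - \<alpha> i n m) | i. True}"
    then obtain i where r: "r = lab Row i (y + - \<alpha> i n m)"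
      by blast
    have "(r, lab Column n y, lab Symbol m (y + \<beta> i n m)) \<in> orth_array X9 L"
      unfolding r entry by simp
    then show "r \<in> mini_set L (Symbol, block_index (\<pi> Symbol m)) Column Row (lab Column n y)"
      unfolding mini_set_def slice_def by (force simp: mem)
  qed
  \<comment> \<open>The blocks other than \<open>n\<close> are \<open>n + 1\<close> and \<open>n + 2\<close>.\<close>
  have d: "(n + One) - (n + Two) = Two" for n
    by (cases n) simp_all
  have A: "ent s i j * k = \<alpha> i j k - \<alpha> i j Zer" for i j k
    by (subst a) simp
  have B: "ent t j k * i = \<beta> i j k - \<beta> Zer j k" for i j k
    by (subst b) simp
  have G: "ent u i k * j = (\<alpha> i Zer k + \<beta> i Zer k) - (\<alpha> i j k + \<beta> i j k)" for i j k
    by (subst g) simp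
  have neg: "sg b = - (sg b * Two)" "- ent m i j = ent m i j * (n + One) - ent m i j * (n + Two)" for b m i j n
    by (simp_all add: right_diff_distrib[symmetric] d)
  have line: "(\<forall>c. D (n + One) c - D (n + Two) c = D (n + One) Zer - D (n + Two) Zer) \<longleftrightarrow> p = q \<and> v One = v Zer \<and> v Two = v Zer"
    if "\<And>c. (D (n + One) c - D (n + Two) c) - (D (n + One) Zer - D (n + Two) Zer) =
          (sg p * c - sg q * c) + ((sg (v c) * (n + One) - sg (v c) * (n + Two)) - (sg (v Zer) * (n + One) - sg (v Zer) * (n + Two))) \<or>
        (D (n + One) c - D (n + Two) c) - (D (n + One) Zer - D (n + Two) Zer) =
          - ((sg p * c - sg q * c) + ((sg (v c) * (n + One) - sg (v c) * (n + Two)) - (sg (v Zer) * (n + One) - sg (v Zer) * (n + Two))))" 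
      for D n p q v
  proof (rule sign_line)
    fix c
    have "(sg p * c - sg q * c) + ((sg (v c) * (n + One) - sg (v c) * (n + Two)) - (sg (v Zer) * (n + One) - sg (v Zer) * (n + Two)))
       = (sg p - sg q) * c - (sg (v c) - sg (v Zer))"
      by (simp add: right_diff_distrib[symmetric] d left_diff_distrib)
    then show "(D (n + One) c - D (n + Two) c) - (D (n + One) Zer - D (n + Two) Zer) = (sg p - sg q) * c - (sg (v c) - sg (v Zer)) \<or>
        (D (n + One) c - D (n + Two) c) - (D (n + One) Zer - D (n + Two) Zer) = - ((sg p - sg q) * c - (sg (v c) - sg (v Zer)))"
      using that[of c] by simp
  qed
  note shift = mu_edge_shift[OF R]
  note ABG = A[unfolded ent_def] B[unfolded ent_def] G[unfolded ent_def]
  show ?thesis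
  proof (cases v; cases w)
    assume vw: "v = Row" "w = Column"
    have "((Row, block_index (\<pi> Row m)), (Column, block_index (\<pi> Column n))) \<in> mu L \<longleftrightarrow>
       at s m (n + One) = at s m (n + Two) \<and> at u m One = at u m Zer \<and> at u m Two = at u m Zer"
      by (subst shift[OF _ _ _ rc], simp_all only: coord.distinct not_False_eq_True, rule line)
        (unfold ABG, simp add: algebra_simps)
    then show ?thesis
      by (simp add: vw c row_twins_def constant_row_def)
  next
    assume vw: "v = Row" "w = Symbol"
    have "((Row, block_index (\<pi> Row m)), (Symbol, block_index (\<pi> Symbol n))) \<in> mu L \<longleftrightarrow>
       at u m (n + One) = at u m (n + Two) \<and> at s m One = at s m Zer \<and> at s m Two = at s m Zer"
      by (subst shift[OF _ _ _ rs], simp_all only: coord.distinct not_False_eq_True, rule line)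
        (unfold ABG, simp add: algebra_simps)
    then show ?thesis
      by (simp add: vw c row_twins_def constant_row_def)
  next
    assume vw: "v = Column" "w = Row"
    have "((Column, block_index (\<pi> Column m)), (Row, block_index (\<pi> Row n))) \<in> mu L \<longleftrightarrow>
       at s (n + One) m = at s (n + Two) m \<and> at t m One = at t m Zer \<and> at t m Two = at t m Zer"
      by (subst shift[OF _ _ _ cr], simp_all only: coord.distinct not_False_eq_True, rule line)
        (unfold ABG, simp add: algebra_simps)
    then show ?thesis
      by (simp add: vw c column_twins_def constant_row_def)
  next
    assume vw: "v = Column" "w = Symbol"
    have "((Column, block_index (\<pi> Column m)), (Symbol, block_index (\<pi> Symbol n))) \<in> mu L \<longleftrightarrow>
       at t m (n + One) = at t m (n + Two) \<and> at s One m = at s Zer m \<and> at s Two m = at s Zer m"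
      by (subst shift[OF _ _ _ cs], simp_all only: coord.distinct not_False_eq_True, rule line)
        (unfold ABG, simp add: algebra_simps)
    then show ?thesis
      by (simp add: vw c row_twins_def constant_column_def)
  next
    assume vw: "v = Symbol" "w = Row"
    have "((Symbol, block_index (\<pi> Symbol m)), (Row, block_index (\<pi> Row n))) \<in> mu L \<longleftrightarrow>
       at u (n + One) m = at u (n + Two) m \<and> at t One m = at t Zer m \<and> at t Two m = at t Zer m"
      by (subst shift[OF _ _ _ sr], simp_all only: coord.distinct not_False_eq_True, rule line)
        (unfold ABG, simp add: algebra_simps)
    then show ?thesis
      by (simp add: vw c column_twins_def constant_column_def)
  next
    assume vw: "v = Symbol" "w = Column"
    have "((Symbol, block_index (\<pi> Symbol m)), (Column, block_index (\<pi> Column n))) \<in> mu L \<longleftrightarrow>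
       at t (n + One) m = at t (n + Two) m \<and> at u One m = at u Zer m \<and> at u Two m = at u Zer m"
      by (subst shift[OF _ _ _ sc], simp_all only: coord.distinct not_False_eq_True, rule line)
        (unfold ABG, simp add: algebra_simps)
    then show ?thesis
      by (simp add: vw c column_twins_def constant_column_def)
  qed (simp_all add: c mu_def)
qed

section \<open>Equivalence of invariants as equality of canonical cubes\<close>

definition iota_cube :: "config \<Rightarrow> bool cube" where
  "iota_cube c = cube (has_intercalate c)"

text \<open>A digraph on the nine vertices is encoded in a cube, so that permutations of bands, stacks
  and piles become index permutations. Every edge is repeated three times.\<close>

definition edges :: "config \<Rightarrow> f3 \<Rightarrow> f3 \<Rightarrow> f3 \<Rightarrow> (bool \<times> bool) tri" where
  "edges c i j k = Tri (edge c Row i Column j, edge c Column j Row i)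
     (edge c Column j Symbol k, edge c Symbol k Column j) (edge c Row i Symbol k, edge c Symbol k Row i)"

definition mu_cube :: "config \<Rightarrow> (bool \<times> bool) tri cube" where
  "mu_cube c = cube (edges c)"

text \<open>Permutations of the block numbers \<open>1, 2, 3\<close> correspond to permutations of \<^typ>\<open>f3\<close>,
  even if two squares use different renumberings \<open>b\<close> and \<open>b'\<close> of the blocks.\<close>

lemma index_bij_of_permutes:
  assumes "bij_betw b UNIV Idx" "bij_betw b' UNIV Idx" "\<sigma> permutes Idx"
  shows "\<exists>P. bij P \<and> (\<forall>i::f3. \<sigma> (b i) = b' (P i))"
proof (intro exI conjI allI)
  have "bij_betw \<sigma> Idx Idx"
    using assms(3) by (rule permutes_imp_bij)
  from bij_betw_trans[OF bij_betw_trans[OF assms(1) this] bij_betw_inv_into[OF assms(2)]]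
  show "bij (inv_into UNIV b' \<circ> (\<sigma> \<circ> b))"
    by (simp add: comp_assoc)
  have "\<sigma> (b i) \<in> Idx" for i
    using assms(1,3) by (meson bij_betwE UNIV_I permutes_in_image)
  then show "\<sigma> (b i) = b' ((inv_into UNIV b' \<circ> (\<sigma> \<circ> b)) i)" for i
    using assms(2) by (metis bij_betw_inv_into_right comp_apply)
qed

lemma permutes_of_index_bij:
  assumes "bij_betw b UNIV Idx" "bij_betw b' UNIV Idx" "bij P"
  shows "\<exists>\<sigma>. \<sigma> permutes Idx \<and> (\<forall>i::f3. \<sigma> (b i) = b' (P i))"
proof (intro exI conjI allI)
  let ?s = "\<lambda>n. if n \<in> Idx then (b' \<circ> (P \<circ> inv_into UNIV b)) n else n"
  have "bij_betw (b' \<circ> (P \<circ> inv_into UNIV b)) Idx Idx"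
    using bij_betw_trans[OF bij_betw_trans[OF bij_betw_inv_into[OF assms(1)] assms(3)] assms(2)] .
  then have "bij_betw ?s Idx Idx"
    by (rule bij_betw_cong[THEN iffD1, rotated]) (simp only: if_True)
  then show "?s permutes Idx"
    by (rule bij_imp_permutes) (simp only: if_False)
  have "b i \<in> Idx" for i
    using assms(1) by (meson bij_betwE UNIV_I)
  moreover have "inv_into UNIV b (b i) = i" for i
    using assms(1) by (meson bij_betw_inv_into_left UNIV_I)
  ultimately show "?s (b i) = b' (P i)" for i
    by (simp only: if_True comp_apply)
qed

lemma bij_labels_block_index:
  assumes "block_labels p R"
  shows "bij_betw (\<lambda>i. block_index (p i)) UNIV Idx"
  using bij_betw_trans[OF _ bij_block_index, of p UNIV] assms by (simp add: block_labels_def comp_def)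

lemma iota_in: "iota L \<in> Idx \<times> Idx \<times> Idx \<rightarrow>\<^sub>E {0, 1}"
proof -
  have "((if P then 1 else 0 :: nat) \<in> {0, 1}) = True" for P
    by simp
  then show ?thesis
    unfolding iota_def restrict_PiE_iff by (simp only: split_beta ball_triv simp_thms)
qed

lemma equiv_iota_equiv: "equiv (Idx \<times> Idx \<times> Idx \<rightarrow>\<^sub>E {0, 1}) iota_equiv"
proof -
  define K where "K = Idx"
  define X where "X = (K \<times> K \<times> K \<rightarrow>\<^sub>E {0, 1 :: nat})"
  have eq: "iota_equiv = {(A, A'). A \<in> X \<and> A' \<in> X \<and> (\<exists>\<pi> \<sigma> \<tau>. \<pi> permutes K \<and> \<sigma> permutes K \<and> \<tau> permutes K \<and>
        (\<forall>i\<in>K. \<forall>j\<in>K. \<forall>k\<in>K. A' (\<pi> i, \<sigma> j, \<tau> k) = A (i, j, k)))}"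
    unfolding iota_equiv_def K_def X_def ..
  have "equiv X iota_equiv"
  proof (rule equivI)
    show "iota_equiv \<subseteq> X \<times> X"
      unfolding eq by auto
    show "refl_on X iota_equiv"
    proof (rule refl_onI)
      fix A assume "A \<in> X"
      moreover have "\<exists>\<pi> \<sigma> \<tau>. \<pi> permutes K \<and> \<sigma> permutes K \<and> \<tau> permutes K \<and>
          (\<forall>i\<in>K. \<forall>j\<in>K. \<forall>k\<in>K. A (\<pi> i, \<sigma> j, \<tau> k) = A (i, j, k))"
        by (intro exI[of _ id] conjI permutes_id) simp
      ultimately show "(A, A) \<in> iota_equiv"
        unfolding eq by simp
    qed
    show "sym iota_equiv"
    proof (rule symI)
      fix A A' assume "(A, A') \<in> iota_equiv"
      then obtain \<pi> \<sigma> \<tau> where X: "A \<in> X" "A' \<in> X" and p: "\<pi> permutes K" "\<sigma> permutes K" "\<tau> permutes K"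
        and e: "\<forall>i\<in>K. \<forall>j\<in>K. \<forall>k\<in>K. A' (\<pi> i, \<sigma> j, \<tau> k) = A (i, j, k)"
        unfolding eq by blast
      have "inv \<pi> permutes K" "inv \<sigma> permutes K" "inv \<tau> permutes K"
        using p by (simp_all add: permutes_inv)
      moreover have "A (inv \<pi> i, inv \<sigma> j, inv \<tau> k) = A' (i, j, k)" if "i \<in> K" "j \<in> K" "k \<in> K" for i j k
      proof -
        have "inv \<pi> i \<in> K" "inv \<sigma> j \<in> K" "inv \<tau> k \<in> K"
          using that calculation by (simp_all add: permutes_in_image)
        with e have "A' (\<pi> (inv \<pi> i), \<sigma> (inv \<sigma> j), \<tau> (inv \<tau> k)) = A (inv \<pi> i, inv \<sigma> j, inv \<tau> k)"
          by blast
        then show ?thesis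
          by (simp only: permutes_inverses(1)[OF p(1)] permutes_inverses(1)[OF p(2)] permutes_inverses(1)[OF p(3)])
      qed
      ultimately show "(A', A) \<in> iota_equiv"
        unfolding eq using X by blast
    qed
    show "trans iota_equiv"
    proof (rule transI)
      fix A B C assume "(A, B) \<in> iota_equiv" "(B, C) \<in> iota_equiv"
      obtain \<pi> \<sigma> \<tau> where A: "A \<in> X" and p: "\<pi> permutes K" "\<sigma> permutes K" "\<tau> permutes K"
        and e: "\<forall>i\<in>K. \<forall>j\<in>K. \<forall>k\<in>K. B (\<pi> i, \<sigma> j, \<tau> k) = A (i, j, k)"
        using \<open>(A, B) \<in> iota_equiv\<close> unfolding eq by blast
      obtain \<pi>' \<sigma>' \<tau>' where C: "C \<in> X" and p': "\<pi>' permutes K" "\<sigma>' permutes K" "\<tau>' permutes K"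
        and e': "\<forall>i\<in>K. \<forall>j\<in>K. \<forall>k\<in>K. C (\<pi>' i, \<sigma>' j, \<tau>' k) = B (i, j, k)"
        using \<open>(B, C) \<in> iota_equiv\<close> unfolding eq by blast
      have "(\<pi>' \<circ> \<pi>) permutes K" "(\<sigma>' \<circ> \<sigma>) permutes K" "(\<tau>' \<circ> \<tau>) permutes K"
        using p p' by (simp_all add: permutes_compose)
      moreover have "C ((\<pi>' \<circ> \<pi>) i, (\<sigma>' \<circ> \<sigma>) j, (\<tau>' \<circ> \<tau>) k) = A (i, j, k)" if "i \<in> K" "j \<in> K" "k \<in> K" for i j k
        using e e' that p by (simp add: permutes_in_image)
      ultimately show "(A, C) \<in> iota_equiv"
        unfolding eq using A C by blast
    qed
  qed
  then show ?thesis
    by (simp only: X_def K_def)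
qed

lemma iota_class_eq_iff: "iota_class L = iota_class L' \<longleftrightarrow> (iota L, iota L') \<in> iota_equiv"
  unfolding iota_class_def by (rule eq_equiv_class_iff[OF equiv_iota_equiv iota_in iota_in])

lemma iota_class_config:
  assumes L: "division_sudoku L" "has_config L c" and L': "division_sudoku L'" "has_config L' c'"
  shows "iota_class L = iota_class L' \<longleftrightarrow> canon (iota_cube c) = canon (iota_cube c')"
proof -
  have lat: "latin_square X9 L" "latin_square X9 L'"
    using L(1) L'(1) by (simp_all add: division_sudoku_def)
  obtain \<pi> lab \<alpha> \<beta> where fr: "framing L \<pi> lab \<alpha> \<beta>" and af: "affine_form c \<alpha> \<beta>"
    using L(2) unfolding has_config_def by blast
  obtain \<pi>' lab' \<alpha>' \<beta>' where fr': "framing L' \<pi>' lab' \<alpha>' \<beta>'" and af': "affine_form c' \<alpha>' \<beta>'"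
    using L'(2) unfolding has_config_def by blast
  let ?b = "\<lambda>v i. block_index (\<pi> v i)" and ?b' = "\<lambda>v i. block_index (\<pi>' v i)"
  have b: "bij_betw (?b v) UNIV Idx" "bij_betw (?b' v) UNIV Idx" for v
    using bij_labels_block_index framing_labels fr fr' by blast+
  have all: "(\<forall>n\<in>Idx. Q n) \<longleftrightarrow> (\<forall>i. Q (?b v i))" for Q v
    using b(1)[of v] by (metis bij_betw_def UNIV_I imageE imageI)
  have conv: "(\<forall>i\<in>Idx. \<forall>j\<in>Idx. \<forall>k\<in>Idx. G i j k) \<longleftrightarrow> (\<forall>i j k. G (?b Row i) (?b Column j) (?b Symbol k))" for G
    by (subst all[of _ Row], subst all[of _ Column], subst all[of _ Symbol]) (rule refl)
  have I: "iota L (?b Row i, ?b Column j, ?b Symbol k) = of_bool (has_intercalate c i j k)" for i j k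
    by (rule iota_config[OF lat(1) fr af])
  have I': "iota L' (?b' Row i, ?b' Column j, ?b' Symbol k) = of_bool (has_intercalate c' i j k)" for i j k
    by (rule iota_config[OF lat(2) fr' af'])
  have "(iota L, iota L') \<in> iota_equiv \<longleftrightarrow>
    (\<exists>\<pi> \<sigma> \<tau>. \<pi> permutes Idx \<and> \<sigma> permutes Idx \<and> \<tau> permutes Idx \<and>
        (\<forall>i j k. iota L' (\<pi> (?b Row i), \<sigma> (?b Column j), \<tau> (?b Symbol k)) = of_bool (has_intercalate c i j k)))"
    (is "_ \<longleftrightarrow> ?l")
    unfolding iota_equiv_def mem_Collect_eq prod.case conv I by (simp only: iota_in simp_thms)
  also have "\<dots> \<longleftrightarrow> (\<exists>P Q R. bij P \<and> bij Q \<and> bij R \<and> (\<forall>i j k. has_intercalate c' (P i) (Q j) (R k) = has_intercalate c i j k))"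
    (is "_ \<longleftrightarrow> ?r")
  proof
    assume ?l
    then obtain p q r where pqr: "p permutes Idx" "q permutes Idx" "r permutes Idx"
      and e: "\<forall>i j k. iota L' (p (?b Row i), q (?b Column j), r (?b Symbol k)) = of_bool (has_intercalate c i j k)"
      by (elim exE conjE)
    obtain P where P: "bij P" "\<And>i. p (?b Row i) = ?b' Row (P i)"
      using index_bij_of_permutes[OF b pqr(1)] by blast
    obtain Q where Q: "bij Q" "\<And>i. q (?b Column i) = ?b' Column (Q i)"
      using index_bij_of_permutes[OF b pqr(2)] by blast
    obtain R where R: "bij R" "\<And>i. r (?b Symbol i) = ?b' Symbol (R i)"
      using index_bij_of_permutes[OF b pqr(3)] by blast
    have "has_intercalate c' (P i) (Q j) (R k) = has_intercalate c i j k" for i j k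
      using e[rule_format, of i j k] unfolding P(2) Q(2) R(2) I' by (simp only: of_bool_eq_iff)
    with P(1) Q(1) R(1) show ?r
      by (intro exI[of _ P] exI[of _ Q] exI[of _ R]) simp
  next
    assume ?r
    then obtain P Q R where PQR: "bij P" "bij Q" "bij R"
      and e: "\<forall>i j k. has_intercalate c' (P i) (Q j) (R k) = has_intercalate c i j k"
      by (elim exE conjE)
    obtain p where p: "p permutes Idx" "\<And>i. p (?b Row i) = ?b' Row (P i)"
      using permutes_of_index_bij[OF b PQR(1)] by blast
    obtain q where q: "q permutes Idx" "\<And>i. q (?b Column i) = ?b' Column (Q i)"
      using permutes_of_index_bij[OF b PQR(2)] by blast
    obtain r where r: "r permutes Idx" "\<And>i. r (?b Symbol i) = ?b' Symbol (R i)"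
      using permutes_of_index_bij[OF b PQR(3)] by blast
    show ?l
      by (intro exI[of _ p] exI[of _ q] exI[of _ r] conjI p(1) q(1) r(1))
        (simp only: p(2) q(2) r(2) I' e[rule_format] simp_thms)
  qed
  also have "\<dots> \<longleftrightarrow> canon (iota_cube c) = canon (iota_cube c')"
    unfolding canon_eq_iff iota_cube_def entry_cube ..
  finally show ?thesis
    unfolding iota_class_eq_iff .
qed

definition relabel :: "(coord \<Rightarrow> nat \<Rightarrow> nat) \<Rightarrow> vertex \<times> vertex \<Rightarrow> vertex \<times> vertex" where
  "relabel \<rho> = (\<lambda>((u, m), (w, n)). ((u, \<rho> u m), (w, \<rho> w n)))"

lemma mu_equiv_relabel:
  "mu_equiv = {(E, E'). E \<subseteq> (UNIV \<times> Idx) \<times> (UNIV \<times> Idx) \<and> (\<exists>\<rho>. (\<forall>c. \<rho> c permutes Idx) \<and> E' = relabel \<rho> ` E)}"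
  unfolding mu_equiv_def relabel_def ..

lemma mu_in: "mu L \<in> Pow ((UNIV \<times> Idx) \<times> (UNIV \<times> Idx))"
  unfolding mu_def by blast

lemma equiv_mu_equiv: "equiv (Pow ((UNIV \<times> Idx) \<times> (UNIV \<times> Idx))) mu_equiv"
proof -
  define K where "K = Idx"
  let ?V = "(UNIV \<times> K) \<times> (UNIV \<times> K) :: (vertex \<times> vertex) set"
  have eq: "mu_equiv = {(E, E'). E \<subseteq> ?V \<and> (\<exists>\<rho>. (\<forall>c. \<rho> c permutes K) \<and> E' = relabel \<rho> ` E)}"
    unfolding mu_equiv_relabel K_def ..
  have V: "relabel \<rho> ` E \<subseteq> ?V" if "E \<subseteq> ?V" "\<forall>c. \<rho> c permutes K" for \<rho> E
    using that by (auto simp: relabel_def permutes_in_image)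
  have "equiv (Pow ?V) mu_equiv"
  proof (rule equivI)
    show "mu_equiv \<subseteq> Pow ?V \<times> Pow ?V"
      unfolding eq using V by blast
    show "refl_on (Pow ?V) mu_equiv"
    proof (rule refl_onI)
      fix E assume "E \<in> Pow ?V"
      moreover have "relabel (\<lambda>_. id) = id"
        by (auto simp: relabel_def)
      ultimately show "(E, E) \<in> mu_equiv"
        unfolding eq using permutes_id[of K] by (auto intro!: exI[of _ "\<lambda>_. id"])
    qed
    show "sym mu_equiv"
    proof (rule symI)
      fix E E' assume "(E, E') \<in> mu_equiv"
      then obtain \<rho> where E: "E \<subseteq> ?V" and r: "\<forall>c. \<rho> c permutes K" and E': "E' = relabel \<rho> ` E"
        unfolding eq by blast
      have "relabel (\<lambda>c. inv (\<rho> c)) (relabel \<rho> e) = e" for e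
        using permutes_inverses(2)[OF r[rule_format]] by (cases e) (auto simp: relabel_def)
      then have "E = relabel (\<lambda>c. inv (\<rho> c)) ` E'"
        unfolding E' image_image by simp
      moreover have "\<forall>c. inv (\<rho> c) permutes K"
        using r by (simp add: permutes_inv)
      moreover have "E' \<subseteq> ?V"
        unfolding E' by (rule V[OF E r])
      ultimately show "(E', E) \<in> mu_equiv"
        unfolding eq mem_Collect_eq prod.case by (intro conjI exI[of _ "\<lambda>c. inv (\<rho> c)"])
    qed
    show "trans mu_equiv"
    proof (rule transI)
      fix E F G assume "(E, F) \<in> mu_equiv" "(F, G) \<in> mu_equiv"
      obtain \<rho> where E: "E \<subseteq> ?V" and r: "\<forall>c. \<rho> c permutes K" and F: "F = relabel \<rho> ` E"
        using \<open>(E, F) \<in> mu_equiv\<close> unfolding eq by blast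
      obtain \<rho>' where r': "\<forall>c. \<rho>' c permutes K" and G: "G = relabel \<rho>' ` F"
        using \<open>(F, G) \<in> mu_equiv\<close> unfolding eq by blast
      have "relabel \<rho>' (relabel \<rho> e) = relabel (\<lambda>c. \<rho>' c \<circ> \<rho> c) e" for e
        by (cases e) (auto simp: relabel_def)
      then have "G = relabel (\<lambda>c. \<rho>' c \<circ> \<rho> c) ` E"
        unfolding G F image_image by simp
      moreover have "\<forall>c. (\<rho>' c \<circ> \<rho> c) permutes K"
        using r r' by (simp add: permutes_compose)
      ultimately show "(E, G) \<in> mu_equiv"
        unfolding eq mem_Collect_eq prod.case using E by (intro conjI exI[of _ "\<lambda>c. \<rho>' c \<circ> \<rho> c"])
    qed
  qed
  then show ?thesis
    by (simp only: K_def)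
qed

lemma mu_class_eq_iff: "mu_class L = mu_class L' \<longleftrightarrow> (mu L, mu L') \<in> mu_equiv"
  unfolding mu_class_def by (rule eq_equiv_class_iff[OF equiv_mu_equiv mu_in mu_in])

lemma mu_edges:
  assumes lat: "latin_square X9 L" and fr: "framing L \<pi> lab \<alpha> \<beta>" and af: "affine_form c \<alpha> \<beta>"
  shows "mu L = {((v, block_index (\<pi> v m)), (w, block_index (\<pi> w n))) | v m w n. edge c v m w n}"
proof -
  have "\<exists>m. n = block_index (\<pi> v m)" if "n \<in> Idx" for n v
    using Idx_labels[OF framing_labels[OF fr] that] by blast
  moreover have "m \<in> Idx \<and> n \<in> Idx" if "((v, m), (w, n)) \<in> mu L" for v m w n
    using that mu_in[of L] by blast
  ultimately show ?thesis
    using mu_config[OF lat fr af] by (auto, metis)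
qed

lemma mu_class_config:
  assumes L: "division_sudoku L" "has_config L c" and L': "division_sudoku L'" "has_config L' c'"
  shows "mu_class L = mu_class L' \<longleftrightarrow> canon (mu_cube c) = canon (mu_cube c')"
proof -
  have lat: "latin_square X9 L" "latin_square X9 L'"
    using L(1) L'(1) by (simp_all add: division_sudoku_def)
  obtain \<pi> lab \<alpha> \<beta> where fr: "framing L \<pi> lab \<alpha> \<beta>" and af: "affine_form c \<alpha> \<beta>"
    using L(2) unfolding has_config_def by blast
  obtain \<pi>' lab' \<alpha>' \<beta>' where fr': "framing L' \<pi>' lab' \<alpha>' \<beta>'" and af': "affine_form c' \<alpha>' \<beta>'"
    using L'(2) unfolding has_config_def by blast
  let ?b = "\<lambda>v i. block_index (\<pi> v i)" and ?b' = "\<lambda>v i. block_index (\<pi>' v i)"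
  have b: "bij_betw (?b v) UNIV Idx" "bij_betw (?b' v) UNIV Idx" for v
    using bij_labels_block_index framing_labels fr fr' by blast+
  note M = mu_edges[OF lat(1) fr af] and M' = mu_config[OF lat(2) fr' af']
  have image: "mu L' = relabel \<rho> ` mu L \<longleftrightarrow> (\<forall>v m w n. edge c' v (P v m) w (P w n) = edge c v m w n)"
    if P: "\<And>v. bij (P v)" and r: "\<And>v i. \<rho> v (?b v i) = ?b' v (P v i)" for \<rho> P
  proof -
    have inj: "inj (\<pi>' v)" for v
      using framing_labels[OF fr'] by (auto simp: block_labels_def bij_is_inj)
    have img: "relabel \<rho> ` mu L = {((v, ?b' v (P v m)), (w, ?b' w (P w n))) | v m w n. edge c v m w n}"
      unfolding M relabel_def by (force simp: r image_iff)
    have "((v, ?b' v (P v m)), (w, ?b' w (P w n))) \<in> relabel \<rho> ` mu L \<longleftrightarrow> edge c v m w n" for v m w n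
      unfolding img using inj P by (auto dest!: injD bij_is_inj)
    moreover have "((v, ?b' v (P v m)), (w, ?b' w (P w n))) \<in> mu L' \<longleftrightarrow> edge c' v (P v m) w (P w n)" for v m w n
      by (rule M')
    moreover have "mu L' = relabel \<rho> ` mu L" if e: "\<And>v m w n. edge c' v (P v m) w (P w n) = edge c v m w n"
    proof -
      have "\<exists>n. m = P v n" for m v
        using P[of v] by (metis bij_is_surj surjD)
      then have ei: "edge c' v m' w n' \<longleftrightarrow> (\<exists>m n. m' = P v m \<and> n' = P w n \<and> edge c v m w n)" for v m' w n'
        using e by metis
      show ?thesis
        unfolding img mu_edges[OF lat(2) fr' af'] ei by blast
    qed
    ultimately show ?thesis
      by metis
  qed
  have "(mu L, mu L') \<in> mu_equiv \<longleftrightarrow> (\<exists>\<rho>. (\<forall>c. \<rho> c permutes Idx) \<and> mu L' = relabel \<rho> ` mu L)"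
    unfolding mu_equiv_relabel using mu_in[of L] by simp
  also have "\<dots> \<longleftrightarrow> (\<exists>P. (\<forall>v. bij (P v)) \<and> (\<forall>v m w n. edge c' v (P v m) w (P w n) = edge c v m w n))" (is "?l \<longleftrightarrow> ?r")
  proof
    assume ?l
    then obtain \<rho> where \<rho>: "\<forall>c. \<rho> c permutes Idx" "mu L' = relabel \<rho> ` mu L"
      by (elim exE conjE)
    define P where "P v = (SOME P. bij P \<and> (\<forall>i. \<rho> v (?b v i) = ?b' v (P i)))" for v
    have P: "bij (P v) \<and> (\<forall>i. \<rho> v (?b v i) = ?b' v (P v i))" for v
      unfolding P_def
      using someI_ex[OF index_bij_of_permutes[OF b(1)[of v] b(2)[of v] \<rho>(1)[rule_format, of v]]] .
    then have "\<forall>v m w n. edge c' v (P v m) w (P w n) = edge c v m w n"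
      using image[of P \<rho>] \<rho>(2) by blast
    with P show ?r
      by (intro exI[of _ P]) simp
  next
    assume ?r
    then obtain P where P: "\<forall>v. bij (P v)" "\<forall>v m w n. edge c' v (P v m) w (P w n) = edge c v m w n"
      by (elim exE conjE)
    define \<rho> where "\<rho> v = (SOME \<rho>. \<rho> permutes Idx \<and> (\<forall>i. \<rho> (?b v i) = ?b' v (P v i)))" for v
    have \<rho>: "\<rho> v permutes Idx \<and> (\<forall>i. \<rho> v (?b v i) = ?b' v (P v i))" for v
      unfolding \<rho>_def
      using someI_ex[OF permutes_of_index_bij[OF b(1)[of v] b(2)[of v] P(1)[rule_format, of v]]] .
    then have "mu L' = relabel \<rho> ` mu L"
      using image[of P \<rho>] P by blast
    with \<rho> show ?l
      by (intro exI[of _ \<rho>]) simp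
  qed
  also have "\<dots> \<longleftrightarrow> (\<exists>P Q R. bij P \<and> bij Q \<and> bij R \<and> (\<forall>i j k. edges c' (P i) (Q j) (R k) = edges c i j k))"
  proof
    assume ?r
    then obtain P where P: "\<forall>v. bij (P v)" "\<forall>v m w n. edge c' v (P v m) w (P w n) = edge c v m w n"
      by (elim exE conjE)
    then show "\<exists>P Q R. bij P \<and> bij Q \<and> bij R \<and> (\<forall>i j k. edges c' (P i) (Q j) (R k) = edges c i j k)"
      by (intro exI[of _ "P Row"] exI[of _ "P Column"] exI[of _ "P Symbol"]) (simp add: edges_def)
  next
    assume "\<exists>P Q R. bij P \<and> bij Q \<and> bij R \<and> (\<forall>i j k. edges c' (P i) (Q j) (R k) = edges c i j k)"
    then obtain P Q R where PQR: "bij P" "bij Q" "bij R" 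
      and e: "\<forall>i j k. edges c' (P i) (Q j) (R k) = edges c i j k"
      by (elim exE conjE)
    let ?P = "\<lambda>v. case v of Row \<Rightarrow> P | Column \<Rightarrow> Q | Symbol \<Rightarrow> R"
    have "bij (?P v)" for v
      by (cases v) (simp_all add: PQR)
    moreover have "edge c' v (?P v m) w (?P w n) = edge c v m w n" for v m w n
      using e[rule_format, of m n] e[rule_format, of n m] e[rule_format, of _ m n] e[rule_format, of _ n m]
        e[rule_format, of m _ n] e[rule_format, of n _ m]
      by (cases v; cases w) (simp_all add: edges_def, (cases c; cases c'; simp)+)
    ultimately show ?r
      by (intro exI[of _ ?P]) simp
  qed
  also have "\<dots> \<longleftrightarrow> canon (mu_cube c) = canon (mu_cube c')"
    unfolding canon_eq_iff mu_cube_def entry_cube ..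
  finally show ?thesis
    unfolding mu_class_eq_iff .
qed

section \<open>Symmetries of sign configurations\<close>

type_synonym symmetry = "f3 tri \<times> f3 tri \<times> f3 tri \<times> bool"

definition twist :: "bool \<Rightarrow> mat \<Rightarrow> mat" where
  "twist b m = (if b then m else map_tri (map_tri Not) m)"

fun act_s :: "symmetry \<Rightarrow> mat \<Rightarrow> mat" where
  "act_s (p, q, r, e) s = permute p (map_tri (permute q) (twist (even_perm r = e) s))"

fun act_t :: "symmetry \<Rightarrow> mat \<Rightarrow> mat" where
  "act_t (p, q, r, e) t = permute q (map_tri (permute r) (twist (even_perm p = e) t))"

fun act_u :: "symmetry \<Rightarrow> mat \<Rightarrow> mat" where
  "act_u (p, q, r, e) u = permute p (map_tri (permute r) (twist (even_perm q = e) u))"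

definition symmetries :: "symmetry list" where
  "symmetries = concat (map (\<lambda>p. concat (map (\<lambda>q. concat (map (\<lambda>r.
     [(p, q, r, True), (p, q, r, False)]) perms)) perms)) perms)"

lemma ent_twist: "ent (twist b m) i j = sg b * ent m i j"
proof (cases b)
  case False
  have "sg (\<not> x) = - sg x" for x
    by (cases x) simp_all
  then show ?thesis
    using False by (simp add: twist_def ent_def at_def)
qed (simp add: twist_def)

lemma ent_rearranged: "ent (permute p (map_tri (permute q) m)) i j = ent m (sel p i) (sel q j)"
  by (simp add: ent_def at_def)

text \<open>Renumbering the blocks and changing the sign of all labels gives another framing of the
  same square. An odd renumbering of the bands reverses the dependence of \<open>\<beta>\<close> on the band index and
  thus the sign of \<open>t\<close>; similarly for \<open>u\<close> and the stacks and for \<open>s\<close> and the piles.\<close>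

lemma has_config_act:
  assumes "has_config L (s, t, u)" and "g \<in> set symmetries"
  shows "has_config L (act_s g s, act_t g t, act_u g u)"
proof -
  obtain p q r e where g: "g = (p, q, r, e)" and pqr: "p \<in> set perms" "q \<in> set perms" "r \<in> set perms"
    using assms(2) unfolding symmetries_def by auto
  obtain \<pi> lab \<alpha> \<beta> where fr: "framing L \<pi> lab \<alpha> \<beta>" and af: "affine_form (s, t, u) \<alpha> \<beta>"
    using assms(1) unfolding has_config_def by blast
  define P where "P c = sel (case c of Row \<Rightarrow> p | Column \<Rightarrow> q | Symbol \<Rightarrow> r)" for c
  define \<alpha>' where "\<alpha>' i j k = sg e * \<alpha> (P Row i) (P Column j) (P Symbol k)" for i j k
  define \<beta>' where "\<beta>' i j k = sg e * \<beta> (P Row i) (P Column j) (P Symbol k)" for i j k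
  have bij: "bij (P c)" for c
    unfolding P_def using pqr by (cases c) (simp_all add: perms_iff)
  have "bij_betw (\<lambda>x. sg e * x) UNIV UNIV"
    by (rule bij_betw_byWitness[where f' = "\<lambda>x. sg e * x"]) auto
  then have "block_labels (\<pi> c \<circ> P c) (\<lambda>i x. lab c (P c i) (sg e * x))" for c
    using framing_labels[OF fr, of c] bij[of c] bij_comp[of "P c" "\<pi> c"] bij_betw_trans[of "\<lambda>x. sg e * x" UNIV UNIV]
    by (auto simp: block_labels_def comp_def)
  moreover have "L (lab Row (P Row i) (sg e * x), lab Column (P Column j) (sg e * y)) = lab Symbol (P Symbol k) (sg e * z)
      \<longleftrightarrow> y = x + \<alpha>' i j k \<and> z = y + \<beta>' i j k" for i x j y k z
  proof -
    have "L (lab Row (P Row i) (sg e * x), lab Column (P Column j) (sg e * y)) = lab Symbol (P Symbol k) (sg e * z)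
      \<longleftrightarrow> sg e * y = sg e * x + \<alpha> (P Row i) (P Column j) (P Symbol k) \<and>
          sg e * z = sg e * y + \<beta> (P Row i) (P Column j) (P Symbol k)"
      using fr unfolding framing_def by blast
    then show ?thesis
      unfolding \<alpha>'_def \<beta>'_def sg_mult_eq distrib_left sg_square .
  qed
  ultimately have fr': "framing L (\<lambda>c. \<pi> c \<circ> P c) (\<lambda>c i x. lab c (P c i) (sg e * x)) \<alpha>' \<beta>'"
    unfolding framing_def by blast
  have aff: "P Row i = sg (even_perm p) * i + P Row Zer" "P Column i = sg (even_perm q) * i + P Column Zer"
    "P Symbol i = sg (even_perm r) * i + P Symbol Zer" for i
    unfolding P_def coord.case
    by (rule perm_affine[OF pqr(1)] perm_affine[OF pqr(2)] perm_affine[OF pqr(3)])+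
  have PP: "sel p = P Row" "sel q = P Column" "sel r = P Symbol"
    by (simp_all add: P_def)
  have a: "\<alpha> i j k = ent s i j * k + \<alpha> i j Zer" for i j k
    using af unfolding affine_form.simps by blast
  have b: "\<beta> i j k = ent t j k * i + \<beta> Zer j k" for i j k
    using af unfolding affine_form.simps by blast
  have g': "- (\<alpha> i j k + \<beta> i j k) = ent u i k * j - (\<alpha> i Zer k + \<beta> i Zer k)" for i j k
    using af unfolding affine_form.simps by blast
  have shift: "f (x + y) - f y = m * x" if "\<And>z. f z = m * z + n" for f :: "f3 \<Rightarrow> f3" and m n x y
    unfolding that[of "x + y"] that[of y] by (simp add: algebra_simps)
  have "affine_form (act_s g s, act_t g t, act_u g u) \<alpha>' \<beta>'"
    unfolding affine_form.simps
  proof (intro allI conjI)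
    fix i j k
    show "\<alpha>' i j k = ent (act_s g s) i j * k + \<alpha>' i j Zer"
      unfolding \<alpha>'_def g act_s.simps ent_rearranged ent_twist sg_eq PP
        using shift[of "\<alpha> (P Row i) (P Column j)" "ent s (P Row i) (P Column j)", OF a, of "sg (even_perm r) * k" "P Symbol Zer"]
      by (subst aff(3)) (simp add: algebra_simps diff_eq_eq)
    show "\<beta>' i j k = ent (act_t g t) j k * i + \<beta>' Zer j k"
      unfolding \<beta>'_def g act_t.simps ent_rearranged ent_twist sg_eq PP
        using shift[of "\<lambda>i. \<beta> i (P Column j) (P Symbol k)" "ent t (P Column j) (P Symbol k)", OF b, of "sg (even_perm p) * i" "P Row Zer"]
      by (subst aff(1)) (simp add: algebra_simps diff_eq_eq)
    have "- (\<alpha> (P Row i) j (P Symbol k) + \<beta> (P Row i) j (P Symbol k)) = ent u (P Row i) (P Symbol k) * j +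
        - (\<alpha> (P Row i) Zer (P Symbol k) + \<beta> (P Row i) Zer (P Symbol k))" for j
      unfolding g'[of "P Row i" j] by simp
    from arg_cong[OF shift[of "\<lambda>j. - (\<alpha> (P Row i) j (P Symbol k) + \<beta> (P Row i) j (P Symbol k))", OF this,
        of "sg (even_perm q) * j" "P Column Zer"], of "\<lambda>x. sg e * x"]
    show "- (\<alpha>' i j k + \<beta>' i j k) = ent (act_u g u) i k * j - (\<alpha>' i Zer k + \<beta>' i Zer k)"
      unfolding \<alpha>'_def \<beta>'_def g act_u.simps ent_rearranged ent_twist sg_eq PP
      unfolding aff(2)[of j] by (simp add: algebra_simps diff_eq_eq eq_diff_eq)
  qed
  with fr' show ?thesis
    unfolding has_config_def by blast
qed

section \<open>Linear relations between the sign matrices\<close>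

definition moment :: "(f3 \<Rightarrow> f3) \<Rightarrow> (f3 \<Rightarrow> f3) \<Rightarrow> mat \<Rightarrow> f3" where
  "moment v w m = (\<Sum>i\<in>UNIV. \<Sum>j\<in>UNIV. v i * (w j * ent m i j))"

text \<open>Summing \<open>\<alpha> + \<beta> + \<gamma> = 0\<close> against a product weight.\<close>

lemma moment_identity:
  fixes \<alpha> \<beta> \<gamma> :: "f3 \<Rightarrow> f3 \<Rightarrow> f3 \<Rightarrow> f3"
  assumes bal: "\<forall>i j k. \<alpha> i j k + \<beta> i j k + \<gamma> i j k = Zer"
  shows "(\<Sum>i\<in>UNIV. \<Sum>j\<in>UNIV. a i * (b j * (\<Sum>k\<in>UNIV. c k * \<alpha> i j k))) +
    (\<Sum>j\<in>UNIV. \<Sum>k\<in>UNIV. b j * (c k * (\<Sum>i\<in>UNIV. a i * \<beta> i j k))) +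
    (\<Sum>i\<in>UNIV. \<Sum>k\<in>UNIV. a i * (c k * (\<Sum>j\<in>UNIV. b j * \<gamma> i j k))) = Zer"
proof -
  have \<gamma>: "\<gamma> i j k = - (\<alpha> i j k + \<beta> i j k)" for i j k
    using bal by (metis add_eq_0_iff zero_f3)
  show ?thesis
    unfolding sum_f3 \<gamma> by (simp add: algebra_simps)
qed

text \<open>With weights \<open>1\<close> and \<open>x\<close>, each of the three sums in the preceding identity is either
  \<open>0\<close> or minus a moment of a sign matrix, because the sum of an affine function over \<open>\<int>/3\<close> vanishes and its
  first moment is minus its slope. These relations are necessary for validity and much cheaper to test.\<close>

lemma moments_zero:
  assumes "affine_form (s, t, u) \<alpha> \<beta>"
  shows "moment (\<lambda>_. One) (\<lambda>_. One) s = Zer" "moment (\<lambda>_. One) (\<lambda>_. One) t = Zer" "moment (\<lambda>_. One) (\<lambda>_. One) u = Zer"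
    "moment (\<lambda>x. x) (\<lambda>_. One) s + moment (\<lambda>_. One) (\<lambda>x. x) t = Zer"
    "moment (\<lambda>x. x) (\<lambda>_. One) t + moment (\<lambda>x. x) (\<lambda>_. One) u = Zer"
    "moment (\<lambda>_. One) (\<lambda>x. x) s + moment (\<lambda>_. One) (\<lambda>x. x) u = Zer"
    "moment (\<lambda>x. x) (\<lambda>x. x) s + (moment (\<lambda>x. x) (\<lambda>x. x) t + moment (\<lambda>x. x) (\<lambda>x. x) u) = Zer"
proof -
  define \<gamma> where "\<gamma> i j k = - (\<alpha> i j k + \<beta> i j k)" for i j k
  have a: "\<alpha> i j k = ent s i j * k + \<alpha> i j Zer" for i j k
    using assms unfolding affine_form.simps by blast
  have b: "\<beta> i j k = ent t j k * i + \<beta> Zer j k" for i j k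
    using assms unfolding affine_form.simps by blast
  have g: "\<gamma> i j k = ent u i k * j + \<gamma> i Zer k" for i j k
    using assms unfolding affine_form.simps \<gamma>_def by (metis diff_conv_add_uminus)
  have sums: "(\<Sum>x\<in>UNIV. One * f x) = Zer" "(\<Sum>x\<in>UNIV. x * f x) = - m" if "\<And>x. f x = m * x + n" for f m n
  proof -
    have f: "f = (\<lambda>x. m * x + n)"
      using that by blast
    show "(\<Sum>x\<in>UNIV. One * f x) = Zer" "(\<Sum>x\<in>UNIV. x * f x) = - m"
      unfolding f sum_f3 by (cases m; cases n; simp)+
  qed
  note A = sums[of "\<lambda>k. \<alpha> i j k" "ent s i j" for i j, OF a]
  note B = sums[of "\<lambda>i. \<beta> i j k" "ent t j k" for j k, OF b]
  note G = sums[of "\<lambda>j. \<gamma> i j k" "ent u i k" for i k, OF g]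
  have "\<forall>i j k. \<alpha> i j k + \<beta> i j k + \<gamma> i j k = Zer"
    by (simp add: \<gamma>_def)
  note M = moment_identity[OF this]
  have neg: "(\<Sum>i\<in>UNIV. \<Sum>j\<in>UNIV. v i * (w j * - ent m i j)) = - moment v w m" for v w m
    by (simp add: moment_def sum_negf)
  have flip: "- x = Zer \<longleftrightarrow> x = Zer" "- x = y \<longleftrightarrow> x + y = Zer" "- x + - y + - z = Zer \<longleftrightarrow> x + (y + z) = Zer" for x y z :: f3
    by (cases x; cases y; cases z; simp)+
  show "moment (\<lambda>_. One) (\<lambda>_. One) s = Zer"
    using M[of "\<lambda>_. One" "\<lambda>_. One" "\<lambda>x. x"] unfolding A B G neg by (simp add: flip)
  show "moment (\<lambda>_. One) (\<lambda>_. One) t = Zer"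
    using M[of "\<lambda>x. x" "\<lambda>_. One" "\<lambda>_. One"] unfolding A B G neg by (simp add: flip)
  show "moment (\<lambda>_. One) (\<lambda>_. One) u = Zer"
    using M[of "\<lambda>_. One" "\<lambda>x. x" "\<lambda>_. One"] unfolding A B G neg by (simp add: flip)
  show "moment (\<lambda>x. x) (\<lambda>_. One) s + moment (\<lambda>_. One) (\<lambda>x. x) t = Zer"
    using M[of "\<lambda>x. x" "\<lambda>_. One" "\<lambda>x. x"] unfolding A B G neg by (simp add: flip)
  show "moment (\<lambda>x. x) (\<lambda>_. One) t + moment (\<lambda>x. x) (\<lambda>_. One) u = Zer"
    using M[of "\<lambda>x. x" "\<lambda>x. x" "\<lambda>_. One"] unfolding A B G neg by (simp add: flip)
  show "moment (\<lambda>_. One) (\<lambda>x. x) s + moment (\<lambda>_. One) (\<lambda>x. x) u = Zer"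
    using M[of "\<lambda>_. One" "\<lambda>x. x" "\<lambda>x. x"] unfolding A B G neg by (simp add: flip)
  show "moment (\<lambda>x. x) (\<lambda>x. x) s + (moment (\<lambda>x. x) (\<lambda>x. x) t + moment (\<lambda>x. x) (\<lambda>x. x) u) = Zer"
    using M[of "\<lambda>x. x" "\<lambda>x. x" "\<lambda>x. x"] unfolding A B G neg flip(3) .
qed

section \<open>Orderly enumeration of configurations\<close>

definition tris :: "'a list \<Rightarrow> 'a tri list" where
  "tris xs = concat (map (\<lambda>a. concat (map (\<lambda>b. map (Tri a b) xs) xs)) xs)"

definition mats :: "mat list" where
  "mats = tris (tris [False, True])"

lemma set_tris: "set xs = UNIV \<Longrightarrow> set (tris xs) = UNIV"
  by (auto simp: tris_def) (metis rangeI tri.exhaust)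

lemma set_mats: "set mats = UNIV"
  unfolding mats_def by (intro set_tris) auto

type_synonym tagged = "mat \<times> f3 \<times> f3 \<times> f3"

text \<open>The moments are stored with each matrix, so that they are computed only once.\<close>

definition tag :: "mat \<Rightarrow> tagged" where
  "tag m = (m, moment (\<lambda>x. x) (\<lambda>_. One) m, moment (\<lambda>_. One) (\<lambda>x. x) m, moment (\<lambda>x. x) (\<lambda>x. x) m)"

text \<open>The relation that involves a single matrix; it is tested before the search starts.\<close>

definition level :: "mat \<Rightarrow> bool" where
  "level m \<longleftrightarrow> moment (\<lambda>_. One) (\<lambda>_. One) m = Zer"

definition candidates :: "tagged list" where
  "candidates = map tag (filter level mats)"

fun minimal :: "('g \<Rightarrow> 'a::linorder \<Rightarrow> 'a) \<Rightarrow> 'g list \<Rightarrow> 'a \<Rightarrow> bool" where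
  "minimal f [] x \<longleftrightarrow> True"
| "minimal f (g # gs) x \<longleftrightarrow> x \<le> f g x \<and> minimal f gs x"

fun stabilizer :: "('g \<Rightarrow> 'a \<Rightarrow> 'a) \<Rightarrow> 'g list \<Rightarrow> 'a \<Rightarrow> 'g list" where
  "stabilizer f [] x = []"
| "stabilizer f (g # gs) x = (if f g x = x then g # stabilizer f gs x else stabilizer f gs x)"

text \<open>The search extends \<open>s\<close> by \<open>t\<close> and then by \<open>u\<close>. In the lexicographic order a minimal
  configuration has minimal \<open>s\<close>; its \<open>t\<close> is minimal under the symmetries that fix \<open>s\<close>, and its
  \<open>u\<close> under those that fix both.\<close>

fun keep_s :: "symmetry list \<Rightarrow> tagged \<Rightarrow> bool" where
  "keep_s gs (s, _) \<longleftrightarrow> minimal act_s gs s"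

fun keep_t :: "symmetry list \<Rightarrow> tagged \<Rightarrow> tagged \<Rightarrow> bool" where
  "keep_t gs (s, sa, sb, sc) (t, ta, tb, tc) \<longleftrightarrow> sa + tb = Zer \<and> minimal act_t gs t"

fun keep_u :: "symmetry list \<Rightarrow> tagged \<Rightarrow> tagged \<Rightarrow> tagged \<Rightarrow> bool" where
  "keep_u gs (s, sa, sb, sc) (t, ta, tb, tc) (u, ua, ub, uc) \<longleftrightarrow>
     ta + ua = Zer \<and> sb + ub = Zer \<and> sc + (tc + uc) = Zer \<and> minimal act_u gs u \<and> valid (s, t, u)"

fun untag :: "tagged \<Rightarrow> tagged \<Rightarrow> tagged \<Rightarrow> config" where
  "untag (s, _) (t, _) (u, _) = (s, t, u)"

fun extend_t :: "tagged list \<Rightarrow> symmetry list \<Rightarrow> tagged \<Rightarrow> tagged \<Rightarrow> config list" where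
  "extend_t ms gs s (t, ta) = map (untag s (t, ta)) (filter (keep_u (stabilizer act_t gs t) s (t, ta)) ms)"

fun extend_s :: "tagged list \<Rightarrow> symmetry list \<Rightarrow> tagged \<Rightarrow> config list" where
  "extend_s ms gs s = concat (map (extend_t ms gs s) (filter (keep_t gs s) ms))"

fun extend :: "tagged list \<Rightarrow> symmetry list \<Rightarrow> tagged \<Rightarrow> config list" where
  "extend ms gs (s, sa) = extend_s ms (stabilizer act_s gs s) (s, sa)"

text \<open>The lists of matrices and symmetries are parameters, so that rewriting evaluates them once instead
  of at every use.\<close>

definition search :: "tagged list \<Rightarrow> symmetry list \<Rightarrow> config list" where
  "search ms gs = concat (map (extend ms gs) (filter (keep_s gs) ms))"

definition reps :: "config list" where
  "reps = search candidates symmetries"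

lemma minimal_iff: "minimal f gs x \<longleftrightarrow> (\<forall>g\<in>set gs. x \<le> f g x)"
  by (induction gs) auto

lemma set_stabilizer: "set (stabilizer f gs x) = {g \<in> set gs. f g x = x}"
  by (induction gs) auto

lemma reps_valid: "c \<in> set reps \<Longrightarrow> valid c"
proof -
  have u: "valid (untag s t u)" if "keep_u gs s t u" for gs s t u
    using that by (cases s; cases t; cases u) auto
  have t: "valid c" if "c \<in> set (extend_t ms gs s t)" for ms gs s t c
    using that by (cases t) (auto intro: u simp del: keep_u.simps untag.simps)
  have s: "valid c" if "c \<in> set (extend ms gs s)" for ms gs s c
    using that by (cases s) (auto intro: t simp del: extend_t.simps)
  show "c \<in> set reps \<Longrightarrow> valid c"
    unfolding reps_def search_def by (auto intro: s)
qed

lemma minimal_config_in_reps: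
  assumes af: "affine_form (s, t, u) \<alpha> \<beta>"
    and least: "\<And>g. g \<in> set symmetries \<Longrightarrow> (s, t, u) \<le> (act_s g s, act_t g t, act_u g u)"
  shows "(s, t, u) \<in> set reps"
proof -
  note z = moments_zero[OF af]
  have mem: "tag m \<in> set candidates" if "moment (\<lambda>_. One) (\<lambda>_. One) m = Zer" for m
    using that by (simp add: candidates_def set_mats level_def)
  have lex: "s \<le> act_s g s" "act_s g s = s \<Longrightarrow> t \<le> act_t g t" "act_s g s = s \<Longrightarrow> act_t g t = t \<Longrightarrow> u \<le> act_u g u"
    if "g \<in> set symmetries" for g
    using least[OF that] by (auto simp: less_eq_prod_def)
  define gs where "gs = stabilizer act_s symmetries s"
  have s: "keep_s symmetries (tag s)"
    unfolding tag_def keep_s.simps minimal_iff using lex(1) by blast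
  have t: "keep_t gs (tag s) (tag t)"
    unfolding tag_def keep_t.simps minimal_iff gs_def set_stabilizer using lex(2) z(4) by blast
  have u: "keep_u (stabilizer act_t gs t) (tag s) (tag t) (tag u)"
    unfolding tag_def keep_u.simps minimal_iff gs_def set_stabilizer
    using lex(3) z(5-7) affine_form_valid[OF af] by blast
  have "(s, t, u) = untag (tag s) (tag t) (tag u)"
    by (simp add: tag_def)
  moreover have "tag u \<in> set (filter (keep_u (stabilizer act_t gs t) (tag s) (tag t)) candidates)"
    using u mem[OF z(3)] by simp
  ultimately have "(s, t, u) \<in> set (map (untag (tag s) (tag t)) (filter (keep_u (stabilizer act_t gs t) (tag s) (tag t)) candidates))"
    by (metis imageI set_map)
  then have "(s, t, u) \<in> set (extend_t candidates gs (tag s) (tag t))"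
    by (simp add: tag_def)
  then have "(s, t, u) \<in> set (extend_s candidates gs (tag s))"
    unfolding extend_s.simps set_concat set_map set_filter using t mem[OF z(2)] by blast
  moreover have "extend candidates symmetries (tag s) = extend_s candidates gs (tag s)"
    by (simp add: tag_def gs_def del: extend_s.simps)
  ultimately have "(s, t, u) \<in> set (extend candidates symmetries (tag s))"
    by (simp only:)
  then show ?thesis
    unfolding reps_def search_def set_concat set_map set_filter using s mem[OF z(1)] by blast
qed

text \<open>The least configuration of a square is minimal under all symmetries, since these lead to
  configurations of the same square.\<close>

lemma division_sudoku_rep:
  assumes "division_sudoku L"
  shows "\<exists>c\<in>set reps. has_config L c"
proof -
  let ?C = "{c. has_config L c}"
  have "?C \<noteq> {}"
    using division_sudoku_config[OF assms] by blast
  then have "Min ?C \<in> ?C" and le: "\<And>c. has_config L c \<Longrightarrow> Min ?C \<le> c"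
    using Min_in[of ?C] Min_le[of ?C] by auto
  moreover obtain s t u where c: "Min ?C = (s, t, u)"
    by (cases "Min ?C")
  ultimately have h: "has_config L (s, t, u)"
    by simp
  then obtain \<alpha> \<beta> where "affine_form (s, t, u) \<alpha> \<beta>"
    unfolding has_config_def by blast
  moreover have "(s, t, u) \<le> (act_s g s, act_t g t, act_u g u)" if "g \<in> set symmetries" for g
    using le[OF has_config_act[OF h that]] by (simp only: c)
  ultimately have "(s, t, u) \<in> set reps"
    by (rule minimal_config_in_reps)
  with h show ?thesis
    by blast
qed

section \<open>Computing canonical cubes\<close>

text \<open>Going through the 216 rearrangements one by one, instead of listing them, keeps the terms
  small during rewriting; the permutations of the first index are dealt with by sorting three planes.\<close>

fun least_over :: "('a \<Rightarrow> 'b::linorder) \<Rightarrow> 'a list \<Rightarrow> 'b \<Rightarrow> 'b" where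
  "least_over f [] b = b"
| "least_over f (x # xs) b = least_over f xs (min b (f x))"

lemma least_over_eq_Min: "least_over f xs b = Min (insert b (f ` set xs))"
proof (induction xs arbitrary: b)
  case (Cons x xs)
  have "Min (insert (min b (f x)) (f ` set xs)) = Min (insert b (insert (f x) (f ` set xs)))"
    by (cases "xs = []") (simp_all add: min.assoc)
  then show ?case
    using Cons by simp
qed simp

fun least_image :: "('a \<Rightarrow> 'b::linorder) \<Rightarrow> 'a list \<Rightarrow> 'b" where
  "least_image f (x # xs) = least_over f xs (f x)"

lemma least_image_eq_Min: "xs \<noteq> [] \<Longrightarrow> least_image f xs = Min (f ` set xs)"
  by (cases xs) (simp_all add: least_over_eq_Min)

fun insert3 :: "'a::linorder \<Rightarrow> 'a \<Rightarrow> 'a \<Rightarrow> 'a tri" where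
  "insert3 a b c = (if b \<le> c then Tri a b c else if a \<le> c then Tri a c b else Tri c a b)"

fun sort3 :: "'a::linorder tri \<Rightarrow> 'a tri" where
  "sort3 (Tri a b c) = (if a \<le> b then insert3 a b c else insert3 b a c)"

lemma sort3_eq_Min: "sort3 v = Min ((\<lambda>p. permute p v) ` set perms)"
proof -
  obtain a b c where v: "v = Tri a b c"
    by (cases v)
  have "(\<lambda>p. permute p v) ` set perms = {Tri a b c, Tri b c a, Tri c a b, Tri a c b, Tri b a c, Tri c b a}"
    by (simp add: v perms_def permute_def)
  moreover have "sort3 v \<in> \<dots>" and "\<And>w. w \<in> {Tri a b c, Tri b c a, Tri c a b, Tri a c b, Tri b a c, Tri c b a} \<Longrightarrow> sort3 v \<le> w"
    by (auto simp: v)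
  ultimately show ?thesis
    by (simp only:) (rule Min_eqI[symmetric]; simp)
qed

definition least_row_order :: "'a::linorder cube \<Rightarrow> 'a cube" where
  "least_row_order v = least_image (\<lambda>q. sort3 (map_tri (permute q) v)) perms"

lemma Min_UN:
  assumes "finite A" "A \<noteq> {}" "\<And>a. a \<in> A \<Longrightarrow> finite (B a) \<and> B a \<noteq> {}"
  shows "Min ((\<lambda>a. Min (B a)) ` A) = Min (\<Union>a\<in>A. B a)"
proof (rule Min_eqI)
  show "finite ((\<lambda>a. Min (B a)) ` A)"
    using assms(1) by simp
  have fin: "finite (\<Union>a\<in>A. B a)" and ne: "(\<Union>a\<in>A. B a) \<noteq> {}"
    using assms by auto
  show "Min (\<Union>a\<in>A. B a) \<le> y" if "y \<in> (\<lambda>a. Min (B a)) ` A" for y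
    using that assms(3) fin by (auto intro!: Min_le intro: Min_in)
  obtain a where a: "a \<in> A" "Min (\<Union>a\<in>A. B a) \<in> B a"
    using Min_in[OF fin ne] by blast
  have "Min (B a) = Min (\<Union>a\<in>A. B a)"
    using a assms(3)[OF a(1)] fin by (intro Min_eqI) (auto intro!: Min_le)
  then show "Min (\<Union>a\<in>A. B a) \<in> (\<lambda>a. Min (B a)) ` A"
    using a(1) by force
qed

lemma perms_not_Nil: "perms \<noteq> []"
  by (simp add: perms_def)

lemma canon_code: "canon v = least_image (\<lambda>r. least_row_order (map_tri (map_tri (permute r)) v)) perms"
proof -
  have row: "least_row_order v = Min (\<Union>q\<in>set perms. (\<lambda>p. permute p (map_tri (permute q) v)) ` set perms)" for v :: "'a cube"
    unfolding least_row_order_def least_image_eq_Min[OF perms_not_Nil] sort3_eq_Min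
    using perms_not_Nil by (intro Min_UN) simp_all
  have "least_image (\<lambda>r. least_row_order (map_tri (map_tri (permute r)) v)) perms =
     Min (\<Union>r\<in>set perms. \<Union>q\<in>set perms. (\<lambda>p. permute p (map_tri (permute q) (map_tri (map_tri (permute r)) v))) ` set perms)"
    unfolding least_image_eq_Min[OF perms_not_Nil] row
    using perms_not_Nil by (intro Min_UN) simp_all
  also have "(\<Union>r\<in>set perms. \<Union>q\<in>set perms. (\<lambda>p. permute p (map_tri (permute q) (map_tri (map_tri (permute r)) v))) ` set perms)
     = rearrangements v" (is "?U = _")
  proof -
    have "x \<in> ?U \<longleftrightarrow> (\<exists>p\<in>set perms. \<exists>q\<in>set perms. \<exists>r\<in>set perms. x = rearrange (p, q, r) v)" for x
      unfolding rearrange_def prod.case by blast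
    then show ?thesis
      unfolding rearrangements_perms by (simp add: set_eq_iff image_iff Bex_def)
  qed
  finally show ?thesis
    by (simp only: canon_def)
qed

section \<open>Evaluation by rewriting\<close>

text \<open>Copies of the constructors, for the right-hand sides of evaluation rules. With the
  congruence rules below, the simplifier never descends into a term built from the genuine
  constructors. A copy is replaced by the constructor only after its arguments have been normalised,
  so that data is evaluated exactly once and not traversed again.\<close>

definition mk_tri :: "'a \<Rightarrow> 'a \<Rightarrow> 'a \<Rightarrow> 'a tri" where "mk_tri = Tri"
definition mk_cons :: "'a \<Rightarrow> 'a list \<Rightarrow> 'a list" where "mk_cons = Cons"
definition mk_pair :: "'a \<Rightarrow> 'b \<Rightarrow> 'a \<times> 'b" where "mk_pair = Pair"

lemma build: "mk_tri a b c = Tri a b c" "mk_cons x xs = x # xs" "mk_pair x y = (x, y)"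
  by (simp_all add: mk_tri_def mk_cons_def mk_pair_def)

text \<open>As congruence rules these equations without premises stop the simplifier at evaluated
  data. The arguments of \<^const>\<open>tab\<close> are functions, which must be applied before they are evaluated.\<close>

lemma opaque_values: "Tri a b c = Tri a b c" "x # xs = x # xs" "(x, y) = (x, y)" "tab f = tab f"
  by (rule refl)+

text \<open>As congruence rules these make conjunction and disjunction short-circuit.\<close>

lemma lazy: "P = P' \<Longrightarrow> (P \<and> Q) = (P' \<and> Q)" "P = P' \<Longrightarrow> (P \<or> Q) = (P' \<or> Q)"
  by simp_all

lemma eval_bool:
  "(True \<and> P) = P" "(False \<and> P) = False" "(True \<or> P) = True" "(False \<or> P) = P"
  "(\<not> True) = False" "(\<not> False) = True" "(True = P) = P" "(False = P) = (\<not> P)"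
  "(False \<le> P) = True" "(True \<le> P) = P" "(False < P) = P" "(True < P) = False"
  "(if True then x else y) = x" "(if False then x else y) = y"
  by auto

text \<open>Least cubes often begin with many entries \<^const>\<open>False\<close>, so equality is decided from the
  last component.\<close>

lemma eval_eq:
  "(x = x) = True"
  "(Tri a b c = Tri a' b' c') = (c = c' \<and> b = b' \<and> a = a')"
  "((a, d) = (a', d')) = (a = a' \<and> d = d')"
  by auto

lemma eval_pair_less:
  "((a :: 'a::linorder, b :: 'b::linorder) \<le> (x, y)) = (if a = x then b \<le> y else a < x)"
  "((a, b) < (x, y)) = (if a = x then b < y else a < x)"
  by auto

lemma eval_list:
  "filter P [] = []" "filter P (x # xs) = (if P x then mk_cons x (filter P xs) else filter P xs)"
  "map f [] = []" "map f (x # xs) = mk_cons (f x) (map f xs)"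
  "concat [] = []" "concat (xs # xss) = xs @ concat xss"
  "[] @ ys = ys" "(x # xs) @ ys = mk_cons x (xs @ ys)"
  "list_ex P [] = False" "list_ex P (x # xs) = (P x \<or> list_ex P xs)"
  by (simp_all add: build)

lemma eval_f3:
  "(Zer = One) = False" "(Zer = Two) = False" "(One = Zer) = False"
  "(One = Two) = False" "(Two = Zer) = False" "(Two = One) = False"
  "a - Zer = a" "Zer - One = Two" "Zer - Two = One" "One - One = Zer"
  "One - Two = Two" "Two - One = One" "Two - Two = Zer"
  by simp_all

lemma eval_tri:
  "map_tri f (Tri a b c) = mk_tri (f a) (f b) (f c)"
  "tab g = mk_tri (g Zer) (g One) (g Two)"
  by (simp_all add: build tab_def)

text \<open>The following constants name functions that would otherwise be abstractions: the
  simplifier would rewrite the body of an abstraction before it is applied.\<close>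

definition plane :: "(f3 \<Rightarrow> f3 \<Rightarrow> f3 \<Rightarrow> 'a) \<Rightarrow> f3 \<Rightarrow> 'a tri tri" where
  "plane f i = tab (\<lambda>j. tab (f i j))"
definition row :: "(f3 \<Rightarrow> f3 \<Rightarrow> f3 \<Rightarrow> 'a) \<Rightarrow> f3 \<Rightarrow> f3 \<Rightarrow> 'a tri" where
  "row f i j = tab (f i j)"

lemma eval_cube: "cube f = tab (plane f)" "plane f i = tab (row f i)" "row f i j = tab (f i j)"
  by (simp_all add: cube_def plane_def[abs_def] row_def[abs_def])

lemma eval_sort:
  "min x y = (if x \<le> y then x else y)"
  "insert3 a b c = (if b \<le> c then mk_tri a b c else if a \<le> c then mk_tri a c b else mk_tri c a b)"
  by (simp_all add: min_def build)

definition row_variant where "row_variant v q = sort3 (map_tri (permute q) v)"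
definition column_variant where "column_variant r = map_tri (permute r)"
definition cube_variant where "cube_variant v r = least_row_order (map_tri (column_variant r) v)"

lemma eval_canon:
  "least_row_order v = least_image (row_variant v) perms"
  "canon v = least_image (cube_variant v) perms"
  by (simp_all add: least_row_order_def row_variant_def[abs_def] canon_code cube_variant_def[abs_def] column_variant_def[abs_def])

fun line_sum where "line_sum (Tri a b c) = sg a + (sg b + sg c)"
fun line_moment where "line_moment (Tri a b c) = sg b - sg c"

lemma eval_moment:
  "level (Tri a b c) = (line_sum a + (line_sum b + line_sum c) = Zer)"
  "tag m = mk_pair m (mk_pair (moment (\<lambda>x. x) (\<lambda>_. One) m) (mk_pair (moment (\<lambda>_. One) (\<lambda>x. x) m) (moment (\<lambda>x. x) (\<lambda>x. x) m)))"
  "moment (\<lambda>x. x) (\<lambda>_. One) (Tri a b c) = line_sum b - line_sum c"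
  "moment (\<lambda>_. One) (\<lambda>x. x) (Tri a b c) = line_moment a + (line_moment b + line_moment c)"
  "moment (\<lambda>x. x) (\<lambda>x. x) (Tri a b c) = line_moment b - line_moment c"
  by (cases a; cases b; cases c; simp add: level_def tag_def moment_def sum_f3 ent_def at_def build algebra_simps)+

lemma eval_twist: "twist True m = m" "twist False m = map_tri (map_tri Not) m"
  by (simp_all add: twist_def)

definition symmetries2 where "symmetries2 p q r = mk_cons (mk_pair p (mk_pair q (mk_pair r True))) (mk_cons (mk_pair p (mk_pair q (mk_pair r False))) [])"
definition symmetries1 where "symmetries1 p q = concat (map (symmetries2 p q) perms)"
definition symmetries0 where "symmetries0 p = concat (map (symmetries1 p) perms)"

lemma eval_symmetries: "symmetries = concat (map symmetries0 perms)"
  by (simp add: symmetries_def symmetries0_def[abs_def] symmetries1_def[abs_def] symmetries2_def[abs_def] build)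

lemma eval_stabilizer:
  "stabilizer f [] x = []"
  "stabilizer f (g # gs) x = (if f g x = x then mk_cons g (stabilizer f gs x) else stabilizer f gs x)"
  by (simp_all add: build)

lemma balanced_Zer: "balanced c Zer j k" "balanced c i Zer k" "balanced c i j Zer"
  by (cases c; simp)+

lemma eval_valid:
  "valid c = (balanced c One One One \<and> balanced c One One Two \<and> balanced c One Two One \<and> balanced c One Two Two \<and>
     balanced c Two One One \<and> balanced c Two One Two \<and> balanced c Two Two One \<and> balanced c Two Two Two)"
  unfolding valid_def all_f3 by (auto simp: balanced_Zer simp del: balanced.simps)

lemma eval_untag: "untag (s, x) (t, y) (u, z) = mk_pair s (mk_pair t u)"
  by (simp add: build)

lemma eval_tris: "tris xs = concat (map (\<lambda>a. concat (map (\<lambda>b. map (mk_tri a b) xs) xs)) xs)"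
  by (simp add: tris_def mk_tri_def)

lemma eval_edges: "edges c i j k = mk_tri (mk_pair (edge c Row i Column j) (edge c Column j Row i))
     (mk_pair (edge c Column j Symbol k) (edge c Symbol k Column j)) (mk_pair (edge c Row i Symbol k) (edge c Symbol k Row i))"
  by (simp add: edges_def build)

section \<open>Counting\<close>

definition tally :: "config list \<Rightarrow> nat \<times> nat \<times> nat" where
  "tally cs = (let xs = map (\<lambda>c. (canon (iota_cube c), canon (mu_cube c))) cs in
     (card (set (map fst xs)), card (set (map snd xs)), card (set xs)))"

definition smaller :: "'a::linorder \<Rightarrow> 'a \<Rightarrow> bool" where
  "smaller x y \<longleftrightarrow> y < x"

definition larger :: "'a::linorder \<Rightarrow> 'a \<Rightarrow> bool" where
  "larger x y \<longleftrightarrow> x < y"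

text \<open>Counting distinct elements in the manner of quicksort, because comparing each element with
  all later ones is much slower.\<close>

function distinct_count :: "'a::linorder list \<Rightarrow> nat \<Rightarrow> nat" where
  "distinct_count [] n = n"
| "distinct_count (x # xs) n =
     distinct_count (filter (smaller x) xs) (Suc (distinct_count (filter (larger x) xs) n))"
  by pat_completeness auto
termination
  by (relation "measure (\<lambda>(xs, n). length xs)") (simp_all add: le_imp_less_Suc)

lemma distinct_count: "distinct_count xs n = card (set xs) + n"
proof (induction xs n rule: distinct_count.induct)
  case (2 x xs n)
  have "set (x # xs) = insert x ({y \<in> set xs. y < x} \<union> {y \<in> set xs. x < y})"
    by auto
  moreover have "card ({y \<in> set xs. y < x} \<union> {y \<in> set xs. x < y}) =
      card {y \<in> set xs. y < x} + card {y \<in> set xs. x < y}"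
    by (intro card_Un_disjoint) auto
  ultimately have "card (set (x # xs)) = Suc (card {y \<in> set xs. y < x} + card {y \<in> set xs. x < y})"
    by (simp only:) simp
  then show ?case
    using 2 by (simp add: smaller_def larger_def)
qed simp

definition signature where "signature c = mk_pair (canon (iota_cube c)) (canon (mu_cube c))"
definition tally_of where "tally_of xs = mk_pair (distinct_count (map fst xs) 0) (mk_pair (distinct_count (map snd xs) 0) (distinct_count xs 0))"

lemma eval_tally: "tally cs = tally_of (map signature cs)"
  by (simp add: tally_def tally_of_def signature_def[abs_def] build Let_def distinct_count image_comp comp_def)

lemmas eval_rules = build eval_bool eval_eq eval_pair_less eval_list eval_f3 eval_tri eval_cube eval_sort eval_canon eval_moment
  eval_twist eval_symmetries eval_stabilizer eval_valid eval_untag eval_tris eval_edges eval_tally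
  signature_def tally_of_def distinct_count.simps smaller_def larger_def symmetries0_def symmetries1_def symmetries2_def row_variant_def column_variant_def cube_variant_def
  line_sum.simps line_moment.simps least_over.simps least_image.simps sort3.simps less_tri.simps less_eq_tri.simps plus_f3.simps uminus_f3.simps times_f3.simps
  sel.simps sg.simps at_def ent_def permute_def even_perm_def perms_def mats_def candidates_def reps_def search_def extend.simps extend_s.simps extend_t.simps
  keep_s.simps keep_t.simps keep_u.simps minimal.simps act_s.simps act_t.simps act_u.simps balanced.simps
  iota_cube_def mu_cube_def has_intercalate_def intercalate_at.simps aligned.simps directions_def edge.simps(1-6) constant_row_def constant_column_def row_twins_def column_twins_def
  fst_conv snd_conv

text \<open>A single normalisation runs the search, computes the canonical cubes and counts them in
  unary; the last step compares the results with the numerals.\<close>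

lemma tally_reps: "tally reps = (148, 139, 183)"
  by (simp only: eval_rules cong: opaque_values if_weak_cong lazy) simp

lemma card_image_cong_eq:
  assumes "\<And>x y. x \<in> A \<Longrightarrow> y \<in> A \<Longrightarrow> f x = f y \<longleftrightarrow> g x = g y"
  shows "card (f ` A) = card (g ` A)"
proof -
  have eq: "g (inv_into A f (f x)) = g x" if "x \<in> A" for x
    using assms[of "inv_into A f (f x)" x] that by (simp add: f_inv_into_f inv_into_into)
  have "inj_on (\<lambda>z. g (inv_into A f z)) (f ` A)"
    using assms eq by (auto simp: inj_on_def)
  moreover have "(\<lambda>z. g (inv_into A f z)) ` f ` A = g ` A"
    using eq by (auto simp: image_image)
  ultimately show ?thesis
    by (metis card_image)
qed

text \<open>An invariant of squares and a function of configurations with the same equivalence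
  relation take the same number of values, because every square has a configuration in the list and
  every configuration in the list belongs to a square.\<close>

lemma card_classes:
  assumes FG: "\<And>L L' c c'. division_sudoku L \<Longrightarrow> has_config L c \<Longrightarrow> division_sudoku L' \<Longrightarrow> has_config L' c' \<Longrightarrow>
    F L = F L' \<longleftrightarrow> G c = G c'"
  shows "card (F ` {L. division_sudoku L}) = card (G ` set reps)"
proof -
  define rep where "rep L = (SOME c. c \<in> set reps \<and> has_config L c)" for L
  have rep: "rep L \<in> set reps \<and> has_config L (rep L)" if "division_sudoku L" for L
    unfolding rep_def by (rule someI_ex) (use division_sudoku_rep[OF that] in blast)
  have "card (F ` {L. division_sudoku L}) = card ((\<lambda>L. G (rep L)) ` {L. division_sudoku L})"
    using rep FG by (intro card_image_cong_eq) simp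
  also have "(\<lambda>L. G (rep L)) ` {L. division_sudoku L} = G ` set reps"
  proof (intro equalityI image_subsetI)
    show "G (rep L) \<in> G ` set reps" if "L \<in> {L. division_sudoku L}" for L
      using rep that by blast
    show "G c \<in> (\<lambda>L. G (rep L)) ` {L. division_sudoku L}" if c: "c \<in> set reps" for c
    proof -
      obtain L where L: "division_sudoku L" "has_config L c"
        using valid_realized[OF reps_valid[OF c]] by blast
      then have "G c = G (rep L)"
        using FG[OF L, of L "rep L"] rep by blast
      with L(1) show ?thesis
        by blast
    qed
  qed
  finally show ?thesis .
qed

theorem proposition4p10:
  shows "card (iota_class ` {L. division_sudoku L}) = 148 \<and>
         card (mu_class ` {L. division_sudoku L}) = 139 \<and>
         card ((\<lambda>L. (iota_class L, mu_class L)) ` {L. division_sudoku L}) = 183"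
proof -
  let ?I = "\<lambda>c. canon (iota_cube c)" and ?M = "\<lambda>c. canon (mu_cube c)"
  have "card (iota_class ` {L. division_sudoku L}) = card (?I ` set reps)"
    by (intro card_classes iota_class_config)
  moreover have "card (mu_class ` {L. division_sudoku L}) = card (?M ` set reps)"
    by (intro card_classes mu_class_config)
  moreover have "card ((\<lambda>L. (iota_class L, mu_class L)) ` {L. division_sudoku L}) = card ((\<lambda>c. (?I c, ?M c)) ` set reps)"
    using iota_class_config mu_class_config by (intro card_classes) simp
  moreover have "tally reps = (card (?I ` set reps), card (?M ` set reps), card ((\<lambda>c. (?I c, ?M c)) ` set reps))"
    by (simp add: tally_def Let_def image_image)
  ultimately show ?thesis
    using tally_reps by simp
qed

end
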